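(* Let $\mu$ be a Borel probability measure on $\mathbb{R}$ with mean zero and variance one, and let $\alpha\in\mathbb{R}$. Suppose $N\ge 1$ tends to infinity through positive real values, and let $M=M(N)>0$ be a positive real-valued function of $N$ such that $M N^{\alpha+\frac12}\to t$ as $N\to\infty$ for some $t>0$. Then, as $N\to\infty$: (1) if $\alpha>-\frac12$, then $D_{N^\alpha}\big((\mu^{\boxplus N})^{\uplus M}\big)$ converges weakly to $\mu_{C_t}$; (2) if $\alpha=-\frac12$, then $D_{N^\alpha}\big((\mu^{\boxplus N})^{\uplus M}\big)$ converges weakly to $\mu_{\rm sc}^{\uplus t}$; (3) if $\alpha<-\frac12$, then $D_{N^\alpha}\big((\mu^{\boxplus N})^{\uplus M}\big)$ converges weakly to $\delta_0$. Here $\mu_{C_t}$ is the Cauchy distribution with parameter $t$, $\mu_{\rm sc}$ is the standard Wigner semicircle law, and $\delta_0$ is the point mass at $0$.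
   Context: Let $\mathcal{P}$ be the set of Borel probability measures on $\mathbb{R}$ and $\mathbb{C}^+$ the open complex upper half-plane. Dilation: for $\mu\in\mathcal{P}$ and $c\ne 0$, $D_c(\mu)(B):=\mu(c^{-1}B)$ for Borel $B\subset\mathbb{R}$ (push-forward under $x\mapsto cx$). Transforms: for $\mu\in\mathcal{P}$, the Cauchy transform is $G_\mu(z)=\int_{\mathbb{R}}\frac{1}{z-x}\,\mu(dx)$ and the F-transform is $F_\mu(z)=1/G_\mu(z)$, for $z\in\mathbb{C}^+$; $F_\mu$ is analytic and maps $\mathbb{C}^+$ into itself, and $F_\mu$ determines $\mu$. Free convolution power: for $\lambda,R>0$ let $\Gamma_{\lambda,R}=\{z\in\mathbb{C}^+:|\mathrm{Re}\,z|<\lambda\,\mathrm{Im}\,z,\ \mathrm{Im}\,z>R\}$. For every $\mu\in\mathcal{P}$ there are $\lambda,R>0$ such that $F_\mu$ has an analytic right inverse $F_\mu^{\langle-1\rangle}:\Gamma_{\lambda,R}\to\mathbb{C}^+$ (so $F_\mu(F_\mu^{\langle-1\rangle}(z))=z$ on $\Gamma_{\lambda,R}$) with $F_\mu^{\langle-1\rangle}(z)=z(1+o(1))$ as $z\to\infty$ non-tangentially (i.e. within a cone $|\mathrm{Re}\,z|<\beta\,\mathrm{Im}\,z$, $\beta>0$). The Voiculescu transform of $\mu$ is $\varphi_\mu(z)=F_\mu^{\langle-1\rangle}(z)-z$ on $\Gamma_{\lambda,R}$. Additive free convolution $\boxplus$ satisfies $\varphi_{\mu\boxplus\nu}=\varphi_\mu+\varphi_\nu$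 on some $\Gamma_{\lambda,R}$. For $\mu\in\mathcal{P}$ and real $s\ge 1$, the additive free convolution power $\mu^{\boxplus s}\in\mathcal{P}$ is the probability measure with $\varphi_{\mu^{\boxplus s}}=s\,\varphi_\mu$ on some domain $\Gamma_{\lambda,R}$ (it is known to exist for every $\mu\in\mathcal{P}$ and every real $s\ge1$). Boolean convolution power: for $\mu\in\mathcal{P}$ and real $s>0$, $\mu^{\uplus s}\in\mathcal{P}$ is the probability measure determined by $F_{\mu^{\uplus s}}(z)=sF_\mu(z)+(1-s)z$ for $z\in\mathbb{C}^+$ (it is known to exist for every $\mu\in\mathcal{P}$ and every real $s>0$). Distributions: $\mu_{C_t}(dx)=\frac{t}{\pi(x^2+t^2)}\,dx$ for $t>0$; $\mu_{\rm sc}(dx)=\frac{1}{2\pi}\sqrt{4-x^2}\,\mathbf{1}_{[-2,2]}(x)\,dx$. The parameters $N$ and $M$ need not be integers. *)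

theory Defs
  imports "HOL-Probability.Probability" "HOL-Complex_Analysis.Complex_Analysis"
begin

text \<open>Borel probability measures on the real line are rendered by the library locale
  \<^locale>\<open>real_distribution\<close>.\<close>

definition dilation :: "real \<Rightarrow> real measure \<Rightarrow> real measure" where
  "dilation c \<mu> = distr \<mu> borel (\<lambda>x. c * x)"

definition upper_half_plane :: "complex set" where
  "upper_half_plane = {z. Im z > 0}"

definition cauchy_transform :: "real measure \<Rightarrow> complex \<Rightarrow> complex" where
  "cauchy_transform \<mu> z = (LINT x|\<mu>. 1 / (z - complex_of_real x))"

definition F_transform :: "real measure \<Rightarrow> complex \<Rightarrow> complex" where
  "F_transform \<mu> z = 1 / cauchy_transform \<mu> z"

definition truncated_cone :: "real \<Rightarrow> real \<Rightarrow> complex set" where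
  "truncated_cone \<kappa> R = {z \<in> upper_half_plane. \<bar>Re z\<bar> < \<kappa> * Im z \<and> Im z > R}"

text \<open>The growth condition $g(z) = z(1+o(1))$ is imposed as $z \to \infty$ inside the part
  of the domain of $g$ that lies in a cone $|\mathrm{Re}\,z| < \beta\,\mathrm{Im}\,z$.\<close>

definition F_right_inverse ::
    "real measure \<Rightarrow> real \<Rightarrow> real \<Rightarrow> (complex \<Rightarrow> complex) \<Rightarrow> bool" where
  "F_right_inverse \<mu> \<kappa> R g \<longleftrightarrow>
     g holomorphic_on truncated_cone \<kappa> R \<and>
     g ` truncated_cone \<kappa> R \<subseteq> upper_half_plane \<and>
     (\<forall>z\<in>truncated_cone \<kappa> R. F_transform \<mu> (g z) = z) \<and>
     (\<forall>\<beta>>0. ((\<lambda>z. g z / z) \<longlongrightarrow> 1)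
        (inf at_infinity (principal {z \<in> truncated_cone \<kappa> R. \<bar>Re z\<bar> < \<beta> * Im z})))"

text \<open>\<open>voiculescu_transform_on \<mu> \<kappa> R \<phi>\<close> says that \<open>\<phi>\<close> is, on the truncated cone, the Voiculescu
  transform of \<open>\<mu>\<close>.  It is a relation because the domain on which the right inverse exists
  depends on \<open>\<mu>\<close>.\<close>

definition voiculescu_transform_on ::
    "real measure \<Rightarrow> real \<Rightarrow> real \<Rightarrow> (complex \<Rightarrow> complex) \<Rightarrow> bool" where
  "voiculescu_transform_on \<mu> \<kappa> R \<phi> \<longleftrightarrow>
     (\<exists>g. F_right_inverse \<mu> \<kappa> R g \<and> (\<forall>z\<in>truncated_cone \<kappa> R. \<phi> z = g z - z))"

text \<open>The convolution powers are the probability measures singled out by their transforms;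
  they are meaningful for $s \ge 1$ (free) and $s > 0$ (Boolean), where existence and
  uniqueness hold.\<close>

definition is_free_power :: "real measure \<Rightarrow> real \<Rightarrow> real measure \<Rightarrow> bool" where
  "is_free_power \<mu> s \<nu> \<longleftrightarrow>
     real_distribution \<nu> \<and>
     (\<exists>\<kappa>>0. \<exists>R>0. \<exists>\<phi> \<psi>.
        voiculescu_transform_on \<mu> \<kappa> R \<phi> \<and> voiculescu_transform_on \<nu> \<kappa> R \<psi> \<and>
        (\<forall>z\<in>truncated_cone \<kappa> R. \<psi> z = complex_of_real s * \<phi> z))"

definition free_power :: "real measure \<Rightarrow> real \<Rightarrow> real measure" where
  "free_power \<mu> s = (THE \<nu>. is_free_power \<mu> s \<nu>)"

definition is_boolean_power :: "real measure \<Rightarrow> real \<Rightarrow> real measure \<Rightarrow> bool" where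
  "is_boolean_power \<mu> s \<nu> \<longleftrightarrow>
     real_distribution \<nu> \<and>
     (\<forall>z\<in>upper_half_plane.
        F_transform \<nu> z = complex_of_real s * F_transform \<mu> z + (1 - complex_of_real s) * z)"

definition boolean_power :: "real measure \<Rightarrow> real \<Rightarrow> real measure" where
  "boolean_power \<mu> s = (THE \<nu>. is_boolean_power \<mu> s \<nu>)"

definition cauchy_distribution :: "real \<Rightarrow> real measure" where
  "cauchy_distribution t = density lborel (\<lambda>x. ennreal (t / (pi * (x\<^sup>2 + t\<^sup>2))))"

definition semicircle_distribution :: "real measure" where
  "semicircle_distribution =
     density lborel (\<lambda>x. ennreal (1 / (2 * pi) * sqrt (4 - x\<^sup>2) * indicator {-2..2} x))"

text \<open>Weak convergence along an arbitrary filter; the library notion \<^const>\<open>weak_conv_m\<close>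
  only covers sequences, and the lemma below shows that the two agree there.\<close>

definition weakly_converges :: "('i \<Rightarrow> real measure) \<Rightarrow> real measure \<Rightarrow> 'i filter \<Rightarrow> bool" where
  "weakly_converges \<nu> \<mu> \<FF> \<longleftrightarrow>
     (\<forall>f :: real \<Rightarrow> real. continuous_on UNIV f \<and> bounded (range f) \<longrightarrow>
        ((\<lambda>i. LINT x|\<nu> i. f x) \<longlongrightarrow> (LINT x|\<mu>. f x)) \<FF>)"

lemma weakly_converges_sequentially_iff:
  assumes "\<And>n. real_distribution (\<nu> n)" and "real_distribution \<mu>"
  shows "weakly_converges \<nu> \<mu> sequentially \<longleftrightarrow> weak_conv_m \<nu> \<mu>"
proof
  assume w: "weakly_converges \<nu> \<mu> sequentially"
  show "weak_conv_m \<nu> \<mu>"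
  proof (rule integral_bdd_continuous_conv_imp_weak_conv[OF assms])
    fix f :: "real \<Rightarrow> real"
    assume "\<And>x. isCont f x" and "\<And>x. \<bar>f x\<bar> \<le> 1"
    then have "continuous_on UNIV f" and "bounded (range f)"
      by (auto simp: continuous_at_imp_continuous_on bounded_iff)
    then show "(\<lambda>n. integral\<^sup>L (\<nu> n) f) \<longlonglongrightarrow> integral\<^sup>L \<mu> f"
      using w unfolding weakly_converges_def by blast
  qed
next
  assume w: "weak_conv_m \<nu> \<mu>"
  show "weakly_converges \<nu> \<mu> sequentially"
    unfolding weakly_converges_def
  proof (intro allI impI)
    fix f :: "real \<Rightarrow> real"
    assume f: "continuous_on UNIV f \<and> bounded (range f)"
    then obtain B where "\<And>x. norm (f x) \<le> B"
      by (auto simp: bounded_iff)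
    moreover have "\<And>x. isCont f x"
      using f by (simp add: continuous_on_eq_continuous_at)
    ultimately show "(\<lambda>n. LINT x|\<nu> n. f x) \<longlonglongrightarrow> (LINT x|\<mu>. f x)"
      using weak_conv_imp_integral_bdd_continuous_conv[OF assms w] by blast
  qed
qed

end

theory Submission
  imports Defs "HOL-Real_Asymp.Real_Asymp"
begin

text \<open>
  For \<open>\<mu>\<close> with mean zero and variance one, \<open>F\<close> is the identity plus an excess \<open>h\<close> with \<open>Im h \<ge> 0\<close>,
  \<open>\<bar>h w\<bar> \<le> 1 / Im w\<close> and \<open>w h w \<longlongrightarrow> -1\<close> nontangentially. Conversely, every analytic \<open>F\<close> with
  \<open>Im (F z) \<ge> Im z\<close> and \<open>\<bar>F z - z\<bar> \<le> C / Im z\<close> is the F-transform of a unique distribution, obtained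
  from the boundary densities of \<open>1 / F (z + \<i> \<epsilon>)\<close> by a tightness argument. Hence the Boolean power
  exists, and the free power \<open>s\<close> has F-transform \<open>z + s h (\<omega> z)\<close>, where the subordination function \<open>\<omega> z\<close>
  is the unique solution of \<open>w = z + (s - 1) h w\<close> in the upper half-plane.

  The F-transform of the dilated measure is then \<open>z + M N powr (\<alpha> + 1/2) * sqrt N * h (sqrt N * w)\<close>,
  where \<open>w\<close> solves \<open>w = \<zeta> + (1 - 1/N) * sqrt N * h (sqrt N * w)\<close> with \<open>\<zeta> = N powr (- \<alpha> - 1/2) * z\<close>.
  The right-hand side tends to \<open>\<zeta> - 1 / w\<close>, and the three regimes correspond to \<open>\<zeta>\<close> tending to \<open>0\<close> (where
  \<open>w \<longlongrightarrow> \<i>\<close>), being equal to \<open>z\<close> (the semicircle equation \<open>w + 1 / w = z\<close>), and tending to infinity.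
\<close>

section \<open>Cauchy and F-transforms\<close>

text \<open>Both powers are definite descriptions, so nothing can be said about
  \<open>free_power\<close> or \<open>boolean_power\<close> before existence and uniqueness are
  proved; this is why a converse for F-transforms and the injectivity of the Cauchy transform
  precede any limit. The bound on \<open>h\<close> is Cauchy-Schwarz: mean zero allows the constant
  \<open>G\<close> to be subtracted from the kernel \<open>1 / (z - x)\<close>, and variance one
  then gives \<open>\<bar>h z\<bar>\<^sup>2 * Im z \<le> Im (h z)\<close>. Applied to two kernels,
  Cauchy-Schwarz is the Schwarz-Pick inequality, which makes subordination values unique; their
  existence is Brouwer's theorem. Neither argument iterates analytic maps, and all real
  \<open>s \<ge> 1\<close> are treated alike. The obstacle in the limit is the regime where \<zeta>
  tends to 0: the a priori bound \<open>Im w \<ge> Im \<zeta>\<close> degenerates and gives no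
  control of \<open>w\<close> from below. There a solution is constructed close to \<i> for each
  large \<open>N\<close>, and uniqueness identifies it with the subordination value.\<close>

text \<open>Cauchy-Schwarz, from the discriminant of the quadratic
  \<open>LINT x|M. (t * cmod (f x) - cmod (g x))\<^sup>2\<close> in \<open>t\<close>. It is applied
  with \<open>g\<close> a Cauchy kernel, possibly centred.\<close>

lemma norm_integral_mult_squared_le:
  fixes f g :: "'a \<Rightarrow> complex"
  assumes [measurable]: "f \<in> borel_measurable M" "g \<in> borel_measurable M"
    and f: "integrable M (\<lambda>x. (cmod (f x))\<^sup>2)" and g: "integrable M (\<lambda>x. (cmod (g x))\<^sup>2)"
  shows "(cmod (LINT x|M. f x * g x))\<^sup>2 \<le> (LINT x|M. (cmod (f x))\<^sup>2) * (LINT x|M. (cmod (g x))\<^sup>2)"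
proof -
  define a where "a = (LINT x|M. (cmod (f x))\<^sup>2)"
  define b where "b = (LINT x|M. (cmod (g x))\<^sup>2)"
  define c where "c = (LINT x|M. cmod (f x) * cmod (g x))"
  have int: "integrable M (\<lambda>x. cmod (f x) * cmod (g x))"
  proof (rule Bochner_Integration.integrable_bound[OF Bochner_Integration.integrable_add[OF f g]])
    show "AE x in M. norm (cmod (f x) * cmod (g x)) \<le> norm ((cmod (f x))\<^sup>2 + (cmod (g x))\<^sup>2)"
    proof (intro AE_I2)
      fix x
      have "2 * (cmod (f x) * cmod (g x)) \<le> (cmod (f x))\<^sup>2 + (cmod (g x))\<^sup>2"
        using sum_squares_bound[of "cmod (f x)" "cmod (g x)"] by simp
      moreover have "0 \<le> cmod (f x) * cmod (g x)" by simp
      ultimately show "norm (cmod (f x) * cmod (g x)) \<le> norm ((cmod (f x))\<^sup>2 + (cmod (g x))\<^sup>2)"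
        unfolding real_norm_def by linarith
    qed
  qed simp
  have quad: "0 \<le> a * t\<^sup>2 - 2 * c * t + b" for t
  proof -
    have "0 \<le> (LINT x|M. (t * cmod (f x) - cmod (g x))\<^sup>2)" by simp
    also have "(\<lambda>x. (t * cmod (f x) - cmod (g x))\<^sup>2) =
        (\<lambda>x. t\<^sup>2 * (cmod (f x))\<^sup>2 - 2 * t * (cmod (f x) * cmod (g x)) + (cmod (g x))\<^sup>2)"
      by (auto simp: power2_eq_square algebra_simps)
    also have "(LINT x|M. t\<^sup>2 * (cmod (f x))\<^sup>2 - 2 * t * (cmod (f x) * cmod (g x)) + (cmod (g x))\<^sup>2)
        = t\<^sup>2 * a - 2 * t * c + b"
      unfolding a_def b_def c_def using f g int by simp
    finally show ?thesis by (simp add: mult_ac)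
  qed
  have "a \<ge> 0" unfolding a_def by simp
  have "c \<ge> 0" unfolding c_def by simp
  have "c\<^sup>2 \<le> a * b"
  proof (cases "a = 0")
    case True
    have "c = 0"
    proof (rule ccontr)
      assume "c \<noteq> 0"
      \<comment> \<open>For \<open>a = 0\<close> the quadratic is affine in \<open>t\<close>, and at
        this \<open>t\<close> its value is \<open>-1\<close>.\<close>
      then show False using quad[of "(b + 1) / (2 * c)"] True by (simp add: field_simps)
    qed
    then show ?thesis using True by simp
  next
    case False
    then have "a > 0" using \<open>a \<ge> 0\<close> by simp
    then have "0 \<le> b - c\<^sup>2 / a" using quad[of "c / a"] by (simp add: field_simps power2_eq_square)
    then show ?thesis using \<open>a > 0\<close> by (simp add: field_simps)
  qed
  moreover have "cmod (LINT x|M. f x * g x) \<le> c"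
    unfolding c_def using integral_norm_bound[of M "\<lambda>x. f x * g x"] by (simp add: norm_mult)
  ultimately show ?thesis
    unfolding a_def b_def by (meson norm_ge_zero order_trans power_mono)
qed

lemma cmod_diff_squared:
  "(cmod (a - b))\<^sup>2 = (cmod a)\<^sup>2 - 2 * Re (a * cnj b) + (cmod b)\<^sup>2"
  unfolding cmod_power2 by (simp add: power2_eq_square algebra_simps)

lemma open_upper_half_plane: "open upper_half_plane"
  unfolding upper_half_plane_def by (rule open_halfspace_Im_gt)

lemma convex_upper_half_plane: "convex upper_half_plane"
  unfolding upper_half_plane_def by (rule convex_halfspace_Im_gt)

lemma Im_le_norm_diff_of_real: "Im z \<le> cmod (z - of_real x)"
  using abs_Im_le_cmod[of "z - of_real x"] by simp

lemma norm_inverse_diff_of_real_le: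
  assumes "Im z > 0"
  shows "cmod (1 / (z - of_real x)) \<le> 1 / Im z"
  using Im_le_norm_diff_of_real[of z x] assms by (simp add: norm_divide frac_le)

lemma diff_of_real_nonzero: "Im z > 0 \<Longrightarrow> z - complex_of_real x \<noteq> 0"
  by (auto simp: complex_eq_iff)

context real_distribution
begin

lemma integrable_cauchy_kernel:
  assumes "Im z > 0"
  shows "integrable M (\<lambda>x. 1 / (z - complex_of_real x))"
  using norm_inverse_diff_of_real_le[OF assms]
  by (intro integrable_const_bound[where B = "1 / Im z"]) auto

lemma integrable_cauchy_kernel_squared:
  assumes "Im z > 0"
  shows "integrable M (\<lambda>x. (cmod (1 / (z - complex_of_real x)))\<^sup>2)"
proof (intro integrable_const_bound[where B = "(1 / Im z)\<^sup>2"] AE_I2)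
  show "norm ((cmod (1 / (z - complex_of_real x)))\<^sup>2) \<le> (1 / Im z)\<^sup>2" for x
    using norm_inverse_diff_of_real_le[OF assms, of x] by (simp add: norm_divide power_mono)
qed simp

lemma Im_cauchy_transform:
  assumes "Im z > 0"
  shows "Im (cauchy_transform M z) = - Im z * (LINT x|M. (cmod (1 / (z - complex_of_real x)))\<^sup>2)"
proof -
  have "Im (cauchy_transform M z) = (LINT x|M. Im (1 / (z - complex_of_real x)))"
    unfolding cauchy_transform_def by (rule integral_Im[OF integrable_cauchy_kernel[OF assms], symmetric])
  also have "\<dots> = (LINT x|M. - Im z * (cmod (1 / (z - complex_of_real x)))\<^sup>2)"
    by (intro Bochner_Integration.integral_cong)
      (auto simp: Im_divide norm_divide cmod_power2 power_divide)
  finally show ?thesis by simp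
qed

lemma norm_cauchy_transform_le:
  assumes "Im z > 0"
  shows "cmod (cauchy_transform M z) \<le> 1 / Im z"
proof -
  have "cmod (cauchy_transform M z) \<le> (LINT x|M. cmod (1 / (z - complex_of_real x)))"
    unfolding cauchy_transform_def by (rule integral_norm_bound)
  also have "\<dots> \<le> (LINT x|M. 1 / Im z)"
    using integrable_cauchy_kernel[OF assms] norm_inverse_diff_of_real_le[OF assms]
    by (intro integral_mono) auto
  finally show ?thesis using prob_space by simp
qed

text \<open>Cauchy-Schwarz against the constant function 1. Divided by the squared modulus, this is
  the inequality \<open>Im (F_transform M z) \<ge> Im z\<close>.\<close>

lemma cauchy_transform_squared_le:
  assumes "Im z > 0"
  shows "(cmod (cauchy_transform M z))\<^sup>2 * Im z \<le> - Im (cauchy_transform M z)"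
proof -
  have "(cmod (LINT x|M. 1 * (1 / (z - complex_of_real x))))\<^sup>2 \<le>
     (LINT x|M. (cmod 1)\<^sup>2) * (LINT x|M. (cmod (1 / (z - complex_of_real x)))\<^sup>2)"
    using integrable_cauchy_kernel_squared[OF assms]
    by (intro norm_integral_mult_squared_le) auto
  then have "(cmod (cauchy_transform M z))\<^sup>2 \<le> (LINT x|M. (cmod (1 / (z - complex_of_real x)))\<^sup>2)"
    using prob_space by (simp add: cauchy_transform_def)
  then show ?thesis
    using assms unfolding Im_cauchy_transform[OF assms] by (simp add: mult.commute)
qed

lemma Im_cauchy_transform_neg:
  assumes "Im z > 0"
  shows "Im (cauchy_transform M z) < 0"
proof -
  have "(LINT x|M. (cmod (1 / (z - complex_of_real x)))\<^sup>2) \<noteq> 0"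
  proof
    assume "(LINT x|M. (cmod (1 / (z - complex_of_real x)))\<^sup>2) = 0"
    then have "AE x in M. (cmod (1 / (z - complex_of_real x)))\<^sup>2 = 0"
      using integrable_cauchy_kernel_squared[OF assms] by (subst (asm) integral_nonneg_eq_0_iff_AE) auto
    then have "AE x in M. False"
      by eventually_elim (use diff_of_real_nonzero[OF assms] in auto)
    then show False by simp
  qed
  moreover have "(LINT x|M. (cmod (1 / (z - complex_of_real x)))\<^sup>2) \<ge> 0" by simp
  ultimately show ?thesis
    using assms unfolding Im_cauchy_transform[OF assms] by (simp add: less_le)
qed

lemma cauchy_transform_nonzero: "Im z > 0 \<Longrightarrow> cauchy_transform M z \<noteq> 0"
  using Im_cauchy_transform_neg[of z] by auto

text \<open>The resolvent identity: difference quotients become integrals of products of kernels,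
  which serves both the Schwarz-Pick bound and differentiability.\<close>

lemma cauchy_transform_diff:
  assumes "Im z > 0" "Im w > 0"
  shows "cauchy_transform M w - cauchy_transform M z =
     (z - w) * (LINT x|M. (1 / (w - complex_of_real x)) * (1 / (z - complex_of_real x)))"
proof -
  have "cauchy_transform M w - cauchy_transform M z =
      (LINT x|M. 1 / (w - complex_of_real x) - 1 / (z - complex_of_real x))"
    unfolding cauchy_transform_def using assms by (simp add: integrable_cauchy_kernel)
  also have "\<dots> = (LINT x|M. (z - w) * ((1 / (w - complex_of_real x)) * (1 / (z - complex_of_real x))))"
    using diff_of_real_nonzero[OF assms(1)] diff_of_real_nonzero[OF assms(2)]
    by (intro Bochner_Integration.integral_cong) (auto simp: field_simps)
  also have "\<dots> = (z - w) * (LINT x|M. (1 / (w - complex_of_real x)) * (1 / (z - complex_of_real x)))"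
    by (rule integral_mult_right_zero)
  finally show ?thesis .
qed

text \<open>By the resolvent identity the difference quotient is a pairing of two kernels.
  Cauchy-Schwarz bounds it by their square integrals, which \<open>Im_cauchy_transform\<close>
  expresses through the imaginary parts.\<close>

lemma cauchy_transform_schwarz_pick:
  assumes "Im z > 0" "Im w > 0"
  shows "(cmod (cauchy_transform M w - cauchy_transform M z))\<^sup>2 * (Im w * Im z) \<le>
     (cmod (w - z))\<^sup>2 * (Im (cauchy_transform M w) * Im (cauchy_transform M z))"
proof -
  let ?k = "\<lambda>z. LINT x|M. (cmod (1 / (z - complex_of_real x)))\<^sup>2"
  have "(cmod (LINT x|M. (1 / (w - complex_of_real x)) * (1 / (z - complex_of_real x))))\<^sup>2 \<le> ?k w * ?k z"
    using integrable_cauchy_kernel_squared[OF assms(1)] integrable_cauchy_kernel_squared[OF assms(2)]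
    by (intro norm_integral_mult_squared_le) auto
  then have "(cmod (w - z))\<^sup>2 * (cmod (LINT x|M. (1 / (w - complex_of_real x)) * (1 / (z - complex_of_real x))))\<^sup>2 * (Im w * Im z)
      \<le> (cmod (w - z))\<^sup>2 * (?k w * ?k z) * (Im w * Im z)"
    using assms by (intro mult_right_mono mult_left_mono) auto
  then show ?thesis
    unfolding cauchy_transform_diff[OF assms] Im_cauchy_transform[OF assms(1)] Im_cauchy_transform[OF assms(2)]
    by (simp add: norm_mult power_mult_distrib norm_minus_commute mult_ac)
qed

lemma holomorphic_cauchy_transform: "cauchy_transform M holomorphic_on upper_half_plane"
proof -
  have "(cauchy_transform M has_field_derivative
      - (LINT x|M. (1 / (z - complex_of_real x)) * (1 / (z - complex_of_real x)))) (at z)"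
    if z: "Im z > 0" for z
    unfolding has_field_derivative_iff
  proof (rule Lim_transform_eventually)
    let ?D = "\<lambda>w. LINT x|M. (1 / (w - complex_of_real x)) * (1 / (z - complex_of_real x))"
    have int: "integrable M (\<lambda>x. (1 / (w - complex_of_real x)) * (1 / (z - complex_of_real x)))"
      if w: "Im w > 0" for w
    proof (intro integrable_const_bound[where B = "1 / Im w * (1 / Im z)"] AE_I2)
      show "norm (1 / (w - complex_of_real x) * (1 / (z - complex_of_real x))) \<le> 1 / Im w * (1 / Im z)" for x
        unfolding norm_mult
        by (intro mult_mono norm_inverse_diff_of_real_le z w) (use w in auto)
    qed simp
    \<comment> \<open>Above height \<open>Im z / 2\<close> the kernel at \<open>w\<close> is at most
      \<open>2 / Im z\<close>, uniformly in \<open>x\<close>, so the error below is linear in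
      \<open>cmod (w - z)\<close>.\<close>
    have ev: "\<forall>\<^sub>F w in at z. Im z / 2 < Im w"
      using z by (intro order_tendstoD) (auto intro!: tendsto_eq_intros)
    have "((\<lambda>w. ?D w - ?D z) \<longlongrightarrow> 0) (at z)"
    proof (rule Lim_null_comparison)
      show "\<forall>\<^sub>F w in at z. norm (?D w - ?D z) \<le> cmod (w - z) * (2 / Im z * (1 / Im z) * (1 / Im z))"
        using ev
      proof eventually_elim
        case (elim w)
        with z have w: "Im w > 0" by simp
        have "cmod (?D w - ?D z) = cmod (LINT x|M. (1 / (w - complex_of_real x)) * (1 / (z - complex_of_real x))
            - (1 / (z - complex_of_real x)) * (1 / (z - complex_of_real x)))"
          using int[OF w] int[OF z] by simp
        also have "\<dots> \<le> (LINT x|M. cmod ((1 / (w - complex_of_real x)) * (1 / (z - complex_of_real x))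
            - (1 / (z - complex_of_real x)) * (1 / (z - complex_of_real x))))"
          by (rule integral_norm_bound)
        also have "\<dots> \<le> (LINT x|M. cmod (w - z) * (2 / Im z * (1 / Im z) * (1 / Im z)))"
        proof (rule integral_mono)
          show "integrable M (\<lambda>x. cmod ((1 / (w - complex_of_real x)) * (1 / (z - complex_of_real x))
            - (1 / (z - complex_of_real x)) * (1 / (z - complex_of_real x))))"
            using int[OF w] int[OF z] by (intro integrable_norm) simp
          fix x
          have "cmod ((1 / (w - complex_of_real x)) * (1 / (z - complex_of_real x))
            - (1 / (z - complex_of_real x)) * (1 / (z - complex_of_real x))) =
            cmod (- (w - z) * ((1 / (w - complex_of_real x)) * (1 / (z - complex_of_real x)) * (1 / (z - complex_of_real x))))"
          proof -
            have "1 / (w - complex_of_real x) - 1 / (z - complex_of_real x) =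
                - (w - z) * ((1 / (w - complex_of_real x)) * (1 / (z - complex_of_real x)))"
              using diff_of_real_nonzero[OF w, of x] diff_of_real_nonzero[OF z, of x]
              by (simp add: field_simps)
            then show ?thesis by (simp only: left_diff_distrib[symmetric] mult.assoc)
          qed
          also have "\<dots> = cmod (w - z) * (cmod (1 / (w - complex_of_real x)) * cmod (1 / (z - complex_of_real x)) * cmod (1 / (z - complex_of_real x)))"
            by (simp only: norm_mult norm_minus_cancel)
          also have "\<dots> \<le> cmod (w - z) * (2 / Im z * (1 / Im z) * (1 / Im z))"
          proof -
            have "cmod (1 / (w - complex_of_real x)) \<le> 1 / Im w"
              by (rule norm_inverse_diff_of_real_le[OF w])
            also have "\<dots> \<le> 2 / Im z" using elim z w by (simp add: field_simps)
            finally show ?thesis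
              using z by (intro mult_left_mono mult_mono norm_inverse_diff_of_real_le) auto
          qed
          finally show "cmod ((1 / (w - complex_of_real x)) * (1 / (z - complex_of_real x))
            - (1 / (z - complex_of_real x)) * (1 / (z - complex_of_real x)))
            \<le> cmod (w - z) * (2 / Im z * (1 / Im z) * (1 / Im z))" .
        qed simp
        finally show ?case using prob_space by simp
      qed
      show "((\<lambda>w. cmod (w - z) * (2 / Im z * (1 / Im z) * (1 / Im z))) \<longlongrightarrow> 0) (at z)"
        using z by (auto intro!: tendsto_eq_intros)
    qed
    then show "((\<lambda>w. - ?D w) \<longlongrightarrow> - ?D z) (at z)"
      using Lim_null[of ?D "?D z" "at z"] by (intro tendsto_minus) simp
    have "\<forall>\<^sub>F w in at z. w \<noteq> z" by (simp add: eventually_at_filter)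
    then show "\<forall>\<^sub>F w in at z. - ?D w = (cauchy_transform M w - cauchy_transform M z) / (w - z)"
      using ev by eventually_elim (use z cauchy_transform_diff[OF z] in \<open>auto simp: field_simps\<close>)
  qed
  then show ?thesis
    unfolding upper_half_plane_def
    by (auto intro!: holomorphic_on_subset[OF holomorphic_onI] intro: has_field_derivative_at_within
      simp: holomorphic_on_def field_differentiable_def)
qed

lemma holomorphic_F_transform: "F_transform M holomorphic_on upper_half_plane"
proof -
  have "(\<lambda>z. 1 / cauchy_transform M z) holomorphic_on upper_half_plane"
    by (intro holomorphic_intros holomorphic_cauchy_transform)
      (auto simp: cauchy_transform_nonzero upper_half_plane_def)
  then show ?thesis by (simp add: F_transform_def[abs_def])
qed

lemma Im_F_transform:
  "Im (F_transform M z) = - Im (cauchy_transform M z) / (cmod (cauchy_transform M z))\<^sup>2"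
  by (simp add: F_transform_def Im_divide cmod_power2)

lemma Im_F_transform_ge:
  assumes "Im z > 0"
  shows "Im (F_transform M z) \<ge> Im z"
  using cauchy_transform_squared_le[OF assms] cauchy_transform_nonzero[OF assms]
  unfolding Im_F_transform by (simp add: field_simps)

text \<open>The inequality is invariant under inversion: both sides of its version for
  \<open>G\<close> are divided by the same number \<open>c\<close>.\<close>

lemma F_transform_schwarz_pick:
  assumes z: "Im z > 0" and w: "Im w > 0"
  shows "(cmod (F_transform M w - F_transform M z))\<^sup>2 * (Im w * Im z) \<le>
     (cmod (w - z))\<^sup>2 * (Im (F_transform M w) * Im (F_transform M z))"
proof -
  let ?G = "cauchy_transform M"
  define c where "c = (cmod (?G w))\<^sup>2 * (cmod (?G z))\<^sup>2"
  have nz: "?G z \<noteq> 0" "?G w \<noteq> 0" using cauchy_transform_nonzero z w by auto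
  then have "c > 0" by (simp add: c_def)
  have "F_transform M w - F_transform M z = - (?G w - ?G z) / (?G w * ?G z)"
    using nz by (simp add: F_transform_def field_simps)
  then have 1: "(cmod (F_transform M w - F_transform M z))\<^sup>2 = (cmod (?G w - ?G z))\<^sup>2 / c"
    by (simp add: norm_divide norm_mult power_divide power_mult_distrib c_def norm_minus_commute)
  have 2: "Im (F_transform M w) * Im (F_transform M z) = Im (?G w) * Im (?G z) / c"
    by (simp add: Im_F_transform c_def)
  show ?thesis
    unfolding 1 2 using cauchy_transform_schwarz_pick[OF z w] \<open>c > 0\<close>
    by (simp add: divide_right_mono field_simps)
qed

end

section \<open>Distributions with mean zero and variance one\<close>

locale standardized_distribution = real_distribution +
  assumes integrable_id: "integrable M (\<lambda>x. x)" and mean_zero: "(LINT x|M. x) = 0"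
    and integrable_square: "integrable M (\<lambda>x. x\<^sup>2)" and second_moment: "(LINT x|M. x\<^sup>2) = 1"
begin

lemma integrable_of_real_id: "integrable M complex_of_real"
  by (rule integrable_of_real[OF integrable_id])

text \<open>Writing \<open>x / (z - x) = z / (z - x) - 1\<close> turns \<open>1 - z * G\<close> into
  an integral with a factor \<open>x\<close>, on which the moment assumptions can act.\<close>

lemma F_transform_diff:
  assumes "Im z > 0"
  shows "F_transform M z - z =
    - (LINT x|M. complex_of_real x / (z - complex_of_real x)) / cauchy_transform M z"
proof -
  have int: "integrable M (\<lambda>x. 1 / (z - complex_of_real x))"
    by (rule integrable_cauchy_kernel[OF assms])
  have "(LINT x|M. complex_of_real x / (z - complex_of_real x)) =
      (LINT x|M. z * (1 / (z - complex_of_real x)) - 1)"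
    using diff_of_real_nonzero[OF assms]
    by (intro Bochner_Integration.integral_cong) (auto simp: field_simps)
  also have "\<dots> = z * cauchy_transform M z - 1"
    unfolding cauchy_transform_def using int prob_space
    by (subst Bochner_Integration.integral_diff) (simp_all del: times_divide_eq_right mult_1_right)
  finally show ?thesis
    using cauchy_transform_nonzero[OF assms] by (simp add: F_transform_def diff_divide_distrib)
qed

text \<open>Since the mean is zero, \<open>K\<close> is also the integral of
  \<open>x * (1 / (z - x) - G)\<close>. Cauchy-Schwarz with second moment one bounds its square by
  the variance \<open>S - (cmod G)\<^sup>2\<close> of the kernel, and the same variance, times
  \<open>Im z / (cmod G)\<^sup>2\<close>, is exactly the imaginary part of
  \<open>F_transform M z - z\<close>.\<close>

lemma norm_F_transform_diff_squared_le:
  assumes z: "Im z > 0"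
  shows "(cmod (F_transform M z - z))\<^sup>2 * Im z \<le> Im (F_transform M z - z)"
proof -
  define G where "G = cauchy_transform M z"
  define S where "S = (LINT x|M. (cmod (1 / (z - complex_of_real x)))\<^sup>2)"
  define K where "K = (LINT x|M. complex_of_real x / (z - complex_of_real x))"
  note [simp] = integrable_of_real_id
  have int: "integrable M (\<lambda>x. 1 / (z - complex_of_real x))"
    by (rule integrable_cauchy_kernel[OF z])
  note int2 = integrable_cauchy_kernel_squared[OF z]
  have G0: "G \<noteq> 0" unfolding G_def by (rule cauchy_transform_nonzero[OF z])
  have expand: "(cmod (1 / (z - complex_of_real x) - G))\<^sup>2 = (cmod (1 / (z - complex_of_real x)))\<^sup>2
      - 2 * Re (1 / (z - complex_of_real x) * cnj G) + (cmod G)\<^sup>2" for x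
    by (rule cmod_diff_squared)
  have intc: "integrable M (\<lambda>x. 1 / (z - complex_of_real x) * cnj G)"
    using int by (rule integrable_mult_left)
  have intRe: "integrable M (\<lambda>x. Re (1 / (z - complex_of_real x) * cnj G))"
    using intc by (rule integrable_Re)
  have "(LINT x|M. (cmod (1 / (z - complex_of_real x) - G))\<^sup>2)
     = S - 2 * (LINT x|M. Re (1 / (z - complex_of_real x) * cnj G)) + (cmod G)\<^sup>2"
    unfolding expand S_def using int2 intRe prob_space by simp
  also have "(LINT x|M. Re (1 / (z - complex_of_real x) * cnj G)) = Re (G * cnj G)"
    unfolding integral_Re[OF intc] Bochner_Integration.integral_mult_left[OF int] by (simp add: G_def cauchy_transform_def)
  also have "Re (G * cnj G) = (cmod G)\<^sup>2"
    by (metis complex_mult_cnj cmod_power2 Re_complex_of_real)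
  finally have var: "(LINT x|M. (cmod (1 / (z - complex_of_real x) - G))\<^sup>2) = S - (cmod G)\<^sup>2"
    by simp
  have int_var: "integrable M (\<lambda>x. (cmod (1 / (z - complex_of_real x) - G))\<^sup>2)"
    unfolding expand using int2 intRe by simp
  have intK: "integrable M (\<lambda>x. complex_of_real x * (1 / (z - complex_of_real x)))"
  proof (rule Bochner_Integration.integrable_bound)
    show "integrable M (\<lambda>x. 1 / Im z * norm (complex_of_real x))"
      by (intro integrable_mult_right integrable_norm) simp
    show "AE x in M. norm (complex_of_real x * (1 / (z - complex_of_real x))) \<le> norm (1 / Im z * norm (complex_of_real x))"
    proof (intro AE_I2)
      fix x
      have "norm (complex_of_real x * (1 / (z - complex_of_real x))) \<le> norm (complex_of_real x) * (1 / Im z)"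
        unfolding norm_mult by (intro mult_left_mono norm_inverse_diff_of_real_le z) simp
      then show "norm (complex_of_real x * (1 / (z - complex_of_real x))) \<le> norm (1 / Im z * norm (complex_of_real x))"
        using z by (simp add: mult.commute)
    qed
  qed simp
  have "K = (LINT x|M. complex_of_real x * (1 / (z - complex_of_real x)) - complex_of_real x * G)"
    unfolding K_def using intK mean_zero by (subst Bochner_Integration.integral_diff) auto
  also have "\<dots> = (LINT x|M. complex_of_real x * (1 / (z - complex_of_real x) - G))"
    by (simp add: right_diff_distrib)
  finally have "(cmod K)\<^sup>2 \<le> (LINT x|M. (cmod (complex_of_real x))\<^sup>2) * (LINT x|M. (cmod (1 / (z - complex_of_real x) - G))\<^sup>2)"
    using integrable_square int_var by (simp only:) (intro norm_integral_mult_squared_le; simp)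
  then have K: "(cmod K)\<^sup>2 \<le> S - (cmod G)\<^sup>2"
    using second_moment by (simp add: var)
  have h: "F_transform M z - z = - K / G"
    unfolding K_def G_def by (rule F_transform_diff[OF z])
  have "Im (F_transform M z - z) = Im z * S / (cmod G)\<^sup>2 - Im z"
    using Im_F_transform[of z] Im_cauchy_transform[OF z] by (simp add: G_def S_def)
  also have "\<dots> = (S - (cmod G)\<^sup>2) / (cmod G)\<^sup>2 * Im z"
    using G0 by (simp add: field_simps)
  also have "\<dots> \<ge> (cmod K)\<^sup>2 / (cmod G)\<^sup>2 * Im z"
    using K z by (intro mult_right_mono divide_right_mono) auto
  finally show ?thesis
    unfolding h by (simp add: norm_divide power_divide)
qed

lemma norm_F_transform_diff_le:
  assumes z: "Im z > 0"
  shows "cmod (F_transform M z - z) \<le> 1 / Im z"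
proof -
  let ?h = "F_transform M z - z"
  have "cmod ?h * (cmod ?h * Im z) \<le> Im ?h"
    using norm_F_transform_diff_squared_le[OF z] by (simp add: power2_eq_square mult_ac)
  also have "\<dots> \<le> cmod ?h * 1" using abs_Im_le_cmod[of ?h] by simp
  finally have "cmod ?h * Im z \<le> 1 \<or> cmod ?h = 0"
    by (metis mult_le_cancel_left_pos norm_ge_zero less_le)
  then show ?thesis using z by (auto simp: field_simps)
qed

text \<open>In the expansion \<open>x / (z - x) = x / z + x\<^sup>2 / (z * (z - x))\<close> the
  first term integrates to zero, which leaves \<open>Q z / z\<^sup>2\<close>. The cone condition
  bounds \<open>z / (z - x)\<close> by \<beta>, so \<open>Q\<close> tends to the second moment by
  dominated convergence.\<close>

lemma F_transform_asymptotic_seq: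
  fixes w :: "nat \<Rightarrow> complex"
  assumes top: "filterlim (\<lambda>n. Im (w n)) at_top sequentially"
    and cone: "\<And>n. cmod (w n) \<le> \<beta> * Im (w n)" and pos: "\<And>n. Im (w n) > 0"
  shows "(\<lambda>n. w n * (F_transform M (w n) - w n)) \<longlonglongrightarrow> -1"
proof -
  define Q where "Q z = (LINT x|M. (complex_of_real x)\<^sup>2 * (z / (z - complex_of_real x)))" for z
  note [simp] = integrable_of_real_id
  have lim0: "filterlim w at_infinity sequentially"
    by (rule filterlim_norm_at_top_imp_at_infinity[OF filterlim_at_top_mono[OF top]])
      (intro always_eventually allI order_trans[OF abs_ge_self abs_Im_le_cmod])
  have inv0: "(\<lambda>n. 1 / w n) \<longlonglongrightarrow> 0"
    using tendsto_divide_0[OF tendsto_const lim0] .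
  have bound: "cmod ((complex_of_real x)\<^sup>2 * (w n / (w n - complex_of_real x))) \<le> \<beta> * x\<^sup>2" for n x
  proof -
    have "cmod (w n / (w n - complex_of_real x)) = cmod (w n) * cmod (1 / (w n - complex_of_real x))"
      by (simp add: norm_divide)
    also have "\<dots> \<le> (\<beta> * Im (w n)) * (1 / Im (w n))"
      using norm_inverse_diff_of_real_le[OF pos] pos[of n] cone[of n] order_trans[OF norm_ge_zero cone[of n]]
      by (intro mult_mono) auto
    also have "\<dots> = \<beta>" using pos[of n] by simp
    finally have "x\<^sup>2 * cmod (w n / (w n - complex_of_real x)) \<le> x\<^sup>2 * \<beta>"
      by (rule mult_left_mono) simp
    then show ?thesis
      by (simp only: norm_mult norm_power norm_of_real power2_abs mult.commute[of \<beta>])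
  qed
  have Qlim: "(\<lambda>n. Q (w n)) \<longlonglongrightarrow> (LINT x|M. (complex_of_real x)\<^sup>2)"
    unfolding Q_def
  proof (rule integral_dominated_convergence[where w = "\<lambda>x. \<beta> * x\<^sup>2"])
    show "AE x in M. (\<lambda>n. (complex_of_real x)\<^sup>2 * (w n / (w n - complex_of_real x))) \<longlonglongrightarrow> (complex_of_real x)\<^sup>2"
    proof (intro AE_I2)
      fix x
      have "(\<lambda>n. (complex_of_real x)\<^sup>2 * (1 / (1 - complex_of_real x * (1 / w n)))) \<longlonglongrightarrow> (complex_of_real x)\<^sup>2 * (1 / (1 - complex_of_real x * 0))"
        by (intro tendsto_intros inv0) auto
      moreover have "1 / (1 - complex_of_real x * (1 / w n)) = w n / (w n - complex_of_real x)" for n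
      proof -
        have "w n \<noteq> 0" using pos[of n] by auto
        then have "1 - complex_of_real x * (1 / w n) = (w n - complex_of_real x) / w n"
          by (simp add: diff_divide_distrib)
        then show ?thesis by simp
      qed
      ultimately show "(\<lambda>n. (complex_of_real x)\<^sup>2 * (w n / (w n - complex_of_real x))) \<longlonglongrightarrow> (complex_of_real x)\<^sup>2"
        by (simp only: mult_zero_right diff_zero div_by_1 mult_1_right)
    qed
  qed (use bound integrable_square in \<open>auto intro!: AE_I2\<close>)
  also have "(LINT x|M. (complex_of_real x)\<^sup>2) = 1"
    using second_moment integral_complex_of_real[of M "\<lambda>x. x\<^sup>2"] by simp
  finally have Qlim: "(\<lambda>n. Q (w n)) \<longlonglongrightarrow> 1" .
  have K: "(LINT x|M. complex_of_real x / (z - complex_of_real x)) = Q z * (1 / z) * (1 / z)"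
    if z: "Im z > 0" and int: "integrable M (\<lambda>x. (complex_of_real x)\<^sup>2 * (z / (z - complex_of_real x)))" for z
  proof -
    have "z \<noteq> 0" using z by auto
    have "(LINT x|M. complex_of_real x / (z - complex_of_real x))
      = (LINT x|M. (1 / z) * complex_of_real x + (1 / z * (1 / z)) * ((complex_of_real x)\<^sup>2 * (z / (z - complex_of_real x))))"
      using diff_of_real_nonzero[OF z] \<open>z \<noteq> 0\<close>
      by (intro Bochner_Integration.integral_cong refl)
        (simp add: divide_simps, simp add: algebra_simps power2_eq_square)
    also have "\<dots> = (1 / z * (1 / z)) * Q z"
      unfolding Q_def using int mean_zero
      by (subst Bochner_Integration.integral_add) (simp_all del: times_divide_eq_left times_divide_eq_right)
    finally show ?thesis by (simp add: mult_ac)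
  qed
  have intQ: "integrable M (\<lambda>x. (complex_of_real x)\<^sup>2 * (w n / (w n - complex_of_real x)))" for n
  proof (rule Bochner_Integration.integrable_bound)
    show "integrable M (\<lambda>x. \<beta> * x\<^sup>2)" using integrable_square by simp
    show "AE x in M. norm ((complex_of_real x)\<^sup>2 * (w n / (w n - complex_of_real x))) \<le> norm (\<beta> * x\<^sup>2)"
      unfolding real_norm_def by (intro AE_I2 order_trans[OF bound abs_ge_self])
  qed simp
  have "w n * (F_transform M (w n) - w n) = - Q (w n) / (1 + Q (w n) * (1 / w n) * (1 / w n))" for n
  proof -
    let ?z = "w n" and ?G = "cauchy_transform M (w n)"
    have "?z \<noteq> 0" using pos[of n] by auto
    have G0: "?G \<noteq> 0" by (rule cauchy_transform_nonzero[OF pos])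
    define q where "q = Q ?z * (1 / ?z) * (1 / ?z)"
    have h: "F_transform M ?z - ?z = - q / ?G"
      unfolding q_def using F_transform_diff[OF pos] K[OF pos intQ] by simp
    have "(1 / ?G - ?z) * ?G = - q"
      using h G0 by (simp add: F_transform_def)
    then have "1 - ?z * ?G = - q"
      using G0 by (simp add: left_diff_distrib)
    then have "?z * ?G = 1 + q"
      by (simp add: diff_eq_eq)
    moreover have "?z * (- q / ?G) = - (q * ?z * ?z) / (?z * ?G)"
      using \<open>?z \<noteq> 0\<close> G0 by (simp add: field_simps)
    moreover have "q * ?z * ?z = Q ?z" using \<open>?z \<noteq> 0\<close> by (simp add: q_def)
    ultimately show ?thesis unfolding h by (simp add: q_def)
  qed
  moreover have "(\<lambda>n. - Q (w n) / (1 + Q (w n) * (1 / w n) * (1 / w n))) \<longlonglongrightarrow> - 1 / (1 + 1 * 0 * 0)"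
    by (intro tendsto_intros Qlim inv0) auto
  ultimately show ?thesis by simp
qed

text \<open>Dominated convergence is a statement about sequences, whereas the scaling limit requires
  uniformity on the cone; a sequence of counterexamples of growing height bridges the two.\<close>

lemma F_transform_asymptotic:
  assumes "\<epsilon> > 0"
  obtains R where "R > 0"
    "\<And>w. Im w \<ge> R \<Longrightarrow> cmod w \<le> \<beta> * Im w \<Longrightarrow> cmod (w * (F_transform M w - w) + 1) < \<epsilon>"
proof (rule ccontr)
  assume "\<not> thesis"
  \<comment> \<open>The summand 1 makes the candidate radius positive also for
    \<open>n = 0\<close>.\<close>
  then have "\<exists>w. Im w \<ge> real n + 1 \<and> cmod w \<le> \<beta> * Im w \<and> \<not> cmod (w * (F_transform M w - w) + 1) < \<epsilon>" for n
    using that[of "real n + 1"] by fastforce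
  then obtain w where w: "\<And>n. Im (w n) \<ge> real n + 1" "\<And>n. cmod (w n) \<le> \<beta> * Im (w n)"
      "\<And>n. \<not> cmod (w n * (F_transform M (w n) - w n) + 1) < \<epsilon>"
    by metis
  have "filterlim (\<lambda>n. Im (w n)) at_top sequentially"
    using w(1) by (intro filterlim_at_top_mono[OF filterlim_real_sequentially])
      (auto intro!: always_eventually order_trans[OF _ w(1)])
  moreover have "Im (w n) > 0" for n using w(1)[of n] by simp
  ultimately have "(\<lambda>n. w n * (F_transform M (w n) - w n)) \<longlonglongrightarrow> -1"
    using w(2) by (intro F_transform_asymptotic_seq)
  then have "\<forall>\<^sub>F n in sequentially. dist (w n * (F_transform M (w n) - w n)) (-1) < \<epsilon>"
    using assms by (rule tendstoD)
  then show False
    using w(3) by (simp add: dist_norm)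
qed

end

section \<open>Boundary values in the upper half-plane\<close>

lemma integrable_inverse_one_plus_square: "integrable lborel (\<lambda>x::real. 1 / (1 + x\<^sup>2))"
  using integrable_inverse_1_plus_square by (simp add: set_integrable_def inverse_eq_divide)

lemma integrable_cauchy_kernel_squared_lborel:
  assumes "Im z \<noteq> 0"
  shows "integrable lborel (\<lambda>x. (cmod (1 / (z - complex_of_real x)))\<^sup>2)"
proof -
  have "integrable lborel (\<lambda>x. 1 / (Im z)\<^sup>2 * (1 / (1 + (- Re z / Im z + 1 / Im z * x)\<^sup>2)))"
    using assms lborel_integrable_real_affine[OF integrable_inverse_one_plus_square, of "1 / Im z" "- Re z / Im z"]
    by (intro integrable_mult_right) simp
  also have "(\<lambda>x. 1 / (Im z)\<^sup>2 * (1 / (1 + (- Re z / Im z + 1 / Im z * x)\<^sup>2))) = (\<lambda>x. (cmod (1 / (z - complex_of_real x)))\<^sup>2)"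
  proof
    fix x
    have "(Im z)\<^sup>2 * (1 + (- Re z / Im z + 1 / Im z * x)\<^sup>2) = (Re z - x)\<^sup>2 + (Im z)\<^sup>2"
      using assms by (simp add: field_simps power2_eq_square)
    then show "1 / (Im z)\<^sup>2 * (1 / (1 + (- Re z / Im z + 1 / Im z * x)\<^sup>2)) = (cmod (1 / (z - complex_of_real x)))\<^sup>2"
      by (simp add: norm_divide power_divide cmod_power2)
  qed
  finally show ?thesis .
qed

lemma integrable_norm_squared_of_decay:
  fixes f :: "real \<Rightarrow> complex"
  assumes [measurable]: "f \<in> borel_measurable borel"
    and decay: "\<And>x. cmod (f x) * (1 + \<bar>x\<bar>) \<le> B"
  shows "integrable lborel (\<lambda>x. (cmod (f x))\<^sup>2)"
proof (rule Bochner_Integration.integrable_bound)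
  show "integrable lborel (\<lambda>x. B\<^sup>2 * (1 / (1 + x\<^sup>2)))"
    by (intro integrable_mult_right integrable_inverse_one_plus_square)
  show "AE x in lborel. norm ((cmod (f x))\<^sup>2) \<le> norm (B\<^sup>2 * (1 / (1 + x\<^sup>2)))"
  proof (intro AE_I2)
    fix x :: real
    have "(cmod (f x))\<^sup>2 * (1 + x\<^sup>2) \<le> (cmod (f x))\<^sup>2 * (1 + \<bar>x\<bar>)\<^sup>2"
      by (intro mult_left_mono) (auto simp: power2_eq_square algebra_simps)
    also have "\<dots> = (cmod (f x) * (1 + \<bar>x\<bar>))\<^sup>2" by (simp add: power_mult_distrib)
    also have "\<dots> \<le> B\<^sup>2" using decay[of x] by (intro power_mono) auto
    finally have "(cmod (f x))\<^sup>2 \<le> B\<^sup>2 / (1 + x\<^sup>2)"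
      by (simp add: pos_le_divide_eq add_pos_nonneg)
    then show "norm ((cmod (f x))\<^sup>2) \<le> norm (B\<^sup>2 * (1 / (1 + x\<^sup>2)))" by simp
  qed
qed simp

lemma integrable_mult_of_norm_squared:
  fixes f g :: "'a \<Rightarrow> complex"
  assumes [measurable]: "f \<in> borel_measurable M" "g \<in> borel_measurable M"
    and f: "integrable M (\<lambda>x. (cmod (f x))\<^sup>2)" and g: "integrable M (\<lambda>x. (cmod (g x))\<^sup>2)"
  shows "integrable M (\<lambda>x. f x * g x)"
proof (rule Bochner_Integration.integrable_bound[OF Bochner_Integration.integrable_add[OF f g]])
  show "AE x in M. norm (f x * g x) \<le> norm ((cmod (f x))\<^sup>2 + (cmod (g x))\<^sup>2)"
  proof (intro AE_I2)
    fix x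
    have "2 * (cmod (f x) * cmod (g x)) \<le> (cmod (f x))\<^sup>2 + (cmod (g x))\<^sup>2"
      using sum_squares_bound[of "cmod (f x)" "cmod (g x)"] by simp
    moreover have "0 \<le> cmod (f x) * cmod (g x)" by simp
    ultimately show "norm (f x * g x) \<le> norm ((cmod (f x))\<^sup>2 + (cmod (g x))\<^sup>2)"
      unfolding real_norm_def norm_mult by linarith
  qed
qed simp

text \<open>Holomorphy slightly below the real axis makes the boundary values ordinary continuous
  values, so that a contour may run along the axis. The decay makes them square integrable and
  removes the rest of the contour in the limit.\<close>

locale half_plane_decay =
  fixes g :: "complex \<Rightarrow> complex" and \<epsilon> B :: real
  assumes eps: "\<epsilon> > 0" and holo: "g holomorphic_on {z. Im z > - \<epsilon>}"
    and decay: "\<And>z. Im z \<ge> 0 \<Longrightarrow> cmod (g z) * (1 + cmod z) \<le> B"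
begin

lemma continuous_boundary: "continuous_on UNIV (\<lambda>x. g (complex_of_real x))"
  using eps by (intro continuous_on_compose2[OF holomorphic_on_imp_continuous_on[OF holo]] continuous_intros) auto

lemma measurable_boundary [measurable]: "(\<lambda>x. g (complex_of_real x)) \<in> borel_measurable borel"
  using continuous_boundary by (rule borel_measurable_continuous_onI)

lemma integrable_boundary:
  assumes "Im z \<noteq> 0"
  shows "integrable lborel (\<lambda>x. g (complex_of_real x) / (complex_of_real x - z))"
proof -
  have "integrable lborel (\<lambda>x. g (complex_of_real x) * (1 / (complex_of_real x - z)))"
  proof (intro integrable_mult_of_norm_squared)
    show "integrable lborel (\<lambda>x. (cmod (g (complex_of_real x)))\<^sup>2)"
      using decay[of "complex_of_real x" for x] by (intro integrable_norm_squared_of_decay[where B = B]) auto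
    show "integrable lborel (\<lambda>x. (cmod (1 / (complex_of_real x - z)))\<^sup>2)"
      using integrable_cauchy_kernel_squared_lborel[OF assms] by (simp add: norm_divide norm_minus_commute)
  qed auto
  then show ?thesis by simp
qed

text \<open>Cauchy's formula on the rectangle over \<open>{-R..R}\<close> of height
  \<open>R\<close>. A point \<open>z\<close> in the lower half-plane lies outside, and the value 0
  found there is what later isolates the imaginary part of the boundary values.\<close>

lemma contour_integral_bottom_edge:
  assumes z: "Im z \<noteq> 0" and R: "cmod z < R"
  shows "cmod (integral {-R..R} (\<lambda>x. g (complex_of_real x) / (complex_of_real x - z))
     - 2 * pi * \<i> * (if Im z > 0 then g z else 0)) \<le> 4 * (B / (R - cmod z))"
proof -
  define f where "f w = g w / (w - z)" for w
  define a1 a2 a3 a4 where a: "a1 = complex_of_real (-R)" "a2 = complex_of_real R" "a3 = Complex R R" "a4 = Complex (-R) R"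
  have R0: "R > 0" using R by (meson norm_ge_zero order.strict_trans1)
  have zb: "\<bar>Re z\<bar> < R" "\<bar>Im z\<bar> < R" using R abs_Re_le_cmod[of z] abs_Im_le_cmod[of z] by auto
  have rect: "rectpath a1 a3 = linepath a1 a2 +++ linepath a2 a3 +++ linepath a3 a4 +++ linepath a4 a1"
    by (simp add: rectpath_def a complex_eq_iff Let_def)
      (metis complex_of_real_def)
  have B0: "B \<ge> 0" using decay[of 0] by (auto intro: order_trans[rotated])
  have path: "path_image (rectpath a1 a3) = closed_segment a1 a2 \<union> closed_segment a2 a3 \<union> closed_segment a3 a4 \<union> closed_segment a4 a1"
    unfolding rect by (simp add: path_image_join Un_assoc)
  have seg: "closed_segment a1 a2 \<subseteq> {w. Im w = 0}" "closed_segment a2 a3 \<subseteq> {w. Re w = R \<and> Im w \<ge> 0}"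
    "closed_segment a3 a4 \<subseteq> {w. Im w = R}" "closed_segment a4 a1 \<subseteq> {w. Re w = -R \<and> Im w \<ge> 0}"
    using R0 by (auto simp: a closed_segment_same_Re closed_segment_same_Im closed_segment_eq_real_ivl)
  have sub: "closed_segment a1 a2 \<subseteq> {w. Im w \<ge> 0} - {z}" "closed_segment a2 a3 \<subseteq> {w. Im w \<ge> 0} - {z}"
    "closed_segment a3 a4 \<subseteq> {w. Im w \<ge> 0} - {z}" "closed_segment a4 a1 \<subseteq> {w. Im w \<ge> 0} - {z}"
    using seg z zb R0 by auto
  have contf: "continuous_on ({w. Im w \<ge> 0} - {z}) f"
    unfolding f_def using eps
    by (intro continuous_intros continuous_on_subset[OF holomorphic_on_imp_continuous_on[OF holo]]) auto
  have intf: "f contour_integrable_on linepath a1 a2" "f contour_integrable_on linepath a2 a3"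
    "f contour_integrable_on linepath a3 a4" "f contour_integrable_on linepath a4 a1"
    using sub by (auto intro!: contour_integrable_continuous_linepath intro: continuous_on_subset[OF contf])
  have total: "contour_integral (rectpath a1 a3) f = contour_integral (linepath a1 a2) f + contour_integral (linepath a2 a3) f
      + contour_integral (linepath a3 a4) f + contour_integral (linepath a4 a1) f"
    unfolding rect using intf by (simp add: contour_integrable_join)
  have "(f has_contour_integral 2 * pi * \<i> * (if Im z > 0 then g z else 0)) (rectpath a1 a3)"
  proof (cases "Im z > 0")
    case True
    have "z \<in> box a1 a3" using True zb by (auto simp: in_box_complex_iff a)
    then have "winding_number (rectpath a1 a3) z = 1" by (rule winding_number_rectpath)
    moreover have "(f has_contour_integral 2 * pi * \<i> * winding_number (rectpath a1 a3) z * g z) (rectpath a1 a3)"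
      unfolding f_def
    proof (rule Cauchy_integral_formula_convex_simple[of "{w. Im w > - \<epsilon>}"])
      show "convex {w. Im w > - \<epsilon>}" by (rule convex_halfspace_Im_gt)
      show "z \<in> interior {w. Im w > - \<epsilon>}"
        using True eps by (subst interior_open) (auto intro: open_halfspace_Im_gt)
      show "path_image (rectpath a1 a3) \<subseteq> {w. Im w > - \<epsilon>} - {z}"
        unfolding path using sub eps by fastforce
    qed (use holo in auto)
    ultimately show ?thesis using True by simp
  next
    case False
    then have neg: "Im z < 0" using z by simp
    have "(f has_contour_integral 0) (rectpath a1 a3)"
    \<comment> \<open>This half-plane still contains the real axis and excludes the pole at
      \<open>z\<close>.\<close>
    proof (rule Cauchy_theorem_convex_simple[of _ "{w. Im w > max (- \<epsilon>) (Im z)}"])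
      show "f holomorphic_on {w. Im w > max (- \<epsilon>) (Im z)}"
        unfolding f_def by (intro holomorphic_intros holomorphic_on_subset[OF holo]) auto
      show "convex {w. Im w > max (- \<epsilon>) (Im z)}" by (rule convex_halfspace_Im_gt)
      show "path_image (rectpath a1 a3) \<subseteq> {w. Im w > max (- \<epsilon>) (Im z)}"
        unfolding path using sub eps neg by fastforce
    qed auto
    then show ?thesis using False by simp
  qed
  then have "2 * pi * \<i> * (if Im z > 0 then g z else 0) = contour_integral (rectpath a1 a3) f"
    by (rule contour_integral_unique[symmetric])
  moreover have "contour_integral (linepath a1 a2) f = integral {-R..R} (\<lambda>x. f (complex_of_real x))"
    using R0 by (subst contour_integral_linepath_Reals_eq) (auto simp: a)
  ultimately have eq: "integral {-R..R} (\<lambda>x. f (complex_of_real x)) - 2 * pi * \<i> * (if Im z > 0 then g z else 0)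
     = - (contour_integral (linepath a2 a3) f + contour_integral (linepath a3 a4) f + contour_integral (linepath a4 a1) f)"
    using total by simp
  \<comment> \<open>On the other three sides \<open>cmod w \<ge> R\<close>, so the decay gives
    \<open>cmod (g w) \<le> B / R\<close>. Their total length \<open>4 * R\<close> yields the
    constant 4 of the claim.\<close>
  have fb: "cmod (f w) \<le> B / (R * (R - cmod z))" if "Im w \<ge> 0" "cmod w \<ge> R" for w
  proof -
    have "cmod (g w) * R \<le> cmod (g w) * (1 + cmod w)" using that by (intro mult_left_mono) auto
    also have "\<dots> \<le> B" using decay that by blast
    finally have 1: "cmod (g w) \<le> B / R" using R0 by (simp add: field_simps)
    have 2: "R - cmod z \<le> cmod (w - z)" using norm_triangle_ineq2[of w z] that by simp
    have "cmod (f w) = cmod (g w) / cmod (w - z)" by (simp add: f_def norm_divide)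
    also have "\<dots> \<le> (B / R) / (R - cmod z)"
      using 1 2 R B0 R0 by (intro frac_le) auto
    finally show ?thesis by simp
  qed
  have nonneg: "0 \<le> B / (R * (R - cmod z))" using B0 R0 R by simp
  have b: "cmod (contour_integral (linepath a2 a3) f) \<le> B / (R * (R - cmod z)) * cmod (a3 - a2)"
     "cmod (contour_integral (linepath a3 a4) f) \<le> B / (R * (R - cmod z)) * cmod (a4 - a3)"
     "cmod (contour_integral (linepath a4 a1) f) \<le> B / (R * (R - cmod z)) * cmod (a1 - a4)"
  proof (rule_tac [!] contour_integral_bound_linepath[OF _ nonneg])
    show "cmod (f w) \<le> B / (R * (R - cmod z))" if "w \<in> closed_segment a2 a3" for w
      using that seg(2) abs_Re_le_cmod[of w] R0 by (intro fb) fastforce+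
    show "cmod (f w) \<le> B / (R * (R - cmod z))" if "w \<in> closed_segment a3 a4" for w
      using that seg(3) abs_Im_le_cmod[of w] R0 by (intro fb) fastforce+
    show "cmod (f w) \<le> B / (R * (R - cmod z))" if "w \<in> closed_segment a4 a1" for w
      using that seg(4) abs_Re_le_cmod[of w] R0 by (intro fb) fastforce+
  qed (use intf in auto)
  have l: "cmod (a3 - a2) = R" "cmod (a4 - a3) = 2 * R" "cmod (a1 - a4) = R"
    using R0 by (auto simp: a cmod_def real_sqrt_mult)
  have "cmod (integral {-R..R} (\<lambda>x. f (complex_of_real x)) - 2 * pi * \<i> * (if Im z > 0 then g z else 0))
     \<le> cmod (contour_integral (linepath a2 a3) f) + cmod (contour_integral (linepath a3 a4) f) + cmod (contour_integral (linepath a4 a1) f)"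
    unfolding eq norm_minus_cancel by (meson add_mono norm_triangle_ineq order.refl order_trans)
  also have "\<dots> \<le> B / (R * (R - cmod z)) * R + B / (R * (R - cmod z)) * (2 * R) + B / (R * (R - cmod z)) * R"
    using b unfolding l by linarith
  also have "\<dots> = 4 * (B / (R * (R - cmod z)) * R)" by linarith
  also have "B / (R * (R - cmod z)) * R = B / (R - cmod z)" using R0 by simp
  finally show ?thesis by (simp add: f_def)
qed

lemma cauchy_formula_boundary:
  assumes z: "Im z \<noteq> 0"
  shows "(LINT x|lborel. g (complex_of_real x) / (complex_of_real x - z)) = 2 * pi * \<i> * (if Im z > 0 then g z else 0)"
proof (rule LIMSEQ_unique)
  let ?f = "\<lambda>x. g (complex_of_real x) / (complex_of_real x - z)"
  have int: "integrable lborel ?f" by (rule integrable_boundary[OF z])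
  have [measurable]: "?f \<in> borel_measurable borel" using int by (auto dest: borel_measurable_integrable)
  have "(\<lambda>n. LINT x|lborel. indicator {- real n..real n} x *\<^sub>R ?f x) \<longlonglongrightarrow> integral\<^sup>L lborel ?f"
  proof (rule integral_dominated_convergence[where w = "\<lambda>x. norm (?f x)"])
    show "AE x in lborel. (\<lambda>n. indicator {- real n..real n} x *\<^sub>R ?f x) \<longlonglongrightarrow> ?f x"
    proof (intro AE_I2 tendsto_eventually)
      fix x :: real
      show "\<forall>\<^sub>F n in sequentially. indicator {- real n..real n} x *\<^sub>R ?f x = ?f x"
        using eventually_ge_at_top[of "nat \<lceil>\<bar>x\<bar>\<rceil>"]
      proof eventually_elim
        case (elim n)
        then have "\<bar>x\<bar> \<le> real n" by linarith
        then show ?case by (simp add: abs_le_iff)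
      qed
    qed
  qed (use int in \<open>auto simp: indicator_def\<close>)
  moreover have "(LINT x|lborel. indicator {- real n..real n} x *\<^sub>R ?f x) = integral {- real n..real n} ?f" for n
  proof -
    have "set_integrable lborel {- real n..real n} ?f"
      using int unfolding set_integrable_def by (rule integrable_mult_indicator[rotated]) simp
    then show ?thesis
      using set_borel_integral_eq_integral(2) by (fastforce simp: set_lebesgue_integral_def)
  qed
  ultimately show "(\<lambda>n. integral {- real n..real n} ?f) \<longlonglongrightarrow> integral\<^sup>L lborel ?f" by simp
  show "(\<lambda>n. integral {- real n..real n} ?f) \<longlonglongrightarrow> 2 * pi * \<i> * (if Im z > 0 then g z else 0)"
  proof (rule LIM_zero_cancel, rule Lim_null_comparison)
    show "\<forall>\<^sub>F n in sequentially. norm (integral {- real n..real n} ?f - 2 * pi * \<i> * (if Im z > 0 then g z else 0)) \<le> 4 * (B / (real n - cmod z))"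
      using eventually_gt_at_top[of "nat \<lceil>cmod z\<rceil>"]
    proof eventually_elim
      case (elim n)
      then have "cmod z < real n" by linarith
      then show ?case by (rule contour_integral_bottom_edge[OF z])
    qed
    show "(\<lambda>n. 4 * (B / (real n - cmod z))) \<longlonglongrightarrow> 0"
      by real_asymp
  qed
qed

end

lemma norm_divide_le_1: "cmod a \<le> cmod b \<Longrightarrow> cmod (a / b) \<le> 1"
  by (cases "b = 0") (auto simp: norm_divide)

lemma norm_imaginary_kernel_le: "cmod (\<i> * of_nat n / (\<i> * of_nat n - complex_of_real x)) \<le> 1"
proof (rule norm_divide_le_1)
  show "cmod (\<i> * of_nat n) \<le> cmod (\<i> * of_nat n - complex_of_real x)"
    using Im_le_norm_diff_of_real[of "\<i> * of_nat n" x] by (simp add: norm_mult)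
qed

lemma imaginary_kernel_tendsto: "(\<lambda>n. \<i> * of_nat n / (\<i> * of_nat n - complex_of_real x)) \<longlonglongrightarrow> 1"
proof (rule Lim_transform_eventually)
  have "(\<lambda>n. 1 / (1 + \<i> * complex_of_real x * (1 / of_nat n))) \<longlonglongrightarrow> 1 / (1 + \<i> * complex_of_real x * 0)"
    by (intro tendsto_intros lim_1_over_n) auto
  then show "(\<lambda>n. 1 / (1 + \<i> * complex_of_real x * (1 / of_nat n))) \<longlonglongrightarrow> 1" by simp
  show "\<forall>\<^sub>F n in sequentially. 1 / (1 + \<i> * complex_of_real x * (1 / of_nat n)) = \<i> * of_nat n / (\<i> * of_nat n - complex_of_real x)"
    using eventually_gt_at_top[of 0]
  proof eventually_elim
    case (elim n)
    have "\<i> * of_nat n - complex_of_real x = \<i> * of_nat n * (1 + \<i> * complex_of_real x * (1 / of_nat n))"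
      using elim by (simp add: field_simps)
    then show ?case using elim by simp
  qed
qed

lemma cauchy_transform_density:
  assumes int: "integrable lborel p" and p0: "\<And>x. p x \<ge> 0"
    and formula: "(LINT x|lborel. complex_of_real (p x) / (z - complex_of_real x)) = c"
  shows "cauchy_transform (density lborel p) z = c"
proof -
  have "cauchy_transform (density lborel p) z = (LINT x|lborel. p x *\<^sub>R (1 / (z - complex_of_real x)))"
    unfolding cauchy_transform_def using p0 borel_measurable_integrable[OF int] by (intro integral_density) auto
  also have "\<dots> = (LINT x|lborel. complex_of_real (p x) / (z - complex_of_real x))"
    by (simp only: scaleR_conv_of_real times_divide_eq_right mult_1_right)
  finally show ?thesis unfolding formula .
qed

text \<open>The total mass is never computed as an integral of \<open>p\<close>: the factors
  \<open>\<i> * n / (\<i> * n - x)\<close> are bounded by 1 and tend to 1, so the mass is the limit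
  of \<open>\<i> * n * g (\<i> * n)\<close>.\<close>

lemma density_distribution:
  fixes p :: "real \<Rightarrow> real" and g :: "complex \<Rightarrow> complex"
  assumes intp: "integrable lborel p" and p0: "\<And>x. p x \<ge> 0"
    and formula: "\<And>z. Im z > 0 \<Longrightarrow> (LINT x|lborel. complex_of_real (p x) / (z - complex_of_real x)) = g z"
    and lim: "(\<lambda>n. \<i> * of_nat n * g (\<i> * of_nat n)) \<longlonglongrightarrow> 1"
  shows "real_distribution (density lborel p)"
proof -
  have [measurable]: "p \<in> borel_measurable borel" using borel_measurable_integrable[OF intp] by simp
  let ?\<nu> = "density lborel p"
  have "(\<lambda>n. LINT x|lborel. complex_of_real (p x) * (\<i> * of_nat n / (\<i> * of_nat n - complex_of_real x)))
      \<longlonglongrightarrow> (LINT x|lborel. complex_of_real (p x))"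
  proof (rule integral_dominated_convergence[where w = p])
    show "AE x in lborel. (\<lambda>n. complex_of_real (p x) * (\<i> * of_nat n / (\<i> * of_nat n - complex_of_real x))) \<longlonglongrightarrow> complex_of_real (p x)"
    proof (intro AE_I2)
      fix x
      from tendsto_mult_left[OF imaginary_kernel_tendsto[of x], of "complex_of_real (p x)"]
      show "(\<lambda>n. complex_of_real (p x) * (\<i> * of_nat n / (\<i> * of_nat n - complex_of_real x))) \<longlonglongrightarrow> complex_of_real (p x)"
        by (simp only: mult_1_right)
    qed
    show "AE x in lborel. norm (complex_of_real (p x) * (\<i> * of_nat n / (\<i> * of_nat n - complex_of_real x))) \<le> p x" for n
    proof (intro AE_I2)
      fix x
      have "p x * cmod (\<i> * of_nat n / (\<i> * of_nat n - complex_of_real x)) \<le> p x * 1"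
        by (intro mult_left_mono norm_imaginary_kernel_le p0)
      moreover have "cmod (complex_of_real (p x)) = p x"
        using p0[of x] by (simp only: norm_of_real abs_of_nonneg)
      ultimately show "norm (complex_of_real (p x) * (\<i> * of_nat n / (\<i> * of_nat n - complex_of_real x))) \<le> p x"
        by (simp only: norm_mult)
    qed
    show "(\<lambda>x. complex_of_real (p x)) \<in> borel_measurable lborel" by measurable
    show "(\<lambda>x. complex_of_real (p x) * (\<i> * of_nat n / (\<i> * of_nat n - complex_of_real x))) \<in> borel_measurable lborel" for n
      by measurable
  qed (rule intp)
  moreover have "\<forall>\<^sub>F n in sequentially. (LINT x|lborel. complex_of_real (p x) * (\<i> * of_nat n / (\<i> * of_nat n - complex_of_real x)))
      = \<i> * of_nat n * g (\<i> * of_nat n)"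
    using eventually_gt_at_top[of 0]
  proof eventually_elim
    case (elim n)
    have "(LINT x|lborel. complex_of_real (p x) * (\<i> * of_nat n / (\<i> * of_nat n - complex_of_real x)))
       = (LINT x|lborel. \<i> * of_nat n * (complex_of_real (p x) / (\<i> * of_nat n - complex_of_real x)))"
      by (simp add: mult_ac)
    also have "\<dots> = \<i> * of_nat n * (LINT x|lborel. complex_of_real (p x) / (\<i> * of_nat n - complex_of_real x))"
      by (rule integral_mult_right_zero)
    also have "\<dots> = \<i> * of_nat n * g (\<i> * of_nat n)"
      using elim formula[of "\<i> * of_nat n"] by simp
    finally show ?case .
  qed
  ultimately have "(\<lambda>n. \<i> * of_nat n * g (\<i> * of_nat n)) \<longlonglongrightarrow> (LINT x|lborel. complex_of_real (p x))"
    by (rule Lim_transform_eventually)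
  with lim have "(LINT x|lborel. complex_of_real (p x)) = 1" by (rule LIMSEQ_unique[rotated])
  then have "complex_of_real (LINT x|lborel. p x) = 1" by (simp only: integral_complex_of_real)
  then have one: "(LINT x|lborel. p x) = 1" by (simp only: of_real_eq_1_iff)
  have "emeasure ?\<nu> (space ?\<nu>) = (\<integral>\<^sup>+x. ennreal (p x) \<partial>lborel)"
    by (simp add: emeasure_density)
  also have "\<dots> = ennreal (LINT x|lborel. p x)"
    by (rule nn_integral_eq_integral[OF intp]) (use p0 in auto)
  finally have "emeasure ?\<nu> (space ?\<nu>) = 1" by (simp only: one ennreal_1)
  then have "prob_space ?\<nu>" by (rule prob_spaceI)
  then show "real_distribution ?\<nu>"
    unfolding real_distribution_def real_distribution_axioms_def by simp
qed

section \<open>Poisson formula and distributions with boundary densities\<close>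

context half_plane_decay
begin

text \<open>The Cauchy formula at the reflected point \<open>cnj z\<close> gives \<open>0\<close>; subtracting its conjugate from
  the formula at \<open>z\<close> leaves only the imaginary part of the boundary values.\<close>

lemma poisson_formula:
  assumes z: "Im z > 0"
  shows "(LINT x|lborel. complex_of_real (- Im (g (complex_of_real x)) / pi) / (z - complex_of_real x)) = g z"
proof -
  let ?g = "\<lambda>x. g (complex_of_real x)"
  have 1: "(LINT x|lborel. ?g x / (complex_of_real x - z)) = 2 * pi * \<i> * g z"
    using cauchy_formula_boundary[of z] z by simp
  have "(LINT x|lborel. cnj (?g x) / (complex_of_real x - z)) = (LINT x|lborel. cnj (?g x / (complex_of_real x - cnj z)))"
    by simp
  also have "\<dots> = cnj (LINT x|lborel. ?g x / (complex_of_real x - cnj z))"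
    by (rule Bochner_Integration.integral_cnj)
  also have "\<dots> = 0" using cauchy_formula_boundary[of "cnj z"] z by simp
  finally have 2: "(LINT x|lborel. cnj (?g x) / (complex_of_real x - z)) = 0" .
  have int1: "integrable lborel (\<lambda>x. ?g x / (complex_of_real x - z))"
    using z by (intro integrable_boundary) simp
  have "integrable lborel (\<lambda>x. cnj (?g x / (complex_of_real x - cnj z)))"
    using z by (intro integrable_cnj integrable_boundary) simp
  then have int2: "integrable lborel (\<lambda>x. cnj (?g x) / (complex_of_real x - z))" by simp
  have "2 * pi * \<i> * g z = (LINT x|lborel. ?g x / (complex_of_real x - z) - cnj (?g x) / (complex_of_real x - z))"
    using int1 int2 1 2 by simp
  also have "\<dots> = (LINT x|lborel. (2 * pi * \<i>) * (complex_of_real (- Im (?g x) / pi) / (z - complex_of_real x)))"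
  proof (intro Bochner_Integration.integral_cong refl)
    fix x
    have "?g x / (complex_of_real x - z) - cnj (?g x) / (complex_of_real x - z) = (2 * \<i> * Im (?g x)) / (complex_of_real x - z)"
      by (simp add: diff_divide_distrib[symmetric] complex_diff_cnj mult_ac)
    also have "\<dots> = (2 * \<i> * (- Im (?g x))) / (z - complex_of_real x)"
      by (subst minus_divide_divide[symmetric]) simp
    finally show "?g x / (complex_of_real x - z) - cnj (?g x) / (complex_of_real x - z) =
      (2 * pi * \<i>) * (complex_of_real (- Im (?g x) / pi) / (z - complex_of_real x))"
      by simp
  qed
  also have "\<dots> = (2 * pi * \<i>) * (LINT x|lborel. complex_of_real (- Im (?g x) / pi) / (z - complex_of_real x))"
    by (rule integral_mult_right_zero)
  finally have "(2 * pi * \<i>) * g z = (2 * pi * \<i>) * (LINT x|lborel. complex_of_real (- Im (?g x) / pi) / (z - complex_of_real x))" .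
  then show ?thesis
    by (subst (asm) mult_cancel_left) (auto simp only: mult_eq_0_iff of_real_eq_0_iff pi_neq_zero complex_i_not_zero zero_neq_numeral[symmetric])
qed

lemma boundary_distribution:
  assumes nonpos: "\<And>x. Im (g (complex_of_real x)) \<le> 0"
    and int: "integrable lborel (\<lambda>x. Im (g (complex_of_real x)))"
    and lim: "(\<lambda>n. \<i> * of_nat n * g (\<i> * of_nat n)) \<longlonglongrightarrow> 1"
  defines "\<nu> \<equiv> density lborel (\<lambda>x. ennreal (- Im (g (complex_of_real x)) / pi))"
  shows "real_distribution \<nu>" and "Im z > 0 \<Longrightarrow> cauchy_transform \<nu> z = g z"
  unfolding \<nu>_def
proof -
  let ?p = "\<lambda>x. - Im (g (complex_of_real x)) / pi"
  have p0: "?p x \<ge> 0" for x using nonpos[of x] by (intro divide_nonneg_pos) auto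
  have intp: "integrable lborel ?p" using int by simp
  show "real_distribution (density lborel ?p)"
    using intp p0 poisson_formula lim by (rule density_distribution)
  show "cauchy_transform (density lborel ?p) z = g z" if "Im z > 0"
    using intp p0 poisson_formula[OF that] by (rule cauchy_transform_density)
qed

end

section \<open>The Cauchy distribution as boundary density of
  \<open>1 / (z + \<i> t)\<close>\<close>

lemma
  assumes t: "t > 0"
  shows real_distribution_cauchy: "real_distribution (cauchy_distribution t)"
    and cauchy_transform_cauchy: "Im z > 0 \<Longrightarrow> cauchy_transform (cauchy_distribution t) z = 1 / (z + \<i> * of_real t)"
proof -
  let ?g = "\<lambda>z. 1 / (z + \<i> * of_real t)"
  \<comment> \<open>The margin \<open>t / 2\<close> stays above the pole at \<open>- \<i> t\<close>.
    The constant comes from \<open>cmod (z + \<i> t)\<close> being at least \<open>t\<close> and at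
    least \<open>cmod z\<close>.\<close>
  have d: "half_plane_decay ?g (t / 2) (1 / t + 1)"
  proof
    show "?g holomorphic_on {z. - (t / 2) < Im z}"
      using t by (intro holomorphic_intros) (auto simp: complex_eq_iff)
    fix z assume z: "0 \<le> Im z"
    have 1: "t \<le> cmod (z + \<i> * of_real t)" using z abs_Im_le_cmod[of "z + \<i> * of_real t"] by simp
    have 2: "cmod z \<le> cmod (z + \<i> * of_real t)"
      using z t by (simp add: cmod_def power_mono)
    have "(1 + cmod z) / cmod (z + \<i> * of_real t) = 1 / cmod (z + \<i> * of_real t) + cmod z / cmod (z + \<i> * of_real t)"
      by (simp add: add_divide_distrib)
    also have "\<dots> \<le> 1 / t + 1"
      using 1 2 t by (intro add_mono) (auto simp: frac_le divide_le_eq_1)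
    finally show "cmod (?g z) * (1 + cmod z) \<le> 1 / t + 1" by (simp add: norm_divide)
  qed (use t in auto)
  have Im: "Im (?g (complex_of_real x)) = - t / (x\<^sup>2 + t\<^sup>2)" for x
    by (simp add: Im_divide power2_eq_square)
  have eq: "cauchy_distribution t = density lborel (\<lambda>x. ennreal (- Im (?g (complex_of_real x)) / pi))"
    unfolding cauchy_distribution_def Im by (simp add: mult.commute)
  have int: "integrable lborel (\<lambda>x. Im (?g (complex_of_real x)))"
  proof -
    have "integrable lborel (\<lambda>x. - t * (cmod (1 / (\<i> * of_real t - complex_of_real x)))\<^sup>2)"
      using t by (intro integrable_mult_right integrable_cauchy_kernel_squared_lborel) simp
    also have "(\<lambda>x. - t * (cmod (1 / (\<i> * of_real t - complex_of_real x)))\<^sup>2) = (\<lambda>x. Im (?g (complex_of_real x)))"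
      unfolding Im by (simp add: norm_divide power_divide cmod_power2)
    finally show ?thesis .
  qed
  have lim: "(\<lambda>n. \<i> * of_nat n * ?g (\<i> * of_nat n)) \<longlonglongrightarrow> 1"
  proof (rule Lim_transform_eventually)
    have "(\<lambda>n. 1 / (1 + of_real t * (1 / of_nat n))) \<longlonglongrightarrow> 1 / (1 + complex_of_real t * 0)"
      by (intro tendsto_intros lim_1_over_n) auto
    then show "(\<lambda>n. 1 / (1 + complex_of_real t * (1 / of_nat n))) \<longlonglongrightarrow> 1" by simp
    show "\<forall>\<^sub>F n in sequentially. 1 / (1 + complex_of_real t * (1 / of_nat n)) = \<i> * of_nat n * ?g (\<i> * of_nat n)"
      using eventually_gt_at_top[of 0]
    proof eventually_elim
      case (elim n)
      have "\<i> * of_nat n + \<i> * of_real t = \<i> * of_nat n * (1 + of_real t * (1 / of_nat n))"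
        using elim by (simp add: field_simps)
      then show ?case using elim by simp
    qed
  qed
  show "real_distribution (cauchy_distribution t)"
    unfolding eq by (rule half_plane_decay.boundary_distribution(1)[OF d _ int lim]) (use t in \<open>simp add: Im\<close>)
  show "cauchy_transform (cauchy_distribution t) z = ?g z" if "Im z > 0"
    unfolding eq by (rule half_plane_decay.boundary_distribution(2)[OF d _ int lim that]) (use t in \<open>simp add: Im\<close>)
qed

section \<open>Injectivity of the Cauchy transform\<close>

lemma char_cauchy_distribution:
  assumes y: "y > 0"
  shows "char (cauchy_distribution y) t = (LINT v|lborel. complex_of_real (y / (pi * (v\<^sup>2 + y\<^sup>2))) * iexp (t * v))"
  unfolding char_def cauchy_distribution_def
  using y by (subst integral_density) (auto simp: scaleR_conv_of_real)

lemma integrable_cauchy_density: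
  assumes y: "y > 0"
  shows "integrable lborel (\<lambda>v. y / (pi * (v\<^sup>2 + y\<^sup>2)))" "(LINT v|lborel. y / (pi * (v\<^sup>2 + y\<^sup>2))) = 1"
proof -
  interpret C: real_distribution "cauchy_distribution y" by (rule real_distribution_cauchy[OF y])
  have "(\<integral>\<^sup>+v. ennreal (y / (pi * (v\<^sup>2 + y\<^sup>2))) \<partial>lborel) = 1"
    using C.emeasure_space_1 unfolding cauchy_distribution_def by (simp add: emeasure_density)
  then have *: "(\<integral>\<^sup>+v. ennreal (y / (pi * (v\<^sup>2 + y\<^sup>2))) \<partial>lborel) = ennreal 1" by simp
  show "integrable lborel (\<lambda>v. y / (pi * (v\<^sup>2 + y\<^sup>2)))"
    by (rule integrableI_nn_integral_finite[OF _ _ *]) (use y in auto)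
  show "(LINT v|lborel. y / (pi * (v\<^sup>2 + y\<^sup>2))) = 1"
    by (rule integral_eq_nn_integral[THEN trans]) (use y * in auto)
qed

text \<open>The explicit value of this characteristic function is avoided. Scaling moves its
  argument towards 0, where continuity keeps it away from zero.\<close>

lemma char_cauchy_distribution_scale:
  assumes y: "y > 0"
  shows "char (cauchy_distribution y) t = char (cauchy_distribution 1) (t * y)"
proof -
  have "char (cauchy_distribution y) t = \<bar>y\<bar> *\<^sub>R (LINT v|lborel. complex_of_real (y / (pi * ((0 + y * v)\<^sup>2 + y\<^sup>2))) * iexp (t * (0 + y * v)))"
    unfolding char_cauchy_distribution[OF y] using y by (intro lborel_integral_real_affine) simp
  also have "\<dots> = (LINT v|lborel. \<bar>y\<bar> *\<^sub>R (complex_of_real (y / (pi * ((0 + y * v)\<^sup>2 + y\<^sup>2))) * iexp (t * (0 + y * v))))"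
    by (rule integral_scaleR_right[symmetric])
  also have "\<dots> = (LINT v|lborel. complex_of_real (1 / (pi * (v\<^sup>2 + 1\<^sup>2))) * iexp (t * y * v))"
  proof (intro Bochner_Integration.integral_cong refl)
    fix v
    have "y * (y / (pi * ((y * v)\<^sup>2 + y\<^sup>2))) = 1 / (pi * (v\<^sup>2 + 1\<^sup>2))"
    proof -
      have "pi * ((y * v)\<^sup>2 + y\<^sup>2) = (y * y) * (pi * (v\<^sup>2 + 1\<^sup>2))"
        by (simp add: power2_eq_square algebra_simps)
      then show ?thesis using y by simp
    qed
    then have "complex_of_real y * complex_of_real (y / (pi * ((y * v)\<^sup>2 + y\<^sup>2))) = complex_of_real (1 / (pi * (v\<^sup>2 + 1\<^sup>2)))"
      by (simp only: of_real_mult[symmetric])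
    then show "\<bar>y\<bar> *\<^sub>R (complex_of_real (y / (pi * ((0 + y * v)\<^sup>2 + y\<^sup>2))) * iexp (t * (0 + y * v))) =
      complex_of_real (1 / (pi * (v\<^sup>2 + 1\<^sup>2))) * iexp (t * y * v)"
      using y by (simp only: scaleR_conv_of_real abs_of_pos add_0_left mult.assoc[symmetric])
  qed
  also have "\<dots> = char (cauchy_distribution 1) (t * y)"
    by (subst char_cauchy_distribution) auto
  finally show ?thesis .
qed

text \<open>The Poisson integral of a distribution is its convolution with a Cauchy distribution.\<close>

lemma (in real_distribution) fourier_poisson_integral:
  assumes y: "y > 0"
  shows "(LINT u|lborel. complex_of_real (- Im (cauchy_transform M (Complex u y)) / pi) * iexp (t * u))
    = char M t * char (cauchy_distribution y) t"
proof -
  let ?k = "\<lambda>v. y / (pi * (v\<^sup>2 + y\<^sup>2))"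
  define f where "f x u = complex_of_real (?k (u - x)) * iexp (t * u)" for x u :: real
  have k0: "?k v \<ge> 0" for v using y by simp
  note k = integrable_cauchy_density[OF y]
  have sh: "integrable lborel (\<lambda>u. ?k (u - x))" "(LINT u|lborel. ?k (u - x)) = 1" for x
    using lborel_integrable_real_affine[OF k(1), of 1 "- x"] lborel_integral_real_affine[of 1 ?k "- x"] k(2)
    by simp_all
  have kM: "- Im (cauchy_transform M (Complex u y)) / pi = (LINT x|M. ?k (u - x))" for u
  proof -
    have "- Im (cauchy_transform M (Complex u y)) / pi = y / pi * (LINT x|M. (cmod (1 / (Complex u y - complex_of_real x)))\<^sup>2)"
      using Im_cauchy_transform[of "Complex u y"] y by simp
    also have "\<dots> = (LINT x|M. y / pi * (cmod (1 / (Complex u y - complex_of_real x)))\<^sup>2)"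
      by simp
    also have "\<dots> = (LINT x|M. ?k (u - x))"
      by (intro Bochner_Integration.integral_cong) (auto simp: norm_divide power_divide cmod_power2)
    finally show ?thesis .
  qed
  interpret P: pair_sigma_finite M lborel ..
  have nf: "norm (f x u) = ?k (u - x)" for x u
    unfolding f_def norm_mult using k0[of "u - x"]
    by (simp only: norm_of_real abs_of_nonneg norm_exp_i_times mult_1_right)
  have "sets (M \<Otimes>\<^sub>M lborel) = sets (borel \<Otimes>\<^sub>M borel)"
    by (intro sets_pair_measure_cong) auto
  then have [measurable_cong]: "sets (M \<Otimes>\<^sub>M lborel) = sets (borel \<Otimes>\<^sub>M borel)" .
  have meas: "case_prod f \<in> borel_measurable (M \<Otimes>\<^sub>M lborel)"
    unfolding f_def by measurable
  have intf: "integrable lborel (f x)" for x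
  proof (rule Bochner_Integration.integrable_bound[OF sh(1)[of x]])
    show "f x \<in> borel_measurable lborel" unfolding f_def by measurable
    show "AE u in lborel. norm (f x u) \<le> norm (?k (u - x))"
      by (intro AE_I2) (simp only: nf real_norm_def abs_ge_self)
  qed
  \<comment> \<open>For every \<open>x\<close> the norm of \<open>f x\<close> is a translated Cauchy
    density of mass 1, so the iterated integral of the norm is finite.\<close>
  have int: "integrable (M \<Otimes>\<^sub>M lborel) (case_prod f)"
  proof (rule P.Fubini_integrable[OF meas])
    show "integrable M (\<lambda>x. LINT u|lborel. norm (case (x, u) of (x, u) \<Rightarrow> f x u))"
      by (simp add: nf sh(2))
    show "AE x in M. integrable lborel (\<lambda>u. case (x, u) of (x, u) \<Rightarrow> f x u)"
      using intf by simp
  qed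
  have "(LINT u|lborel. complex_of_real (- Im (cauchy_transform M (Complex u y)) / pi) * iexp (t * u))
     = (LINT u|lborel. (LINT x|M. f x u))"
    unfolding kM f_def integral_mult_left_zero integral_complex_of_real ..
  also have "\<dots> = (LINT x|M. (LINT u|lborel. f x u))"
    by (rule P.Fubini_integral[OF int])
  also have "\<dots> = (LINT x|M. iexp (t * x) * char (cauchy_distribution y) t)"
  proof (intro Bochner_Integration.integral_cong refl)
    fix x
    have "(LINT u|lborel. f x u) = \<bar>1\<bar> *\<^sub>R (LINT v|lborel. f x (x + 1 * v))"
      by (rule lborel_integral_real_affine) simp
    also have "\<dots> = (LINT v|lborel. iexp (t * x) * (complex_of_real (?k v) * iexp (t * v)))"
      by (simp add: f_def distrib_left exp_add mult_ac)
    also have "\<dots> = iexp (t * x) * char (cauchy_distribution y) t"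
      unfolding char_cauchy_distribution[OF y] by (rule integral_mult_right_zero)
    finally show "(LINT u|lborel. f x u) = iexp (t * x) * char (cauchy_distribution y) t" .
  qed
  also have "\<dots> = char M t * char (cauchy_distribution y) t"
    unfolding char_def[of M] by (rule integral_mult_left_zero)
  finally show ?thesis .
qed

text \<open>Equal Cauchy transforms give equal Poisson integrals, hence equal products of
  characteristic functions with that of a Cauchy distribution. For each \<open>t\<close> the
  parameter \<open>y\<close> is taken so small that this factor does not vanish at
  \<open>t\<close>.\<close>

theorem cauchy_transform_inject:
  assumes \<mu>: "real_distribution \<mu>" and \<nu>: "real_distribution \<nu>"
    and eq: "\<And>z. Im z > 0 \<Longrightarrow> cauchy_transform \<mu> z = cauchy_transform \<nu> z"
  shows "\<mu> = \<nu>"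
proof (rule Levy_uniqueness[OF \<mu> \<nu>], rule ext)
  fix t
  interpret C: real_distribution "cauchy_distribution 1" by (rule real_distribution_cauchy) simp
  have "(\<lambda>n. char (cauchy_distribution 1) (t * (1 / real (Suc n)))) \<longlonglongrightarrow> char (cauchy_distribution 1) (t * 0)"
    using LIMSEQ_Suc[OF lim_1_over_n]
    by (intro isCont_tendsto_compose[OF C.isCont_char] tendsto_mult tendsto_const)
  then have "(\<lambda>n. char (cauchy_distribution 1) (t * (1 / real (Suc n)))) \<longlonglongrightarrow> 1"
    by (simp only: mult_zero_right C.char_zero)
  then have "\<forall>\<^sub>F n in sequentially. char (cauchy_distribution 1) (t * (1 / real (Suc n))) \<noteq> 0"
    by (rule tendsto_imp_eventually_ne) simp
  then obtain n where n: "char (cauchy_distribution 1) (t * (1 / real (Suc n))) \<noteq> 0"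
    by (auto simp: eventually_sequentially)
  define y where "y = 1 / real (Suc n)"
  have y: "y > 0" by (simp add: y_def)
  have "char \<mu> t * char (cauchy_distribution y) t = char \<nu> t * char (cauchy_distribution y) t"
    using real_distribution.fourier_poisson_integral[OF \<mu> y, of t] real_distribution.fourier_poisson_integral[OF \<nu> y, of t]
    by (simp add: eq y)
  moreover have "char (cauchy_distribution y) t \<noteq> 0"
    using n char_cauchy_distribution_scale[OF y, of t] by (simp add: y_def)
  ultimately show "char \<mu> t = char \<nu> t" by simp
qed

corollary F_transform_inject:
  assumes "real_distribution \<mu>" "real_distribution \<nu>"
    and "\<And>z. Im z > 0 \<Longrightarrow> F_transform \<mu> z = F_transform \<nu> z"
  shows "\<mu> = \<nu>"
  using assms by (intro cauchy_transform_inject) (simp_all add: F_transform_def)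

section \<open>Weak limits and existence of distributions\<close>

context real_distribution
begin

lemma cauchy_transform_imaginary_limit: "(\<lambda>n. \<i> * of_nat n * cauchy_transform M (\<i> * of_nat n)) \<longlonglongrightarrow> 1"
proof -
  have "(\<lambda>n. LINT x|M. \<i> * of_nat n / (\<i> * of_nat n - complex_of_real x)) \<longlonglongrightarrow> (LINT x|M. 1)"
    by (rule integral_dominated_convergence[where w = "\<lambda>_. 1"])
      (use norm_imaginary_kernel_le imaginary_kernel_tendsto in auto)
  moreover have "(LINT x|M. \<i> * of_nat n / (\<i> * of_nat n - complex_of_real x)) = \<i> * of_nat n * cauchy_transform M (\<i> * of_nat n)" for n
    unfolding cauchy_transform_def integral_mult_right_zero[symmetric] by simp
  ultimately show ?thesis using prob_space by simp
qed

text \<open>The real part of \<open>\<i> y G (\<i> y)\<close> is the integral of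
  \<open>y\<^sup>2 / (x\<^sup>2 + y\<^sup>2)\<close>, which is at most 1 on the interval and at most
  1/2 off it. The value at one point of the imaginary axis thus controls the tail.\<close>

lemma measure_interval_ge:
  assumes y: "y > 0"
  shows "1 - 2 * cmod (\<i> * of_real y * cauchy_transform M (\<i> * of_real y) - 1) \<le> measure M {- y<..y}"
proof -
  have int: "integrable M (\<lambda>x. \<i> * of_real y * (1 / (\<i> * of_real y - complex_of_real x)))"
    using y by (intro integrable_mult_right integrable_cauchy_kernel) simp
  have Re: "Re (\<i> * of_real y * (1 / (\<i> * of_real y - complex_of_real x))) = y\<^sup>2 / (x\<^sup>2 + y\<^sup>2)" for x
    by (simp add: Re_divide Im_divide power2_eq_square)
  have intR: "integrable M (\<lambda>x. y\<^sup>2 / (x\<^sup>2 + y\<^sup>2))"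
    using integrable_Re[OF int] unfolding Re .
  have "Re (\<i> * of_real y * cauchy_transform M (\<i> * of_real y)) = (LINT x|M. y\<^sup>2 / (x\<^sup>2 + y\<^sup>2))"
    unfolding cauchy_transform_def integral_mult_right_zero[symmetric] integral_Re[OF int, symmetric] Re ..
  also have "\<dots> \<le> (LINT x|M. (1 + indicator {- y<..y} x) / 2)"
  proof (rule integral_mono[OF intR])
    show "integrable M (\<lambda>x. (1 + indicat_real {- y<..y} x) / 2)"
      by (intro integrable_const_bound[where B = 1]) (auto simp: indicator_def)
    show "y\<^sup>2 / (x\<^sup>2 + y\<^sup>2) \<le> (1 + indicat_real {- y<..y} x) / 2" for x
    proof (cases "x \<in> {- y<..y}")
      case True
      have "y\<^sup>2 / (x\<^sup>2 + y\<^sup>2) \<le> 1" using y by (simp add: add_nonneg_pos)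
      then show ?thesis using True by simp
    next
      case False
      then have "y \<le> \<bar>x\<bar>" by auto
      then have "y\<^sup>2 \<le> x\<^sup>2" using y by (simp add: abs_le_square_iff[symmetric])
      then show ?thesis using False y by (simp add: add_nonneg_pos divide_le_eq)
    qed
  qed
  also have "\<dots> = (1 + measure M {- y<..y}) / 2"
  proof -
    have "integrable M (indicat_real {- y<..y})"
      by (intro integrable_const_bound[where B = 1]) (auto simp: indicator_def)
    then show ?thesis using prob_space by simp
  qed
  finally have "2 * Re (\<i> * of_real y * cauchy_transform M (\<i> * of_real y)) \<le> 1 + measure M {- y<..y}" by simp
  moreover have "1 - Re (\<i> * of_real y * cauchy_transform M (\<i> * of_real y)) \<le> cmod (\<i> * of_real y * cauchy_transform M (\<i> * of_real y) - 1)"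
    using abs_Re_le_cmod[of "\<i> * of_real y * cauchy_transform M (\<i> * of_real y) - 1"] by simp
  ultimately show ?thesis by linarith
qed

end

text \<open>The normalisation of \<open>g\<close> rules out escape of mass. A fixed \<open>k\<close>
  with \<open>\<i> k g (\<i> k)\<close> close to 1 controls the tails of all \<open>\<mu> n\<close>
  with large \<open>n\<close>, because the transforms converge at the single point
  \<open>\<i> k\<close>.\<close>

lemma tight_of_cauchy_transform:
  assumes \<mu>: "\<And>n. real_distribution (\<mu> n)"
    and conv: "\<And>z. Im z > 0 \<Longrightarrow> (\<lambda>n. cauchy_transform (\<mu> n) z) \<longlonglongrightarrow> g z"
    and lim: "(\<lambda>k. \<i> * of_nat k * g (\<i> * of_nat k)) \<longlonglongrightarrow> 1"
  shows "tight \<mu>"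
  unfolding tight_def
proof (intro conjI allI impI)
  show "real_distribution (\<mu> n)" for n by (rule \<mu>)
  fix \<epsilon> :: real assume \<epsilon>: "\<epsilon> > 0"
  have mass: "measure (\<mu> n) {- real k<..real k} > 1 - \<epsilon>"
    if "k > 0" "dist (\<i> * of_nat k * cauchy_transform (\<mu> n) (\<i> * of_nat k)) 1 < \<epsilon> / 2" for k n
    using real_distribution.measure_interval_ge[OF \<mu>, of "real k" n] that by (simp add: dist_norm)
  have "\<forall>\<^sub>F k in sequentially. dist (\<i> * of_nat k * g (\<i> * of_nat k)) 1 < \<epsilon> / 2"
    using lim \<epsilon> by (intro tendstoD) auto
  then have "\<forall>\<^sub>F k in sequentially. k > 0 \<and> dist (\<i> * of_nat k * g (\<i> * of_nat k)) 1 < \<epsilon> / 2"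
    using eventually_gt_at_top[of 0] by eventually_elim auto
  then obtain k :: nat where k: "k > 0" "dist (\<i> * of_nat k * g (\<i> * of_nat k)) 1 < \<epsilon> / 2"
    by (auto simp: eventually_sequentially)
  have "(\<lambda>n. dist (\<i> * of_nat k * cauchy_transform (\<mu> n) (\<i> * of_nat k)) 1) \<longlonglongrightarrow> dist (\<i> * of_nat k * g (\<i> * of_nat k)) 1"
    using k by (intro tendsto_intros conv) auto
  then have "\<forall>\<^sub>F n in sequentially. dist (\<i> * of_nat k * cauchy_transform (\<mu> n) (\<i> * of_nat k)) 1 < \<epsilon> / 2"
    using k(2) by (rule order_tendstoD(2))
  then obtain n0 where n0: "\<And>n. n \<ge> n0 \<Longrightarrow> dist (\<i> * of_nat k * cauchy_transform (\<mu> n) (\<i> * of_nat k)) 1 < \<epsilon> / 2"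
    by (auto simp: eventually_sequentially)
  have "\<exists>b. measure (\<mu> n) {- real b<..real b} > 1 - \<epsilon>" for n
  proof -
    have "\<forall>\<^sub>F b in sequentially. dist (\<i> * of_nat b * cauchy_transform (\<mu> n) (\<i> * of_nat b)) 1 < \<epsilon> / 2"
      using real_distribution.cauchy_transform_imaginary_limit[OF \<mu>, of n] \<epsilon> by (intro tendstoD) auto
    then have "\<forall>\<^sub>F b in sequentially. measure (\<mu> n) {- real b<..real b} > 1 - \<epsilon>"
      using eventually_gt_at_top[of 0] by eventually_elim (rule mass)
    then show ?thesis by (auto simp: eventually_sequentially)
  qed
  then obtain b where b: "\<And>n. measure (\<mu> n) {- real (b n)<..real (b n)} > 1 - \<epsilon>" by metis
  \<comment> \<open>The finitely many initial measures have individual bounds \<open>b n\<close>;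
    \<open>K\<close> dominates these and \<open>k\<close>.\<close>
  define K where "K = Max (insert k (b ` {..<n0}))"
  have kK: "k \<le> K" and bK: "n < n0 \<Longrightarrow> b n \<le> K" for n unfolding K_def by auto
  have "measure (\<mu> n) {- real K<..real K} > 1 - \<epsilon>" for n
  proof -
    interpret real_distribution "\<mu> n" by (rule \<mu>)
    define c where "c = (if n < n0 then b n else k)"
    have "measure (\<mu> n) {- real c<..real c} > 1 - \<epsilon>"
      using b[of n] mass[OF k(1) n0, of n] by (auto simp: c_def)
    also have "measure (\<mu> n) {- real c<..real c} \<le> measure (\<mu> n) {- real K<..real K}"
      using kK bK[of n] by (intro finite_measure_mono) (auto simp: c_def split: if_splits)
    finally show ?thesis .
  qed
  then show "\<exists>a b. a < b \<and> (\<forall>n. 1 - \<epsilon> < measure (\<mu> n) {a<..b})"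
    using k(1) kK by (intro exI[of _ "- real K"] exI[of _ "real K"]) auto
qed

lemma cauchy_transform_weak_limit:
  assumes \<mu>: "\<And>n. real_distribution (\<mu> n)" and M: "real_distribution M"
    and w: "weak_conv_m \<mu> M" and z: "Im z > 0"
  shows "(\<lambda>n. cauchy_transform (\<mu> n) z) \<longlonglongrightarrow> cauchy_transform M z"
  unfolding cauchy_transform_def
proof (rule weak_conv_imp_integral_bdd_continuous_conv[OF \<mu> M w])
  show "isCont (\<lambda>x. 1 / (z - complex_of_real x)) x" for x
    using diff_of_real_nonzero[OF z] by (intro continuous_intros) auto
  show "norm (1 / (z - complex_of_real x)) \<le> 1 / Im z" for x
    by (rule norm_inverse_diff_of_real_le[OF z])
qed

text \<open>One subsequential weak limit suffices, since the transforms converge along the whole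
  sequence.\<close>

lemma cauchy_transform_limit_exists:
  assumes \<mu>: "\<And>n. real_distribution (\<mu> n)"
    and conv: "\<And>z. Im z > 0 \<Longrightarrow> (\<lambda>n. cauchy_transform (\<mu> n) z) \<longlonglongrightarrow> g z"
    and lim: "(\<lambda>k. \<i> * of_nat k * g (\<i> * of_nat k)) \<longlonglongrightarrow> 1"
  shows "\<exists>M. real_distribution M \<and> (\<forall>z. Im z > 0 \<longrightarrow> cauchy_transform M z = g z)"
proof -
  have "tight \<mu>" using assms by (rule tight_of_cauchy_transform)
  from tight_imp_convergent_subsubsequence[OF this strict_mono_id]
  obtain r M where r: "strict_mono r" and M: "real_distribution M" and w: "weak_conv_m (\<mu> \<circ> id \<circ> r) M" by blast
  have "cauchy_transform M z = g z" if z: "Im z > 0" for z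
  proof (rule LIMSEQ_unique)
    show "(\<lambda>n. cauchy_transform ((\<mu> \<circ> id \<circ> r) n) z) \<longlonglongrightarrow> cauchy_transform M z"
      using \<mu> by (intro cauchy_transform_weak_limit M w z) simp
    show "(\<lambda>n. cauchy_transform ((\<mu> \<circ> id \<circ> r) n) z) \<longlonglongrightarrow> g z"
      using LIMSEQ_subseq_LIMSEQ[OF conv[OF z] r] by (simp add: o_def)
  qed
  with M show ?thesis by blast
qed

text \<open>Every subsequential limit has the Cauchy transform of \<open>M\<close> and hence is
  \<open>M\<close>; with tightness this yields convergence of the full sequence.\<close>

lemma weak_conv_of_cauchy_transform:
  assumes \<mu>: "\<And>n. real_distribution (\<mu> n)" and M: "real_distribution M"
    and conv: "\<And>z. Im z > 0 \<Longrightarrow> (\<lambda>n. cauchy_transform (\<mu> n) z) \<longlonglongrightarrow> cauchy_transform M z"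
  shows "weak_conv_m \<mu> M"
proof (rule tight_subseq_weak_converge[OF \<mu> M])
  show "tight \<mu>"
    using \<mu> conv real_distribution.cauchy_transform_imaginary_limit[OF M] by (rule tight_of_cauchy_transform)
  fix s :: "nat \<Rightarrow> nat" and \<nu>
  assume s: "strict_mono s" and \<nu>: "real_distribution \<nu>" and w: "weak_conv_m (\<mu> \<circ> s) \<nu>"
  have "\<nu> = M"
  proof (rule cauchy_transform_inject[OF \<nu> M])
    fix z :: complex assume z: "Im z > 0"
    show "cauchy_transform \<nu> z = cauchy_transform M z"
    proof (rule LIMSEQ_unique)
      show "(\<lambda>n. cauchy_transform ((\<mu> \<circ> s) n) z) \<longlonglongrightarrow> cauchy_transform \<nu> z"
        using \<mu> by (intro cauchy_transform_weak_limit \<nu> w z) simp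
      show "(\<lambda>n. cauchy_transform ((\<mu> \<circ> s) n) z) \<longlonglongrightarrow> cauchy_transform M z"
        using LIMSEQ_subseq_LIMSEQ[OF conv[OF z] s] by (simp add: o_def)
    qed
  qed
  with w show "weak_conv_m (\<mu> \<circ> s) M" by simp
qed

text \<open>The shift by \<open>\<i> \<epsilon>\<close> provides holomorphy across the real axis and
  keeps the modulus of \<open>f\<close> at least \<epsilon> on the closed half-plane. There
  \<open>f z - z\<close> is bounded by \<open>K\<close>, so \<open>1 / f\<close> decays like
  \<open>1 / z\<close>.\<close>

lemma boundary_distribution_of_F:
  assumes holo: "F holomorphic_on upper_half_plane"
    and ge: "\<And>z. Im z > 0 \<Longrightarrow> Im (F z) \<ge> Im z"
    and near: "\<And>z. Im z > 0 \<Longrightarrow> cmod (F z - z) \<le> C / Im z"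
    and \<epsilon>: "\<epsilon> > 0"
  shows "\<exists>M. real_distribution M \<and> (\<forall>z. Im z > 0 \<longrightarrow> cauchy_transform M z = 1 / F (z + \<i> * of_real \<epsilon>))"
proof -
  define f where "f z = F (z + \<i> * of_real \<epsilon>)" for z
  define K where "K = C / \<epsilon> + \<epsilon>"
  have C0: "C \<ge> 0" using order_trans[OF norm_ge_zero near[of \<i>]] by simp
  have Imf: "Im (f z) \<ge> Im z + \<epsilon>" if "Im z > - \<epsilon>" for z
    using ge[of "z + \<i> * of_real \<epsilon>"] that by (simp add: f_def)
  have nearf: "cmod (f z - z) \<le> K" if "Im z \<ge> 0" for z
  proof -
    have "f z - z = (F (z + \<i> * of_real \<epsilon>) - (z + \<i> * of_real \<epsilon>)) + \<i> * of_real \<epsilon>" by (simp add: f_def)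
    also have "cmod \<dots> \<le> cmod (F (z + \<i> * of_real \<epsilon>) - (z + \<i> * of_real \<epsilon>)) + cmod (\<i> * of_real \<epsilon>)"
      by (rule norm_triangle_ineq)
    also have "\<dots> \<le> C / Im (z + \<i> * of_real \<epsilon>) + \<epsilon>"
      using near[of "z + \<i> * of_real \<epsilon>"] that \<epsilon> by (intro add_mono) (auto simp: norm_mult)
    also have "\<dots> \<le> K" unfolding K_def using that \<epsilon> C0 by (intro add_right_mono divide_left_mono) auto
    finally show ?thesis .
  qed
  have f_ge: "cmod (f z) \<ge> Im z + \<epsilon>" if "Im z \<ge> 0" for z
    using Imf[of z] abs_Im_le_cmod[of "f z"] that \<epsilon> by simp
  have f0: "f z \<noteq> 0" if "Im z > - \<epsilon>" for z
    using Imf[OF that] that by auto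
  interpret half_plane_decay "\<lambda>z. 1 / f z" \<epsilon> "(1 + K) / \<epsilon> + 1"
  proof
    have "f holomorphic_on {z. - \<epsilon> < Im z}"
      unfolding f_def by (rule holomorphic_on_compose_gen[OF _ holo, unfolded o_def])
        (auto intro!: holomorphic_intros simp: upper_half_plane_def)
    then show "(\<lambda>z. 1 / f z) holomorphic_on {z. - \<epsilon> < Im z}"
      using f0 by (intro holomorphic_intros) auto
    show "cmod (1 / f z) * (1 + cmod z) \<le> (1 + K) / \<epsilon> + 1" if z: "0 \<le> Im z" for z
    proof -
      have fz: "cmod (f z) \<ge> \<epsilon>" using f_ge[OF z] z by simp
      have "cmod z \<le> cmod (f z) + K"
        using nearf[OF z] norm_triangle_sub[of z "f z"] by (simp add: norm_minus_commute)
      moreover have "K \<ge> 0" using nearf[OF z] by (rule order_trans[OF norm_ge_zero])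
      ultimately have "(1 + cmod z) / cmod (f z) \<le> (1 + K + cmod (f z)) / cmod (f z)"
        by (intro divide_right_mono) auto
      also have "\<dots> = (1 + K) / cmod (f z) + 1"
        using f0[of z] z \<epsilon> by (simp add: add_divide_distrib)
      also have "\<dots> \<le> (1 + K) / \<epsilon> + 1"
        using fz \<epsilon> \<open>K \<ge> 0\<close> by (intro add_right_mono divide_left_mono mult_pos_pos) auto
      finally show ?thesis by (simp add: norm_divide)
    qed
  qed (rule \<epsilon>)
  have Im1: "Im (1 / f z) = - Im (f z) * (cmod (1 / f z))\<^sup>2" for z
    by (simp add: Im_divide norm_divide power_divide cmod_power2)
  have Imf_bound: "\<bar>Im (f (complex_of_real x))\<bar> \<le> K" for x
    using nearf[of "complex_of_real x"] abs_Im_le_cmod[of "f (complex_of_real x) - complex_of_real x"] by simp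
  have nonpos: "Im (1 / f (complex_of_real x)) \<le> 0" for x
    unfolding Im1 using Imf[of "complex_of_real x"] \<epsilon> by (simp add: mult_nonneg_nonneg)
  have sq: "integrable lborel (\<lambda>x. (cmod (1 / f (complex_of_real x)))\<^sup>2)"
    using decay[of "complex_of_real x" for x]
    by (intro integrable_norm_squared_of_decay[where B = "(1 + K) / \<epsilon> + 1"]) auto
  \<comment> \<open>Decay like \<open>1 / x\<close> alone does not give integrability; but the
    imaginary part of \<open>1 / f\<close> carries the square of its modulus, and
    \<open>Im f\<close> is bounded on the axis.\<close>
  have int: "integrable lborel (\<lambda>x. Im (1 / f (complex_of_real x)))"
  proof (rule Bochner_Integration.integrable_bound)
    show "integrable lborel (\<lambda>x. K * (cmod (1 / f (complex_of_real x)))\<^sup>2)"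
      using sq by (rule integrable_mult_right)
    show "AE x in lborel. norm (Im (1 / f (complex_of_real x))) \<le> norm (K * (cmod (1 / f (complex_of_real x)))\<^sup>2)"
      unfolding Im1 real_norm_def abs_mult abs_minus_cancel
      by (intro AE_I2 mult_right_mono order_trans[OF Imf_bound abs_ge_self]) simp
  qed simp
  have lim: "(\<lambda>n. \<i> * of_nat n * (1 / f (\<i> * of_nat n))) \<longlonglongrightarrow> 1"
  proof (rule LIM_zero_cancel, rule Lim_null_comparison)
    show "\<forall>\<^sub>F n in sequentially. cmod (\<i> * of_nat n * (1 / f (\<i> * of_nat n)) - 1) \<le> K * (1 / real n)"
      using eventually_gt_at_top[of 0]
    proof eventually_elim
      case (elim n)
      let ?z = "\<i> * of_nat n :: complex"
      have "f ?z \<noteq> 0" using f0[of ?z] \<epsilon> by simp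
      then have "?z * (1 / f ?z) - 1 = - (f ?z - ?z) / f ?z" by (simp add: field_simps)
      then have "cmod (?z * (1 / f ?z) - 1) = cmod (f ?z - ?z) / cmod (f ?z)"
        by (simp only: norm_divide norm_minus_cancel)
      also have "\<dots> \<le> K / real n"
        using nearf[of ?z] f_ge[of ?z] elim \<epsilon> order_trans[OF norm_ge_zero nearf[of ?z]]
        by (intro frac_le) auto
      finally show ?case by simp
    qed
    show "(\<lambda>n. K * (1 / real n)) \<longlonglongrightarrow> 0"
      by (rule tendsto_mult_right_zero[OF lim_1_over_n])
  qed
  show ?thesis
    using boundary_distribution[OF nonpos int lim] unfolding f_def by blast
qed

text \<open>The shifted functions with \<open>\<epsilon> = 1 / (n + 1)\<close> converge pointwise by
  continuity of \<open>F\<close>. The bound on \<open>F z - z\<close> forces \<open>z / F z\<close>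
  to tend to 1 along the imaginary axis, so no mass is lost in the limit.\<close>

theorem F_transform_exists:
  assumes holo: "F holomorphic_on upper_half_plane"
    and ge: "\<And>z. Im z > 0 \<Longrightarrow> Im (F z) \<ge> Im z"
    and near: "\<And>z. Im z > 0 \<Longrightarrow> cmod (F z - z) \<le> C / Im z"
  shows "\<exists>M. real_distribution M \<and> (\<forall>z. Im z > 0 \<longrightarrow> F_transform M z = F z)"
proof -
  have "\<exists>M. real_distribution M \<and> (\<forall>z. Im z > 0 \<longrightarrow> cauchy_transform M z = 1 / F (z + \<i> * of_real (1 / real (Suc n))))" for n
    by (rule boundary_distribution_of_F[OF holo ge near]) auto
  then obtain \<mu> where \<mu>: "\<And>n. real_distribution (\<mu> n)"
    "\<And>n z. Im z > 0 \<Longrightarrow> cauchy_transform (\<mu> n) z = 1 / F (z + \<i> * of_real (1 / real (Suc n)))"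
    by metis
  have F0: "F z \<noteq> 0" if "Im z > 0" for z using ge[OF that] that by auto
  have C0: "C \<ge> 0" using order_trans[OF norm_ge_zero near[of \<i>]] by simp
  have conv: "(\<lambda>n. cauchy_transform (\<mu> n) z) \<longlonglongrightarrow> 1 / F z" if z: "Im z > 0" for z
  proof -
    have "isCont F z"
      using holomorphic_on_imp_continuous_on[OF holo] open_upper_half_plane z
      by (auto simp: continuous_on_eq_continuous_at upper_half_plane_def)
    moreover have "(\<lambda>n. z + \<i> * of_real (1 / real (Suc n))) \<longlonglongrightarrow> z + \<i> * of_real 0"
      by (intro tendsto_intros LIMSEQ_Suc[OF lim_1_over_n])
    ultimately have "(\<lambda>n. F (z + \<i> * of_real (1 / real (Suc n)))) \<longlonglongrightarrow> F z"
      by (intro isCont_tendsto_compose[of z F]) auto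
    then show ?thesis unfolding \<mu>(2)[OF z] using F0[OF z] by (intro tendsto_intros)
  qed
  have lim: "(\<lambda>k. \<i> * of_nat k * (1 / F (\<i> * of_nat k))) \<longlonglongrightarrow> 1"
  proof (rule LIM_zero_cancel, rule Lim_null_comparison)
    show "\<forall>\<^sub>F n in sequentially. cmod (\<i> * of_nat n * (1 / F (\<i> * of_nat n)) - 1) \<le> C * (1 / real n)"
      using eventually_gt_at_top[of 0]
    proof eventually_elim
      case (elim n)
      let ?z = "\<i> * of_nat n :: complex"
      have z: "Im ?z > 0" using elim by simp
      have n: "real n \<ge> 1" using elim by simp
      have "?z * (1 / F ?z) - 1 = - (F ?z - ?z) / F ?z" using F0[OF z] by (simp add: field_simps)
      then have "cmod (?z * (1 / F ?z) - 1) = cmod (F ?z - ?z) / cmod (F ?z)"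
        by (simp only: norm_divide norm_minus_cancel)
      also have "\<dots> \<le> C / real n"
      proof (rule frac_le)
        have "C / real n \<le> C / 1" using n C0 by (intro divide_left_mono) auto
        then show "cmod (F ?z - ?z) \<le> C" using near[OF z] by simp
        show "real n \<le> cmod (F ?z)" using ge[OF z] abs_Im_le_cmod[of "F ?z"] by simp
      qed (use C0 elim in auto)
      finally show ?case by simp
    qed
    show "(\<lambda>n. C * (1 / real n)) \<longlonglongrightarrow> 0"
      by (rule tendsto_mult_right_zero[OF lim_1_over_n])
  qed
  obtain M where "real_distribution M" "\<And>z. Im z > 0 \<Longrightarrow> cauchy_transform M z = 1 / F z"
    using cauchy_transform_limit_exists[of \<mu> "\<lambda>z. 1 / F z", OF \<mu>(1) conv lim] by blast
  then show ?thesis unfolding F_transform_def by auto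
qed

section \<open>Free convolution powers\<close>

text \<open>Strictness in the Schwarz-Pick inequality: a solution \<open>w\<close> satisfies
  \<open>(s - 1) Im (F w) < s Im w\<close>, whereas two distinct solutions would force the opposite.\<close>

lemma (in real_distribution) subordination_unique:
  assumes s: "s \<ge> 1" and z: "Im z > 0" and w: "Im v > 0" "Im w > 0"
    and v_eq: "v = z + (of_real s - 1) * (F_transform M v - v)"
    and w_eq: "w = z + (of_real s - 1) * (F_transform M w - w)"
  shows "v = w"
proof (rule ccontr)
  assume "v \<noteq> w"
  let ?F = "F_transform M"
  have Fpos: "Im (?F v) > 0" "Im (?F w) > 0" using Im_F_transform_ge w by force+
  have im: "s * Im u = Im z + (s - 1) * Im (?F u)" if "u = z + (of_real s - 1) * (?F u - u)" for u
  proof -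
    have "Im u = Im (z + (of_real s - 1) * (?F u - u))" using that by simp
    also have "\<dots> = Im z + (s - 1) * (Im (?F u) - Im u)" by simp
    finally show ?thesis by (simp add: algebra_simps)
  qed
  have lt: "(s - 1) * Im (?F v) < s * Im v" "(s - 1) * Im (?F w) < s * Im w"
    using im[OF v_eq] im[OF w_eq] z by auto
  have ge0: "0 \<le> (s - 1) * Im (?F v)" "0 \<le> (s - 1) * Im (?F w)" using s Fpos by auto
  have diff: "of_real s * (v - w) = (of_real s - 1) * (?F v - ?F w)"
  proof -
    have "v - w = (z + (of_real s - 1) * (?F v - v)) - (z + (of_real s - 1) * (?F w - w))"
      using v_eq w_eq by simp
    also have "\<dots> = (of_real s - 1) * (?F v - ?F w) - of_real s * (v - w) + (v - w)"
      by (simp add: algebra_simps)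
    finally show ?thesis by simp
  qed
  have "cmod (of_real s * (v - w)) = cmod (of_real (s - 1) * (?F v - ?F w))"
    using diff by simp
  then have "s * cmod (v - w) = (s - 1) * cmod (?F v - ?F w)"
    using s by (simp only: norm_mult norm_of_real)
  \<comment> \<open>Squaring and multiplying by \<open>Im v * Im w\<close> prepares the Schwarz-Pick
    inequality; the contradiction then comes from \<open>lt\<close> in both factors.\<close>
  then have "(s * cmod (v - w))\<^sup>2 * (Im v * Im w) = (s - 1)\<^sup>2 * ((cmod (?F v - ?F w))\<^sup>2 * (Im v * Im w))"
    by (simp add: power_mult_distrib mult_ac)
  also have "\<dots> \<le> (s - 1)\<^sup>2 * ((cmod (v - w))\<^sup>2 * (Im (?F v) * Im (?F w)))"
    by (intro mult_left_mono F_transform_schwarz_pick w) simp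
  also have "\<dots> = (cmod (v - w))\<^sup>2 * (((s - 1) * Im (?F v)) * ((s - 1) * Im (?F w)))"
    by (simp add: power2_eq_square mult_ac)
  also have "\<dots> < (cmod (v - w))\<^sup>2 * ((s * Im v) * (s * Im w))"
    using \<open>v \<noteq> w\<close> s w by (intro mult_strict_left_mono mult_strict_mono lt ge0) auto
  also have "\<dots> = (s * cmod (v - w))\<^sup>2 * (Im v * Im w)"
    by (simp add: power2_eq_square mult_ac)
  finally show False by simp
qed

section \<open>Subordination functions and right inverses\<close>

context standardized_distribution
begin

text \<open>Minus the self-energy \<open>z - F z\<close>; Boolean powers multiply it by the
  exponent.\<close>

definition excess :: "complex \<Rightarrow> complex" where
  "excess z = F_transform M z - z"

lemma holomorphic_excess: "excess holomorphic_on upper_half_plane"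
  unfolding excess_def[abs_def] by (intro holomorphic_intros holomorphic_F_transform)

lemma continuous_on_excess: "S \<subseteq> upper_half_plane \<Longrightarrow> continuous_on S excess"
  using holomorphic_excess holomorphic_on_imp_continuous_on continuous_on_subset by blast

lemma Im_excess_nonneg: "Im z > 0 \<Longrightarrow> Im (excess z) \<ge> 0"
  using Im_F_transform_ge[of z] by (simp add: excess_def)

lemma norm_excess_le: "Im z > 0 \<Longrightarrow> cmod (excess z) \<le> 1 / Im z"
  using norm_F_transform_diff_le by (simp add: excess_def)

lemma subordination_exists:
  assumes s: "s \<ge> 1" and z: "Im z > 0"
  shows "\<exists>w. Im w > 0 \<and> w = z + (of_real s - 1) * excess w"
proof -
  \<comment> \<open>Invariant under the map: on \<open>Im w \<ge> Im z\<close> the excess has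
    modulus at most \<open>1 / Im z\<close> and nonnegative imaginary part. The disc supplies
    compactness.\<close>
  define K where "K = cball z ((s - 1) / Im z) \<inter> {w. Im w \<ge> Im z}"
  have sub: "K \<subseteq> upper_half_plane" using z by (auto simp: K_def upper_half_plane_def)
  obtain w where "w \<in> K" "z + (of_real s - 1) * excess w = w"
  proof (rule brouwer[of K "\<lambda>w. z + (of_real s - 1) * excess w"])
    show "compact K" unfolding K_def by (intro compact_Int_closed compact_cball closed_halfspace_Im_ge)
    show "convex K" unfolding K_def by (intro convex_Int convex_cball convex_halfspace_Im_ge)
    have "z \<in> K" using s z by (simp add: K_def)
    then show "K \<noteq> {}" by blast
    show "continuous_on K (\<lambda>w. z + (of_real s - 1) * excess w)"
      by (intro continuous_intros continuous_on_excess sub)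
    show "(\<lambda>w. z + (of_real s - 1) * excess w) \<in> K \<rightarrow> K"
    proof
      fix w assume "w \<in> K"
      then have w: "Im w \<ge> Im z" by (simp add: K_def)
      have "cmod ((of_real s - 1) * excess w) = (s - 1) * cmod (excess w)"
        using s norm_of_real[of "s - 1", where 'a = complex] by (simp add: norm_mult)
      also have "cmod (excess w) \<le> 1 / Im w" using w z by (intro norm_excess_le) auto
      also have "\<dots> \<le> 1 / Im z" using w z by (simp add: frac_le)
      finally have "cmod ((of_real s - 1) * excess w) \<le> (s - 1) / Im z"
        using s by (simp add: mult_left_mono)
      moreover have "0 \<le> (s - 1) * Im (excess w)"
        using s w z Im_excess_nonneg[of w] by simp
      ultimately show "z + (of_real s - 1) * excess w \<in> K"
        by (simp add: K_def dist_norm)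
    qed
  qed
  then show ?thesis using sub by (auto simp: upper_half_plane_def intro!: exI[of _ w])
qed

definition subordination :: "real \<Rightarrow> complex \<Rightarrow> complex" where
  "subordination s z = (THE w. Im w > 0 \<and> w = z + (of_real s - 1) * excess w)"

lemma subordination_eqI:
  assumes "s \<ge> 1" "Im z > 0" "Im w > 0" "w = z + (of_real s - 1) * excess w"
  shows "subordination s z = w"
  unfolding subordination_def
  by (rule the_equality) (use assms subordination_unique[of s z] in \<open>auto simp: excess_def\<close>)

lemma subordination:
  assumes "s \<ge> 1" "Im z > 0"
  shows "subordination s z = z + (of_real s - 1) * excess (subordination s z)"
    and "Im (subordination s z) \<ge> Im z"
proof -
  obtain w where w: "Im w > 0" "w = z + (of_real s - 1) * excess w"
    using subordination_exists[OF assms] by blast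
  have eq: "subordination s z = w" by (rule subordination_eqI[OF assms w])
  show "subordination s z = z + (of_real s - 1) * excess (subordination s z)"
    unfolding eq by (rule w(2))
  have "Im w = Im z + (s - 1) * Im (excess w)"
    using arg_cong[OF w(2), of Im] by simp
  then show "Im (subordination s z) \<ge> Im z"
    unfolding eq using Im_excess_nonneg[OF w(1)] assms(1) by simp
qed

text \<open>The subordination function inverts \<open>H\<close>. Uniqueness of solutions says that
  \<open>H\<close> is injective on the preimage \<Omega> of the half-plane, and the inverse of an
  injective holomorphic map is holomorphic, so no estimate on the derivative of \<open>H\<close>
  enters.\<close>

lemma holomorphic_subordination:
  assumes s: "s \<ge> 1"
  shows "subordination s holomorphic_on upper_half_plane"
proof -
  define H where "H w = w - (of_real s - 1) * excess w" for w
  define \<Omega> where "\<Omega> = upper_half_plane \<inter> H -` upper_half_plane"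
  have holoH: "H holomorphic_on upper_half_plane"
    unfolding H_def by (intro holomorphic_intros holomorphic_excess)
  have op: "open \<Omega>"
    unfolding \<Omega>_def
    by (rule continuous_open_preimage[OF holomorphic_on_imp_continuous_on[OF holoH] open_upper_half_plane open_upper_half_plane])
  have inv: "subordination s (H w) = w" if "w \<in> \<Omega>" for w
    using that by (intro subordination_eqI[OF s]) (auto simp: \<Omega>_def upper_half_plane_def H_def)
  have holo: "H holomorphic_on \<Omega>" by (rule holomorphic_on_subset[OF holoH]) (simp add: \<Omega>_def)
  have "inj_on H \<Omega>" by (rule inj_on_inverseI[of _ "subordination s"]) (rule inv)
  then obtain g where g: "g holomorphic_on (H ` \<Omega>)" "\<And>w. w \<in> \<Omega> \<Longrightarrow> g (H w) = w"
    using holomorphic_has_inverse[OF holo op] by metis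
  have HS: "H (subordination s z) = z" "subordination s z \<in> \<Omega>" if "z \<in> upper_half_plane" for z
  proof -
    have z: "Im z > 0" using that by (simp add: upper_half_plane_def)
    show *: "H (subordination s z) = z"
      using subordination(1)[OF s z] by (simp add: H_def algebra_simps)
    show "subordination s z \<in> \<Omega>"
      using * subordination(2)[OF s z] z by (simp add: \<Omega>_def upper_half_plane_def)
  qed
  have "g holomorphic_on upper_half_plane"
    using HS by (intro holomorphic_on_subset[OF g(1)]) (metis image_eqI subsetI)
  moreover have "g z = subordination s z" if "z \<in> upper_half_plane" for z
    using g(2)[OF HS(2)[OF that]] HS(1)[OF that] by simp
  ultimately show ?thesis by (metis (no_types, lifting) holomorphic_cong)
qed

lemma F_transform_subordination:
  assumes "s \<ge> 1" "Im z > 0"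
  shows "F_transform M (subordination s z) = z + of_real s * excess (subordination s z)"
proof -
  have "F_transform M (subordination s z) = subordination s z + excess (subordination s z)"
    by (simp add: excess_def)
  also have "\<dots> = (z + (of_real s - 1) * excess (subordination s z)) + excess (subordination s z)"
    using subordination(1)[OF assms] by simp
  finally show ?thesis by (simp add: algebra_simps)
qed

lemma holomorphic_F_subordination:
  assumes "s \<ge> 1"
  shows "(\<lambda>z. F_transform M (subordination s z)) holomorphic_on upper_half_plane"
  by (rule holomorphic_on_compose_gen[OF holomorphic_subordination[OF assms] holomorphic_F_transform, unfolded o_def])
    (use subordination(2)[OF assms] in \<open>force simp: upper_half_plane_def\<close>)

lemma norm_excess_subordination_le:
  assumes "s \<ge> 1" "Im z > 0"
  shows "cmod (excess (subordination s z)) \<le> 1 / Im z"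
proof -
  have "cmod (excess (subordination s z)) \<le> 1 / Im (subordination s z)"
    using subordination(2)[OF assms] assms by (intro norm_excess_le) auto
  also have "\<dots> \<le> 1 / Im z" using subordination(2)[OF assms] assms by (simp add: frac_le)
  finally show ?thesis .
qed

text \<open>Above height 3 a disc of radius 2 stays above height 1, where the excess is at most 1;
  Cauchy's estimate then bounds its derivative by 1/2, and a perturbation of the identity with
  Lipschitz constant 1/2 is injective. For \<open>Im z > 4\<close> the unit disc around
  \<open>z\<close> lies above height 3, and Brouwer's theorem gives a preimage in it.\<close>

lemma F_right_inverse_exists:
  obtains g where "g holomorphic_on {z. Im z > 4}"
    "\<And>z. Im z > 4 \<Longrightarrow> Im (g z) > 3 \<and> F_transform M (g z) = z \<and> cmod (g z - z) \<le> 1"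
proof -
  let ?S = "{w. Im w > 3}"
  have excess_lipschitz: "cmod (excess v - excess w) \<le> 1 / 2 * cmod (v - w)" if "v \<in> ?S" "w \<in> ?S" for v w
  proof (rule field_differentiable_bound[of ?S excess "deriv excess"])
    show "convex ?S" by (rule convex_halfspace_Im_gt)
    fix u assume u: "u \<in> ?S"
    have "u \<in> upper_half_plane" using u by (simp add: upper_half_plane_def)
    then show "(excess has_field_derivative deriv excess u) (at u within ?S)"
      using holomorphic_derivI[OF holomorphic_excess open_upper_half_plane] by (blast intro: has_field_derivative_at_within)
    have Imv: "Im v > 1" if "v \<in> cball u 2" for v
      using abs_Im_le_cmod[of "u - v"] that u by (auto simp: dist_norm)
    have sub: "cball u 2 \<subseteq> upper_half_plane"
      using Imv by (force simp: upper_half_plane_def)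
    have "cmod ((deriv ^^ 1) excess u) \<le> fact 1 * 1 / 2 ^ 1"
    proof (rule Cauchy_inequality)
      show "excess holomorphic_on ball u 2"
        using sub by (intro holomorphic_on_subset[OF holomorphic_excess]) (use ball_subset_cball in blast)
      show "continuous_on (cball u 2) excess" by (rule continuous_on_excess[OF sub])
      fix v assume "cmod (u - v) = 2"
      then have "Im v > 1" by (intro Imv) (simp add: dist_norm)
      then have "cmod (excess v) \<le> 1 / Im v" "1 / Im v \<le> 1" by (auto intro: norm_excess_le)
      then show "cmod (excess v) \<le> 1" by linarith
    qed simp
    then show "cmod (deriv excess u) \<le> 1 / 2" by simp
  qed (use that in auto)
  have inj: "inj_on (F_transform M) ?S"
  proof (rule inj_onI)
    fix v w assume vw: "v \<in> ?S" "w \<in> ?S" and eq: "F_transform M v = F_transform M w"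
    have "excess v - excess w = w - v" using eq by (simp add: excess_def)
    then have "cmod (w - v) \<le> 1 / 2 * cmod (v - w)" using excess_lipschitz[OF vw] by simp
    then have "cmod (v - w) \<le> 0" by (simp add: norm_minus_commute)
    then show "v = w" by simp
  qed
  have ex: "\<exists>w\<in>?S. F_transform M w = z \<and> cmod (w - z) \<le> 1" if z: "Im z > 4" for z
  proof -
    have Imw: "Im w > 3" if "w \<in> cball z 1" for w
      using abs_Im_le_cmod[of "z - w"] that z by (auto simp: dist_norm)
    obtain w where w: "w \<in> cball z 1" "z - excess w = w"
    proof (rule brouwer[of "cball z 1" "\<lambda>w. z - excess w"])
      show "continuous_on (cball z 1) (\<lambda>w. z - excess w)"
        using Imw by (intro continuous_intros continuous_on_excess) (force simp: upper_half_plane_def)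
      show "(\<lambda>w. z - excess w) \<in> cball z 1 \<rightarrow> cball z 1"
      proof
        fix w assume "w \<in> cball z 1"
        then have "Im w > 3" by (rule Imw)
        then have "cmod (excess w) \<le> 1 / Im w" "1 / Im w \<le> 1" by (auto intro: norm_excess_le)
        then show "z - excess w \<in> cball z 1" by (simp add: dist_norm)
      qed
    qed auto
    have "F_transform M w = z" using w(2) by (simp add: excess_def algebra_simps)
    with w(1) Imw[OF w(1)] show ?thesis by (auto simp: dist_norm norm_minus_commute)
  qed
  have holo: "F_transform M holomorphic_on ?S"
    by (rule holomorphic_on_subset[OF holomorphic_F_transform]) (auto simp: upper_half_plane_def)
  obtain g where g: "g holomorphic_on (F_transform M ` ?S)" "\<And>w. w \<in> ?S \<Longrightarrow> g (F_transform M w) = w"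
    using holomorphic_has_inverse[OF holo open_halfspace_Im_gt inj] by metis
  show thesis
  proof
    show "g holomorphic_on {z. Im z > 4}"
      by (rule holomorphic_on_subset[OF g(1)]) (use ex in force)
    show "Im (g z) > 3 \<and> F_transform M (g z) = z \<and> cmod (g z - z) \<le> 1" if "Im z > 4" for z
      using ex[OF that] g(2) by fastforce
  qed
qed

end

lemma tendsto_ratio_of_bounded_diff:
  fixes g :: "complex \<Rightarrow> complex"
  assumes "\<And>z. z \<in> S \<Longrightarrow> cmod (g z - z) \<le> c" "0 \<notin> S" "T \<subseteq> S"
  shows "((\<lambda>z. g z / z) \<longlongrightarrow> 1) (inf at_infinity (principal T))"
proof (rule LIM_zero_cancel, rule Lim_null_comparison)
  show "\<forall>\<^sub>F z in inf at_infinity (principal T). cmod (g z / z - 1) \<le> c * cmod (inverse z)"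
    unfolding eventually_inf_principal
  proof (intro always_eventually allI impI)
    fix z assume "z \<in> T"
    then have z: "z \<in> S" "z \<noteq> 0" using assms by auto
    have "g z / z - 1 = (g z - z) * inverse z" using z(2) by (simp add: field_simps)
    then show "cmod (g z / z - 1) \<le> c * cmod (inverse z)"
      using assms(1)[OF z(1)] by (simp only: norm_mult mult_right_mono norm_ge_zero)
  qed
  have "((\<lambda>z::complex. c * cmod (inverse z)) \<longlongrightarrow> 0) at_infinity"
    by (intro tendsto_mult_right_zero tendsto_norm_zero tendsto_inverse_0)
  then show "((\<lambda>z. c * cmod (inverse z)) \<longlongrightarrow> 0) (inf at_infinity (principal T))"
    by (rule tendsto_mono[OF inf_le1])
qed

lemma open_truncated_cone: "open (truncated_cone \<kappa> R)"
proof -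
  have "truncated_cone \<kappa> R = upper_half_plane \<inter> {z. \<bar>Re z\<bar> < \<kappa> * Im z} \<inter> {z. R < Im z}"
    by (auto simp: truncated_cone_def)
  then show ?thesis
    by (auto intro!: open_Int open_upper_half_plane open_Collect_less continuous_intros)
qed

section \<open>Identification of free powers through Voiculescu transforms\<close>

context standardized_distribution
begin

text \<open>Since \<open>excess (g z) = z - g z\<close>, the subordination equation for the value
  \<open>g z\<close> is solved by the argument \<open>k z = z + s * (g z - z)\<close>. Hence
  \<open>k\<close> is a right inverse of the F-transform of \<nu>, and its Voiculescu transform is
  visibly \<open>s\<close> times that of \<open>M\<close>.\<close>

lemma is_free_powerI:
  assumes s: "s \<ge> 1" and \<nu>: "real_distribution \<nu>"
    and F: "\<And>z. Im z > 0 \<Longrightarrow> F_transform \<nu> z = F_transform M (subordination s z)"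
  shows "is_free_power M s \<nu>"
proof -
  obtain g where holo: "g holomorphic_on {z. Im z > 4}"
    and g: "\<And>z. Im z > 4 \<Longrightarrow> Im (g z) > 3 \<and> F_transform M (g z) = z \<and> cmod (g z - z) \<le> 1"
    using F_right_inverse_exists by blast
  \<comment> \<open>Height 4 is where \<open>g\<close> is defined; height \<open>s\<close> keeps
    \<open>k z\<close> in the upper half-plane, as \<open>k\<close> moves points by at most
    \<open>s\<close>.\<close>
  define R where "R = max 4 s"
  define k where "k z = z + of_real s * (g z - z)" for z
  have cone: "Im z > 4" "Im z > s" "z \<noteq> 0" if "z \<in> truncated_cone 1 R" for z
    using that by (auto simp: truncated_cone_def R_def)
  have holo_cone: "g holomorphic_on truncated_cone 1 R"
    by (rule holomorphic_on_subset[OF holo]) (use cone in auto)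
  have near: "cmod (k z - z) \<le> s" if "z \<in> truncated_cone 1 R" for z
    using g[OF cone(1)[OF that]] s by (simp add: k_def norm_mult)
  have Imk: "Im (k z) > 0" if "z \<in> truncated_cone 1 R" for z
    using near[OF that] abs_Im_le_cmod[of "k z - z"] cone[OF that] by simp
  have Fk: "F_transform \<nu> (k z) = z" if z: "z \<in> truncated_cone 1 R" for z
  proof -
    have gz: "F_transform M (g z) = z" "Im (g z) > 0" using g[OF cone(1)[OF z]] by auto
    have "subordination s (k z) = g z"
      by (rule subordination_eqI[OF s Imk[OF z] gz(2)]) (simp add: excess_def gz k_def algebra_simps)
    then show ?thesis using F[OF Imk[OF z]] gz by simp
  qed
  have "F_right_inverse M 1 R g"
    unfolding F_right_inverse_def
  proof (intro conjI ballI allI impI)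
    show "g ` truncated_cone 1 R \<subseteq> upper_half_plane"
      using g cone(1) by (force simp: upper_half_plane_def)
    show "F_transform M (g z) = z" if "z \<in> truncated_cone 1 R" for z using g[OF cone(1)[OF that]] by simp
    show "((\<lambda>z. g z / z) \<longlongrightarrow> 1) (inf at_infinity (principal {z \<in> truncated_cone 1 R. \<bar>Re z\<bar> < \<beta> * Im z}))" for \<beta>
      by (rule tendsto_ratio_of_bounded_diff[of "truncated_cone 1 R" _ 1]) (use g cone in auto)
  qed (rule holo_cone)
  moreover have "F_right_inverse \<nu> 1 R k"
    unfolding F_right_inverse_def
  proof (intro conjI ballI allI impI)
    show "k holomorphic_on truncated_cone 1 R"
      unfolding k_def by (intro holomorphic_intros holo_cone)
    show "k ` truncated_cone 1 R \<subseteq> upper_half_plane"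
      using Imk by (auto simp: upper_half_plane_def)
    show "((\<lambda>z. k z / z) \<longlongrightarrow> 1) (inf at_infinity (principal {z \<in> truncated_cone 1 R. \<bar>Re z\<bar> < \<beta> * Im z}))" for \<beta>
      by (rule tendsto_ratio_of_bounded_diff[of "truncated_cone 1 R" _ s]) (use near cone in auto)
  qed (rule Fk)
  ultimately have "voiculescu_transform_on M 1 R (\<lambda>z. g z - z)" "voiculescu_transform_on \<nu> 1 R (\<lambda>z. k z - z)"
    unfolding voiculescu_transform_on_def by auto
  moreover have "R > 0" by (simp add: R_def)
  ultimately show ?thesis
    unfolding is_free_power_def using \<nu>
    by (intro conjI exI[of _ 1] exI[of _ R] exI[of _ "\<lambda>z. g z - z"] exI[of _ "\<lambda>z. k z - z"])
      (auto simp: k_def)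
qed

text \<open>The converse computation works for any right inverses witnessing the free power, but
  only on the image of the cone under \<open>k\<close>. This image is open because \<open>k\<close>
  is injective, and the identity theorem extends the equation to the half-plane.\<close>

lemma is_free_powerD:
  assumes s: "s \<ge> 1" and free: "is_free_power M s \<nu>" and z: "Im z > 0"
  shows "F_transform \<nu> z = F_transform M (subordination s z)"
proof -
  have \<nu>: "real_distribution \<nu>" using free by (simp add: is_free_power_def)
  obtain \<kappa> R g k where pos: "\<kappa> > 0" "R > 0" and g: "F_right_inverse M \<kappa> R g" and k: "F_right_inverse \<nu> \<kappa> R k"
    and gk: "\<And>z. z \<in> truncated_cone \<kappa> R \<Longrightarrow> k z - z = of_real s * (g z - z)"
    using free unfolding is_free_power_def voiculescu_transform_on_def by fastforce
  let ?C = "truncated_cone \<kappa> R"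
  have inv: "F_transform \<nu> (k z) = z" if "z \<in> ?C" for z
    using k that by (simp add: F_right_inverse_def)
  have "inj_on k ?C" by (rule inj_on_inverseI[of _ "F_transform \<nu>"]) (rule inv)
  moreover have "k holomorphic_on ?C" using k by (simp add: F_right_inverse_def)
  ultimately have op: "open (k ` ?C)" by (intro open_mapping_thm3 open_truncated_cone)
  have "Complex 0 (R + 1) \<in> ?C" using pos by (simp add: truncated_cone_def upper_half_plane_def)
  then have ne: "k ` ?C \<noteq> {}" by blast
  have sub: "k ` ?C \<subseteq> upper_half_plane" using k by (simp add: F_right_inverse_def)
  have eq: "F_transform \<nu> v = F_transform M (subordination s v)" if v: "v \<in> k ` ?C" for v
  proof -
    obtain u where u: "u \<in> ?C" "v = k u" using v by blast
    have gu: "F_transform M (g u) = u" "Im (g u) > 0"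
      using g u by (auto simp: F_right_inverse_def upper_half_plane_def)
    have "k u = u + of_real s * (g u - u)" using gk[OF u(1)] by (simp add: algebra_simps)
    then have "subordination s (k u) = g u"
      using sub u by (intro subordination_eqI[OF s _ gu(2)])
        (auto simp: upper_half_plane_def excess_def gu algebra_simps)
    then show ?thesis using inv[OF u(1)] u gu by simp
  qed
  show ?thesis
    by (rule analytic_continuation_open[OF op open_upper_half_plane ne
          convex_connected[OF convex_upper_half_plane] sub
          real_distribution.holomorphic_F_transform[OF \<nu>] holomorphic_F_subordination[OF s] eq])
      (use z in \<open>simp_all add: upper_half_plane_def\<close>)
qed

text \<open>The constructed measure is a free power, and every free power has the same F-transform;
  together these make the definite description meaningful.\<close>

theorem
  assumes s: "s \<ge> 1"
  shows real_distribution_free_power: "real_distribution (free_power M s)"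
    and F_transform_free_power: "Im z > 0 \<Longrightarrow>
      F_transform (free_power M s) z = z + of_real s * excess (subordination s z)"
proof -
  have "\<exists>\<nu>. real_distribution \<nu> \<and> (\<forall>z. Im z > 0 \<longrightarrow> F_transform \<nu> z = F_transform M (subordination s z))"
  proof (rule F_transform_exists[where C = s])
    fix z :: complex assume z: "Im z > 0"
    have "Im (subordination s z) > 0" using subordination(2)[OF s z] z by simp
    then show "Im z \<le> Im (F_transform M (subordination s z))"
      using s Im_excess_nonneg by (simp add: F_transform_subordination[OF s z])
    have "s * cmod (excess (subordination s z)) \<le> s * (1 / Im z)"
      using s by (intro mult_left_mono norm_excess_subordination_le z) auto
    then show "cmod (F_transform M (subordination s z) - z) \<le> s / Im z"
      using s by (simp add: F_transform_subordination[OF s z] norm_mult)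
  qed (rule holomorphic_F_subordination[OF s])
  then obtain \<nu> where \<nu>: "real_distribution \<nu>" "\<And>z. Im z > 0 \<Longrightarrow> F_transform \<nu> z = F_transform M (subordination s z)"
    by blast
  have "\<nu>' = \<nu>" if "is_free_power M s \<nu>'" for \<nu>'
    using that \<nu> is_free_powerD[OF s that]
    by (intro F_transform_inject) (auto simp: is_free_power_def)
  then have "\<exists>!\<nu>. is_free_power M s \<nu>"
    using is_free_powerI[OF s \<nu>] by blast
  then have free: "is_free_power M s (free_power M s)"
    unfolding free_power_def by (rule theI')
  then show "real_distribution (free_power M s)" by (simp add: is_free_power_def)
  show "F_transform (free_power M s) z = z + of_real s * excess (subordination s z)" if "Im z > 0"
    unfolding is_free_powerD[OF s free that] by (rule F_transform_subordination[OF s that])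
qed

end

section \<open>Boolean convolution powers, dilations and the semicircle law\<close>

text \<open>The hypothesis \<open>near\<close> survives multiplication of \<open>F z - z\<close> by
  \<open>s\<close>, which is what the existence theorem requires. It holds with \<open>C = N\<close>
  for the free power and with \<open>C = 1\<close> for the semicircle law.\<close>

theorem (in real_distribution)
  assumes s: "s > 0"
    and near: "\<And>z. Im z > 0 \<Longrightarrow> cmod (F_transform M z - z) \<le> C / Im z"
  shows real_distribution_boolean_power: "real_distribution (boolean_power M s)"
    and F_transform_boolean_power: "Im z > 0 \<Longrightarrow>
      F_transform (boolean_power M s) z = z + of_real s * (F_transform M z - z)"
proof -
  let ?F = "\<lambda>z. z + of_real s * (F_transform M z - z)"
  have F: "?F z = of_real s * F_transform M z + (1 - of_real s) * z" for z
    by (simp add: algebra_simps)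
  have "\<exists>\<nu>. real_distribution \<nu> \<and> (\<forall>z. Im z > 0 \<longrightarrow> F_transform \<nu> z = ?F z)"
  proof (rule F_transform_exists)
    show "?F holomorphic_on upper_half_plane"
      by (intro holomorphic_intros holomorphic_F_transform)
    fix z :: complex assume z: "Im z > 0"
    show "Im z \<le> Im (?F z)" using Im_F_transform_ge[OF z] s by simp
    have "s * cmod (F_transform M z - z) \<le> s * (C / Im z)"
      using near[OF z] s by (intro mult_left_mono) auto
    then show "cmod (?F z - z) \<le> (s * C) / Im z" using s by (simp add: norm_mult)
  qed
  then obtain \<nu> where \<nu>: "real_distribution \<nu>" "\<And>z. Im z > 0 \<Longrightarrow> F_transform \<nu> z = ?F z" by blast
  have "is_boolean_power M s \<nu>"
    unfolding is_boolean_power_def using \<nu> F by (auto simp: upper_half_plane_def)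
  moreover have "\<nu>' = \<nu>" if "is_boolean_power M s \<nu>'" for \<nu>'
    using that \<nu> F by (intro F_transform_inject) (auto simp: is_boolean_power_def upper_half_plane_def)
  ultimately have "\<exists>!\<nu>. is_boolean_power M s \<nu>" by blast
  then have b: "is_boolean_power M s (boolean_power M s)"
    unfolding boolean_power_def by (rule theI')
  then show "real_distribution (boolean_power M s)" by (simp add: is_boolean_power_def)
  show "F_transform (boolean_power M s) z = ?F z" if "Im z > 0"
    using b that unfolding F by (simp add: is_boolean_power_def upper_half_plane_def)
qed

lemma (in real_distribution)
  shows real_distribution_dilation: "real_distribution (dilation c M)"
    and F_transform_dilation: "c > 0 \<Longrightarrow> F_transform (dilation c M) z = of_real c * F_transform M (z / of_real c)"
proof -
  show "real_distribution (dilation c M)"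
    unfolding dilation_def by (intro real_distribution_distr) simp
  show "F_transform (dilation c M) z = of_real c * F_transform M (z / of_real c)" if c: "c > 0"
  proof -
    have "cauchy_transform (dilation c M) z = (LINT x|M. 1 / (z - complex_of_real (c * x)))"
      unfolding cauchy_transform_def dilation_def by (rule integral_distr) auto
    also have "\<dots> = (LINT x|M. 1 / of_real c * (1 / (z / of_real c - complex_of_real x)))"
    proof (intro Bochner_Integration.integral_cong refl)
      fix x
      have "z - complex_of_real (c * x) = of_real c * (z / of_real c - complex_of_real x)"
        using c by (simp add: right_diff_distrib)
      then show "1 / (z - complex_of_real (c * x)) = 1 / of_real c * (1 / (z / of_real c - complex_of_real x))"
        by simp
    qed
    also have "\<dots> = 1 / of_real c * cauchy_transform M (z / of_real c)"
      unfolding cauchy_transform_def by (rule integral_mult_right_zero)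
    finally show ?thesis by (simp add: F_transform_def)
  qed
qed

lemma real_distribution_return: "real_distribution (return borel a)"
  unfolding real_distribution_def real_distribution_axioms_def by (simp add: prob_space_return)

lemma F_transform_return: "F_transform (return borel a) z = z - of_real a"
  unfolding F_transform_def cauchy_transform_def by (subst integral_return) auto

lemma F_transform_cauchy: "t > 0 \<Longrightarrow> Im z > 0 \<Longrightarrow> F_transform (cauchy_distribution t) z = z + \<i> * of_real t"
  by (simp add: F_transform_def cauchy_transform_cauchy)

text \<open>The two roots of the quadratic have product 1, so one lies inside the unit disc unless
  both are on the circle; there they would be conjugate and have a real sum.\<close>

lemma joukowski_root_exists:
  assumes z: "Im z > 0"
  obtains q where "q \<noteq> 0" "cmod q < 1" "q + 1 / q = z"
proof -
  define d where "d = csqrt (z\<^sup>2 - 4)"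
  define q where "q = (z + d) / 2"
  define r where "r = (z - d) / 2"
  have "q * r = (z\<^sup>2 - d\<^sup>2) / 4" by (simp add: q_def r_def power2_eq_square algebra_simps)
  also have "\<dots> = 1" by (simp add: d_def)
  finally have qr: "q * r = 1" .
  have sum: "q + r = z" by (simp add: q_def r_def field_simps)
  have nz: "q \<noteq> 0" "r \<noteq> 0" using qr by auto
  have inv: "r = 1 / q" "q = 1 / r" using qr nz by (auto simp: field_simps)
  have nqr: "cmod q * cmod r = 1" using qr by (metis norm_mult norm_one)
  have "cmod q \<noteq> 1"
  proof
    assume "cmod q = 1"
    then have "q * cnj q = 1" by (metis complex_norm_square mult_1_right of_real_1 power_one)
    then have "r = cnj q" using qr nz by (metis mult_left_cancel)
    then have "Im z = 0" by (subst sum[symmetric]) simp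
    then show False using z by simp
  qed
  then consider "cmod q < 1" | "cmod q > 1" by linarith
  then show thesis
  proof cases
    case 1
    then show ?thesis using that[of q] 1 nz(1) sum unfolding inv(1) by blast
  next
    case 2
    then have "cmod r * 1 < cmod r * cmod q" using nz by (intro mult_strict_left_mono) auto
    then have "cmod r < 1" using nqr by (simp add: mult.commute)
    then show ?thesis using that[of r] nz(2) sum unfolding inv(2) by (simp add: add.commute)
  qed
qed

text \<open>On the unit circle \<open>w + 1 / w\<close> is \<open>2 cos \<theta>\<close>, so this
  factorisation links the Cauchy kernel to a contour integrand with poles at \<open>q\<close> and
  \<open>1 / q\<close>.\<close>

lemma joukowski_diff:
  assumes "q \<noteq> 0" "w \<noteq> 0" "q + 1 / q = (z::complex)"
  shows "(1 - q * w) * (w - q) = q * w * (z - (w + 1 / w))"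
proof -
  have "q * w * (z - (w + 1 / w)) = q * q * w + w * (q * (1 / q)) - q * w * w - q * (w * (1 / w))"
    unfolding assms(3)[symmetric] by (simp only: algebra_simps)
  then show ?thesis using assms(1,2) by (simp add: algebra_simps)
qed

text \<open>Substituting \<open>x = 2 cos \<theta>\<close> and \<open>w = exp (\<i> \<theta>)\<close> gives an integral over the unit circle whose
  integrand has, after \<open>2 (sin \<theta>)\<^sup>2\<close> is replaced by \<open>1 - w\<^sup>2\<close>, a simple pole at \<open>q\<close>; the difference of the
  two integrands is odd in \<open>\<theta>\<close>.\<close>

lemma semicircle_integral:
  assumes q: "q \<noteq> 0" "cmod q < 1" "q + 1 / q = z" and z: "Im z > 0"
  shows "integral {-2..2} (\<lambda>x. complex_of_real (sqrt (4 - x\<^sup>2)) / (z - complex_of_real x)) = 2 * of_real pi * q"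
proof -
  define S where "S x = sin (2 * pi * x)" for x
  define C where "C x = cos (2 * pi * x)" for x
  have zx: "z - complex_of_real x \<noteq> 0" for x by (rule diff_of_real_nonzero[OF z])
  then have zx': "z \<noteq> complex_of_real x" for x by (metis diff_self)
  have C': "((\<lambda>x. 2 * C x) has_field_derivative - (4 * pi * S x)) (at x within A)" for x A
    unfolding C_def S_def by (auto intro!: derivative_eq_intros)
  have sc: "(C x)\<^sup>2 + (S x)\<^sup>2 = 1" for x unfolding C_def S_def by simp
  have Crange: "(\<lambda>x. 2 * C x) ` A \<subseteq> {-2..2}" for A unfolding C_def by auto
  have contC: "continuous_on A (\<lambda>x. 2 * C x)" for A unfolding C_def by (intro continuous_intros)

  have circle: "((\<lambda>x. 2 * complex_of_real ((S x)\<^sup>2) / (z - 2 * complex_of_real (C x))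
        - 2 * \<i> * complex_of_real (S x * C x) / (z - 2 * complex_of_real (C x))) has_integral q) {0..1}"
  proof -
    \<comment> \<open>The pole of \<open>?f\<close> at \<open>1 / q\<close> lies outside the closed
      disc, and the normalisation gives \<open>?f q = q\<close>.\<close>
    let ?f = "\<lambda>w. (1 - w\<^sup>2) * q / (1 - q * w)"
    have qw: "1 - q * w \<noteq> 0" if "cmod w \<le> 1" for w
    proof
      assume "1 - q * w = 0"
      then have "cmod q * cmod w = 1" by (metis eq_iff_diff_eq_0 norm_mult norm_one)
      moreover have "cmod q * cmod w \<le> cmod q * 1" using that by (intro mult_left_mono) auto
      ultimately show False using q(2) by simp
    qed
    have "((\<lambda>u. ?f u / (u - q)) has_contour_integral (2 * of_real pi * \<i> * ?f q)) (circlepath 0 1)"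
      by (rule Cauchy_integral_circlepath_simple)
        (use qw q(2) in \<open>auto intro!: holomorphic_intros\<close>)
    then have "((\<lambda>x. ?f (circlepath 0 1 x) / (circlepath 0 1 x - q) * vector_derivative (circlepath 0 1) (at x))
        has_integral (2 * of_real pi * \<i> * ?f q)) {0..1}"
      by (simp add: has_contour_integral)
    from has_integral_mult_right[OF this, of "1 / (2 * of_real pi * \<i>)"]
    have 1: "((\<lambda>x. 1 / (2 * of_real pi * \<i>) * (?f (circlepath 0 1 x) / (circlepath 0 1 x - q) * vector_derivative (circlepath 0 1) (at x)))
        has_integral ?f q) {0..1}" by simp
    have 2: "?f q = q" using qw[of q] q(2) by (simp add: power2_eq_square)
    show ?thesis
    proof (rule has_integral_eq[OF _ 1[unfolded 2]])
      fix x :: real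
      define E where "E = exp (2 * of_real pi * \<i> * x)"
      have E: "E = complex_of_real (C x) + \<i> * complex_of_real (S x)"
      proof -
        have "E = exp (\<i> * complex_of_real (2 * pi * x))" by (simp add: E_def mult_ac)
        then show ?thesis by (simp only: exp_Euler C_def S_def cos_of_real sin_of_real)
      qed
      have E1: "cmod E = 1"
        using sc[of x] by (simp add: E cmod_def)
      then have E0: "E \<noteq> 0" by auto
      have invE: "1 / E = complex_of_real (C x) - \<i> * complex_of_real (S x)"
      proof -
        have "E * (complex_of_real (C x) - \<i> * complex_of_real (S x)) = complex_of_real ((C x)\<^sup>2 + (S x)\<^sup>2)"
          by (simp add: E power2_eq_square algebra_simps)
        then show ?thesis using E0 by (simp add: sc field_simps)
      qed
      have sumE: "E + 1 / E = 2 * complex_of_real (C x)" by (subst invE) (simp add: E)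
      have E2: "1 - E\<^sup>2 = 2 * complex_of_real ((S x)\<^sup>2) - 2 * \<i> * complex_of_real (S x * C x)"
      proof -
        have "1 - E\<^sup>2 = complex_of_real ((C x)\<^sup>2 + (S x)\<^sup>2) - E\<^sup>2" by (simp add: sc)
        then show ?thesis by (simp add: E power2_eq_square algebra_simps)
      qed
      have circ: "circlepath 0 1 x = E" by (simp add: circlepath_def part_circlepath_def linepath_def E_def algebra_simps)
      have "1 / (2 * of_real pi * \<i>) * (?f (circlepath 0 1 x) / (circlepath 0 1 x - q) * vector_derivative (circlepath 0 1) (at x))
         = (1 - E\<^sup>2) * (q * E) / ((1 - q * E) * (E - q))"
      proof -
        have *: "1 / c * (a * q / b / d * (c * E)) = a * (q * E) / (b * d)" if "c \<noteq> 0" for a b c d :: complex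
          using that by simp
        show ?thesis
          unfolding circ vector_derivative_circlepath E_def[symmetric] of_real_1 mult_1_right of_real_mult of_real_numeral
          by (rule *) simp
      qed
      also have "\<dots> = (1 - E\<^sup>2) * (q * E) / (q * E * (z - (E + 1 / E)))"
        by (simp only: joukowski_diff[OF q(1) E0 q(3)])
      also have "\<dots> = (1 - E\<^sup>2) / (z - 2 * complex_of_real (C x))"
        using q(1) E0 by (simp add: sumE)
      also have "\<dots> = 2 * complex_of_real ((S x)\<^sup>2) / (z - 2 * complex_of_real (C x))
        - 2 * \<i> * complex_of_real (S x * C x) / (z - 2 * complex_of_real (C x))"
        unfolding E2 by (simp add: diff_divide_distrib)
      finally show "1 / (2 * of_real pi * \<i>) * (?f (circlepath 0 1 x) / (circlepath 0 1 x - q) * vector_derivative (circlepath 0 1) (at x)) =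
        2 * complex_of_real ((S x)\<^sup>2) / (z - 2 * complex_of_real (C x))
        - 2 * \<i> * complex_of_real (S x * C x) / (z - 2 * complex_of_real (C x))" .
    qed
  qed

  \<comment> \<open>Oddness is realised by substitution: the argument \<open>2 * C x\<close> has the
    same value at both endpoints, so the integral vanishes.\<close>
  have odd: "((\<lambda>x. 2 * \<i> * complex_of_real (S x * C x) / (z - 2 * complex_of_real (C x))) has_integral 0) {0..1}"
  proof -
    have "((\<lambda>x. (- (4 * pi * S x)) *\<^sub>R (complex_of_real (2 * C x) / (z - complex_of_real (2 * C x)))) has_integral
        (integral {2 * C 0..2 * C 1} (\<lambda>x. complex_of_real x / (z - complex_of_real x)) - integral {2 * C 1..2 * C 0} (\<lambda>x. complex_of_real x / (z - complex_of_real x)))) {0..1}"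
      by (rule has_integral_substitution_general[of "{}", OF _ _ Crange _ contC C'])
        (auto intro!: continuous_intros simp: zx')
    then have "((\<lambda>x. (- (4 * pi * S x)) *\<^sub>R (complex_of_real (2 * C x) / (z - complex_of_real (2 * C x)))) has_integral 0) {0..1}"
      by (simp add: C_def)
    from has_integral_mult_right[OF this, of "- \<i> / (4 * of_real pi)"]
    have "((\<lambda>x. - \<i> / (4 * of_real pi) * ((- (4 * pi * S x)) *\<^sub>R (complex_of_real (2 * C x) / (z - complex_of_real (2 * C x))))) has_integral 0) {0..1}"
      by (simp only: mult_zero_right)
    then show ?thesis
    proof (rule has_integral_eq[rotated])
      fix x :: real
      show "- \<i> / (4 * of_real pi) * ((- (4 * pi * S x)) *\<^sub>R (complex_of_real (2 * C x) / (z - complex_of_real (2 * C x)))) =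
        2 * \<i> * complex_of_real (S x * C x) / (z - 2 * complex_of_real (C x))"
        by (simp add: scaleR_conv_of_real)
    qed
  qed

  define \<phi> where "\<phi> x = complex_of_real ((S x)\<^sup>2) / (z - 2 * complex_of_real (C x))" for x
  define I where "I = integral {-2..2} (\<lambda>x. complex_of_real (sqrt (4 - x\<^sup>2)) / (z - complex_of_real x))"
  have sqrt: "sqrt (4 - (2 * C x)\<^sup>2) = 2 * \<bar>S x\<bar>" for x
  proof -
    have "4 - (2 * C x)\<^sup>2 = (2 * S x)\<^sup>2" using sc[of x] by (simp add: power_mult_distrib)
    then show ?thesis by (simp only: real_sqrt_abs abs_mult abs_numeral)
  qed
  have subst: "((\<lambda>x. (- (4 * pi * S x)) *\<^sub>R (complex_of_real (sqrt (4 - (2 * C x)\<^sup>2)) / (z - complex_of_real (2 * C x)))) has_integral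
      (integral {2 * C a..2 * C b} (\<lambda>x. complex_of_real (sqrt (4 - x\<^sup>2)) / (z - complex_of_real x))
       - integral {2 * C b..2 * C a} (\<lambda>x. complex_of_real (sqrt (4 - x\<^sup>2)) / (z - complex_of_real x)))) {a..b}"
    if "a \<le> b" for a b
    by (rule has_integral_substitution_general[of "{}", OF _ that Crange _ contC C'])
      (auto intro!: continuous_intros simp: zx')
  \<comment> \<open>The square root becomes \<open>2 * \<bar>S x\<bar>\<close>, so the interval is
    cut at 1/2, where \<open>S\<close> changes sign. On the two halves \<open>2 * C x\<close>
    traverses \<open>{-2..2}\<close> in opposite directions; the sign of \<open>S\<close>
    compensates, and both contribute equally.\<close>
  have half1: "(\<phi> has_integral I / (8 * of_real pi)) {0..1/2}"
  proof -
    have "((\<lambda>x. (- (4 * pi * S x)) *\<^sub>R (complex_of_real (sqrt (4 - (2 * C x)\<^sup>2)) / (z - complex_of_real (2 * C x)))) has_integral - I) {0..1/2}"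
      using subst[of 0 "1/2"] by (simp add: C_def I_def)
    from has_integral_mult_right[OF this, of "- 1 / (8 * of_real pi)"]
    have "((\<lambda>x. - 1 / (8 * of_real pi) * ((- (4 * pi * S x)) *\<^sub>R (complex_of_real (sqrt (4 - (2 * C x)\<^sup>2)) / (z - complex_of_real (2 * C x))))) has_integral I / (8 * of_real pi)) {0..1/2}"
      by simp
    then show ?thesis
    proof (rule has_integral_eq[rotated])
      fix x :: real assume "x \<in> {0..1/2}"
      then have "S x \<ge> 0" unfolding S_def by (intro sin_ge_zero) auto
      then show "- 1 / (8 * of_real pi) * ((- (4 * pi * S x)) *\<^sub>R (complex_of_real (sqrt (4 - (2 * C x)\<^sup>2)) / (z - complex_of_real (2 * C x)))) = \<phi> x"
        unfolding sqrt \<phi>_def by (simp add: scaleR_conv_of_real power2_eq_square)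
    qed
  qed
  have half2: "(\<phi> has_integral I / (8 * of_real pi)) {1/2..1}"
  proof -
    have "((\<lambda>x. (- (4 * pi * S x)) *\<^sub>R (complex_of_real (sqrt (4 - (2 * C x)\<^sup>2)) / (z - complex_of_real (2 * C x)))) has_integral I) {1/2..1}"
      using subst[of "1/2" 1] by (simp add: C_def I_def)
    from has_integral_mult_right[OF this, of "1 / (8 * of_real pi)"]
    have "((\<lambda>x. 1 / (8 * of_real pi) * ((- (4 * pi * S x)) *\<^sub>R (complex_of_real (sqrt (4 - (2 * C x)\<^sup>2)) / (z - complex_of_real (2 * C x))))) has_integral I / (8 * of_real pi)) {1/2..1}"
      by simp
    then show ?thesis
    proof (rule has_integral_eq[rotated])
      fix x :: real assume x: "x \<in> {1/2..1}"
      have "sin (2 * pi * x - pi) \<ge> 0" using x by (intro sin_ge_zero) (auto simp: algebra_simps)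
      then have "S x \<le> 0" by (simp add: S_def)
      then show "1 / (8 * of_real pi) * ((- (4 * pi * S x)) *\<^sub>R (complex_of_real (sqrt (4 - (2 * C x)\<^sup>2)) / (z - complex_of_real (2 * C x)))) = \<phi> x"
        unfolding sqrt \<phi>_def by (simp add: scaleR_conv_of_real power2_eq_square)
    qed
  qed
  have "(\<phi> has_integral I / (8 * of_real pi) + I / (8 * of_real pi)) {0..1}"
    by (rule has_integral_combine[OF _ _ half1 half2]) auto
  from has_integral_mult_right[OF this, of 2]
  have "((\<lambda>x. 2 * \<phi> x) has_integral I / (2 * of_real pi)) {0..1}" by simp
  moreover have "((\<lambda>x. 2 * \<phi> x) has_integral q) {0..1}"
    using has_integral_add[OF circle odd] by (simp add: \<phi>_def)
  ultimately have "I / (2 * of_real pi) = q" by (rule has_integral_unique)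
  then show ?thesis by (simp add: I_def field_simps)
qed

lemma semicircle_cauchy_integral:
  assumes q: "q \<noteq> 0" "cmod q < 1" "q + 1 / q = z" and z: "Im z > 0"
  shows "(LINT x|lborel. complex_of_real (1 / (2 * pi) * sqrt (4 - x\<^sup>2) * indicator {-2..2} x) / (z - complex_of_real x)) = q"
proof -
  let ?f = "\<lambda>x. complex_of_real (sqrt (4 - x\<^sup>2)) / (z - complex_of_real x)"
  have "continuous_on {-2..2} ?f"
    using diff_of_real_nonzero[OF z] by (intro continuous_intros) auto
  then have int: "set_integrable lborel {-2..2} ?f" by (rule borel_integrable_atLeastAtMost')
  have "(LINT x|lborel. complex_of_real (1 / (2 * pi) * sqrt (4 - x\<^sup>2) * indicator {-2..2} x) / (z - complex_of_real x))
      = (LINT x|lborel. 1 / (2 * of_real pi) * (indicator {-2..2} x *\<^sub>R ?f x))"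
    by (intro Bochner_Integration.integral_cong) (auto simp: indicator_def)
  also have "\<dots> = 1 / (2 * of_real pi) * (LINT x:{-2..2}|lborel. ?f x)"
    unfolding set_lebesgue_integral_def by (rule integral_mult_right_zero)
  also have "(LINT x:{-2..2}|lborel. ?f x) = 2 * of_real pi * q"
    using set_borel_integral_eq_integral(2)[OF int] semicircle_integral[OF q z] by simp
  finally show ?thesis by simp
qed

text \<open>The Joukowski root \<open>Q\<close> is the Cauchy transform. Mass 1 follows from its
  asymptotics: \<open>z * q = 1 + q * q\<close> with \<open>cmod q < 1\<close> gives
  \<open>cmod q \<le> 2 / n\<close> at \<open>z = \<i> * n\<close>.\<close>

lemma
  shows real_distribution_semicircle: "real_distribution semicircle_distribution"
    and cauchy_transform_semicircle:
      "\<And>q z. q \<noteq> 0 \<Longrightarrow> cmod q < 1 \<Longrightarrow> q + 1 / q = z \<Longrightarrow> Im z > 0 \<Longrightarrow> cauchy_transform semicircle_distribution z = q"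
proof -
  let ?p = "\<lambda>x. 1 / (2 * pi) * sqrt (4 - x\<^sup>2) * indicator {-2..2} x"
  have "\<forall>z. \<exists>q. Im z > 0 \<longrightarrow> q \<noteq> 0 \<and> cmod q < 1 \<and> q + 1 / q = z"
    by (blast elim: joukowski_root_exists)
  then obtain Q where Q: "\<And>z. Im z > 0 \<Longrightarrow> Q z \<noteq> 0 \<and> cmod (Q z) < 1 \<and> Q z + 1 / Q z = z"
    unfolding choice_iff by blast
  have p0: "?p x \<ge> 0" for x
  proof (cases "x \<in> {-2..2}")
    case True
    then have "x\<^sup>2 \<le> 2\<^sup>2" by (subst abs_le_square_iff[symmetric]) auto
    then show ?thesis by simp
  qed simp
  have intp: "integrable lborel ?p"
  proof -
    have "set_integrable lborel {-2..2} (\<lambda>x. 1 / (2 * pi) * sqrt (4 - x\<^sup>2))"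
      by (intro borel_integrable_atLeastAtMost' continuous_intros) auto
    then show ?thesis unfolding set_integrable_def by (simp add: mult_ac)
  qed
  have formula: "(LINT x|lborel. complex_of_real (?p x) / (z - complex_of_real x)) = Q z" if "Im z > 0" for z
    using Q[OF that] that by (intro semicircle_cauchy_integral) auto
  have lim: "(\<lambda>n. \<i> * of_nat n * Q (\<i> * of_nat n)) \<longlonglongrightarrow> 1"
  proof (rule LIM_zero_cancel, rule Lim_null_comparison)
    show "\<forall>\<^sub>F n in sequentially. cmod (\<i> * of_nat n * Q (\<i> * of_nat n) - 1) \<le> 2 * (1 / real n)"
      using eventually_gt_at_top[of 0]
    proof eventually_elim
      case (elim n)
      let ?z = "\<i> * of_nat n :: complex"
      let ?q = "Q ?z"
      have q: "?q \<noteq> 0" "cmod ?q < 1" "?q + 1 / ?q = ?z" using Q[of ?z] elim by auto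
      have zq: "?z * ?q = 1 + ?q * ?q" using q(1) by (subst q(3)[symmetric]) (simp add: distrib_right)
      have qq: "cmod (?q * ?q) \<le> cmod ?q * 1" unfolding norm_mult using q(2) by (intro mult_left_mono) auto
      have "real n * cmod ?q = cmod (?z * ?q)" by (simp add: norm_mult)
      also have "\<dots> \<le> 1 + cmod (?q * ?q)" unfolding zq using norm_triangle_ineq[of 1 "?q * ?q"] by simp
      also have "\<dots> \<le> 2" using qq q(2) by simp
      finally have "cmod ?q \<le> 2 * (1 / real n)" using elim by (simp add: field_simps)
      moreover have "?z * ?q - 1 = ?q * ?q" using zq by simp
      ultimately show ?case using qq by (simp only: mult_1_right)
    qed
    show "(\<lambda>n. 2 * (1 / real n)) \<longlonglongrightarrow> 0"
      by (rule tendsto_mult_right_zero[OF lim_1_over_n])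
  qed
  show "real_distribution semicircle_distribution"
    unfolding semicircle_distribution_def using intp p0 formula lim by (rule density_distribution)
  show "cauchy_transform semicircle_distribution z = q" if "q \<noteq> 0" "cmod q < 1" "q + 1 / q = z" "Im z > 0" for q z
    unfolding semicircle_distribution_def
    using intp p0 semicircle_cauchy_integral[OF that] by (rule cauchy_transform_density)
qed

lemma F_transform_semicircle:
  assumes "q \<noteq> 0" "cmod q < 1" "q + 1 / q = z" "Im z > 0"
  shows "F_transform semicircle_distribution z = z - q"
  using cauchy_transform_semicircle[OF assms] assms(3) by (simp add: F_transform_def eq_diff_eq add.commute)

section \<open>The limit theorem\<close>

text \<open>Convergence along a real parameter is tested on sequences tending to infinity, where the
  sequential continuity theorem applies.\<close>

lemma weakly_converges_of_F_transform:
  fixes \<nu> :: "real \<Rightarrow> real measure"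
  assumes \<nu>: "\<And>N. N \<ge> 1 \<Longrightarrow> real_distribution (\<nu> N)" and \<mu>: "real_distribution \<mu>"
    and conv: "\<And>z. Im z > 0 \<Longrightarrow> ((\<lambda>N. F_transform (\<nu> N) z) \<longlongrightarrow> F_transform \<mu> z) at_top"
  shows "weakly_converges \<nu> \<mu> at_top"
  unfolding weakly_converges_def
proof (intro allI impI, rule tendsto_at_topI_sequentially)
  fix f :: "real \<Rightarrow> real" and X :: "nat \<Rightarrow> real"
  assume f: "continuous_on UNIV f \<and> bounded (range f)" and X: "filterlim X at_top sequentially"
  \<comment> \<open>Only \<open>\<nu> N\<close> with \<open>N \<ge> 1\<close> is known to be a
    distribution; eventually \<open>Y n = X n\<close>.\<close>
  define Y where "Y n = max 1 (X n)" for n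
  have Y: "filterlim Y at_top sequentially"
    using X by (rule filterlim_at_top_mono) (simp add: Y_def)
  have \<nu>Y: "real_distribution (\<nu> (Y n))" for n by (rule \<nu>) (simp add: Y_def)
  have "weak_conv_m (\<lambda>n. \<nu> (Y n)) \<mu>"
  proof (rule weak_conv_of_cauchy_transform[OF \<nu>Y \<mu>])
    fix z :: complex assume z: "Im z > 0"
    have "F_transform \<mu> z \<noteq> 0"
      using real_distribution.Im_F_transform_ge[OF \<mu> z] z by auto
    then have "(\<lambda>n. 1 / F_transform (\<nu> (Y n)) z) \<longlonglongrightarrow> 1 / F_transform \<mu> z"
      by (intro tendsto_intros filterlim_compose[OF conv[OF z] Y])
    then show "(\<lambda>n. cauchy_transform (\<nu> (Y n)) z) \<longlonglongrightarrow> cauchy_transform \<mu> z"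
      by (simp add: F_transform_def)
  qed
  then have "weakly_converges (\<lambda>n. \<nu> (Y n)) \<mu> sequentially"
    using weakly_converges_sequentially_iff[of "\<lambda>n. \<nu> (Y n)" \<mu>] \<nu>Y \<mu> by blast
  then have "(\<lambda>n. LINT x|\<nu> (Y n). f x) \<longlonglongrightarrow> (LINT x|\<mu>. f x)"
    using f unfolding weakly_converges_def by blast
  moreover have "\<forall>\<^sub>F n in sequentially. X n \<ge> 1"
    using X unfolding filterlim_at_top by blast
  then have "\<forall>\<^sub>F n in sequentially. (LINT x|\<nu> (Y n). f x) = (LINT x|\<nu> (X n). f x)"
    by eventually_elim (simp add: Y_def max_def)
  ultimately show "(\<lambda>n. LINT x|\<nu> (X n). f x) \<longlonglongrightarrow> (LINT x|\<mu>. f x)"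
    by (rule Lim_transform_eventually)
qed

section \<open>Central-limit rescaling\<close>

context standardized_distribution
begin

text \<open>This is \<open>N\<close> times the excess of the distribution dilated by
  \<open>1 / sqrt N\<close>, the central-limit scaling under which \<open>-1 / w\<close> appears as
  limit.\<close>

definition scaled_excess :: "real \<Rightarrow> complex \<Rightarrow> complex" where
  "scaled_excess N w = of_real (sqrt N) * excess (of_real (sqrt N) * w)"

text \<open>The subordination function for exponent \<open>N\<close> of the distribution dilated by
  \<open>1 / sqrt N\<close>.\<close>

definition scaled_subordination :: "real \<Rightarrow> complex \<Rightarrow> complex" where
  "scaled_subordination N z = subordination N (of_real (sqrt N) * z) / of_real (sqrt N)"

lemma norm_scaled_excess_le:
  assumes "N > 0" "Im w > 0"
  shows "cmod (scaled_excess N w) \<le> 1 / Im w"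
proof -
  have "cmod (scaled_excess N w) = sqrt N * cmod (excess (of_real (sqrt N) * w))"
    using assms by (simp add: scaled_excess_def norm_mult)
  also have "\<dots> \<le> sqrt N * (1 / Im (of_real (sqrt N) * w))"
    using assms by (intro mult_left_mono norm_excess_le) auto
  also have "\<dots> = 1 / Im w" using assms by simp
  finally show ?thesis .
qed

text \<open>The region lies in the cone \<open>cmod w \<le> B / a * Im w\<close>, and multiplication
  by \<open>sqrt N\<close> lifts it above height \<open>R\<close> within that cone. The tolerance
  \<open>\<epsilon> * a\<close> pays for the division by \<open>w\<close>, whose modulus is at least
  \<open>a\<close>.\<close>

lemma scaled_excess_uniform_limit:
  assumes \<epsilon>: "\<epsilon> > 0" and a: "a > 0"
  shows "\<forall>\<^sub>F N in at_top. \<forall>w. Im w \<ge> a \<and> cmod w \<le> B \<longrightarrow> cmod (scaled_excess N w + 1 / w) < \<epsilon>"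
proof -
  obtain R where R: "R > 0"
    "\<And>u. Im u \<ge> R \<Longrightarrow> cmod u \<le> B / a * Im u \<Longrightarrow> cmod (u * (F_transform M u - u) + 1) < \<epsilon> * a"
    using F_transform_asymptotic[of "\<epsilon> * a" "B / a"] \<epsilon> a by auto
  have "\<forall>\<^sub>F N in at_top. N \<ge> max 1 ((R / a)\<^sup>2)" by (rule eventually_ge_at_top)
  then show ?thesis
  proof eventually_elim
    case (elim N)
    show ?case
    proof (intro allI impI)
      fix w assume w: "a \<le> Im w \<and> cmod w \<le> B"
      define u where "u = of_real (sqrt N) * w"
      have r: "sqrt N > 0" "sqrt N \<ge> R / a" using elim real_le_rsqrt[of "R / a" N] by auto
      have w0: "w \<noteq> 0" using w a by auto
      have "R \<le> sqrt N * a" using r(2) a by (simp add: field_simps)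
      also have "\<dots> \<le> Im u" using w r by (simp add: u_def)
      finally have 1: "Im u \<ge> R" .
      have "0 \<le> B" using w norm_ge_zero[of w] by linarith
      have "B * a \<le> B * Im w" using w \<open>0 \<le> B\<close> by (intro mult_left_mono) auto
      then have "B \<le> B / a * Im w" using a by (simp add: field_simps)
      then have "cmod w \<le> B / a * Im w" using w by linarith
      then have "sqrt N * cmod w \<le> sqrt N * (B / a * Im w)" using r by (intro mult_left_mono) auto
      then have 2: "cmod u \<le> B / a * Im u" using r by (simp add: u_def norm_mult mult_ac)
      have "u * (F_transform M u - u) + 1 = w * (scaled_excess N w + 1 / w)"
        using w0 by (simp add: u_def scaled_excess_def excess_def field_simps)
      then have "cmod w * cmod (scaled_excess N w + 1 / w) < \<epsilon> * a"
        using R(2)[OF 1 2] by (simp only: norm_mult)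
      moreover have "a \<le> cmod w" using w abs_Im_le_cmod[of w] by linarith
      then have "a * cmod (scaled_excess N w + 1 / w) \<le> cmod w * cmod (scaled_excess N w + 1 / w)"
        by (intro mult_right_mono) auto
      ultimately have "a * cmod (scaled_excess N w + 1 / w) < a * \<epsilon>" by (simp add: mult.commute)
      then show "cmod (scaled_excess N w + 1 / w) < \<epsilon>" using a by simp
    qed
  qed
qed

lemma scaled_subordination_equation_iff:
  assumes N: "N \<ge> 1"
  shows "w = z + (1 - 1 / of_real N) * scaled_excess N w \<longleftrightarrow>
    of_real (sqrt N) * w = of_real (sqrt N) * z + (of_real N - 1) * excess (of_real (sqrt N) * w)"
proof -
  have r0: "complex_of_real (sqrt N) \<noteq> 0" using N by simp
  have "sqrt N * sqrt N = N" using N by simp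
  then have "complex_of_real (sqrt N) * complex_of_real (sqrt N) = of_real N"
    by (simp only: of_real_mult[symmetric])
  moreover have "of_real N * (1 - 1 / of_real N :: complex) = of_real N - 1"
    using N by (simp add: right_diff_distrib)
  ultimately have "of_real (sqrt N) * ((1 - 1 / of_real N) * scaled_excess N w) = (of_real N - 1) * excess (of_real (sqrt N) * w)"
    unfolding scaled_excess_def by (metis mult.assoc mult.commute)
  then have "of_real (sqrt N) * (z + (1 - 1 / of_real N) * scaled_excess N w)
      = of_real (sqrt N) * z + (of_real N - 1) * excess (of_real (sqrt N) * w)"
    by (simp only: distrib_left)
  then show ?thesis using r0 by (metis mult_left_cancel)
qed

lemma scaled_subordination:
  assumes N: "N \<ge> 1" and z: "Im z > 0"
  shows "scaled_subordination N z = z + (1 - 1 / of_real N) * scaled_excess N (scaled_subordination N z)"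
    and "Im (scaled_subordination N z) \<ge> Im z"
proof -
  have z': "Im (of_real (sqrt N) * z) > 0" using N z by simp
  have eq: "of_real (sqrt N) * scaled_subordination N z = subordination N (of_real (sqrt N) * z)"
    using N by (simp add: scaled_subordination_def)
  show "scaled_subordination N z = z + (1 - 1 / of_real N) * scaled_excess N (scaled_subordination N z)"
    unfolding scaled_subordination_equation_iff[OF N] eq by (rule subordination(1)[OF N z'])
  have "Im (of_real (sqrt N) * z) \<le> Im (of_real (sqrt N) * scaled_subordination N z)"
    unfolding eq by (rule subordination(2)[OF N z'])
  then show "Im (scaled_subordination N z) \<ge> Im z" using N by simp
qed

lemma scaled_subordination_eqI:
  assumes N: "N \<ge> 1" and z: "Im z > 0" and w: "Im w > 0"
    and eq: "w = z + (1 - 1 / of_real N) * scaled_excess N w"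
  shows "scaled_subordination N z = w"
proof -
  have "subordination N (of_real (sqrt N) * z) = of_real (sqrt N) * w"
    using N z w eq[unfolded scaled_subordination_equation_iff[OF N]] by (intro subordination_eqI) auto
  then show ?thesis using N by (simp add: scaled_subordination_def)
qed

text \<open>With \<open>c = N powr \<alpha>\<close> the coefficient of the excess is
  \<open>c * m * N\<close>. One factor \<open>sqrt N\<close> goes into \<open>scaled_excess\<close>,
  which isolates the quantity assumed to converge to \<open>t\<close>; the argument
  \<open>z / c\<close> is split in the same way.\<close>

lemma
  assumes N: "N \<ge> 1" and m: "m > 0"
  shows real_distribution_dilated_power:
      "real_distribution (dilation (N powr \<alpha>) (boolean_power (free_power M N) m))"
    and F_transform_dilated_power: "Im z > 0 \<Longrightarrow>
      F_transform (dilation (N powr \<alpha>) (boolean_power (free_power M N) m)) z =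
      z + of_real (m * N powr (\<alpha> + 1/2)) *
        scaled_excess N (scaled_subordination N (of_real (N powr (- \<alpha> - 1/2)) * z))"
proof -
  interpret free: real_distribution "free_power M N" by (rule real_distribution_free_power[OF N])
  have near: "cmod (F_transform (free_power M N) z - z) \<le> N / Im z" if z: "Im z > 0" for z
  proof -
    have "N * cmod (excess (subordination N z)) \<le> N * (1 / Im z)"
      using N by (intro mult_left_mono norm_excess_subordination_le z) auto
    then show ?thesis using N by (simp add: F_transform_free_power[OF N z] norm_mult)
  qed
  interpret bool: real_distribution "boolean_power (free_power M N) m"
    by (rule free.real_distribution_boolean_power[OF m near])
  show "real_distribution (dilation (N powr \<alpha>) (boolean_power (free_power M N) m))"
    by (rule bool.real_distribution_dilation)
  assume z: "Im z > 0"
  define c where "c = N powr \<alpha>"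
  have c: "c > 0" using N by (simp add: c_def)
  have z': "Im (z / of_real c) > 0" using z c by (simp add: Im_divide_of_real)
  have "N powr (- \<alpha> - 1/2) * (c * sqrt N) = 1"
    using N unfolding c_def powr_half_sqrt[OF order_trans[OF zero_le_one N], symmetric] powr_add[symmetric] by simp
  then have "N powr (- \<alpha> - 1/2) = 1 / (c * sqrt N)"
    using N c by (simp add: eq_divide_eq)
  then have arg: "of_real (sqrt N) * (of_real (N powr (- \<alpha> - 1/2)) * z) = z / of_real c"
    using N c by simp
  have coeff: "m * N powr (\<alpha> + 1/2) * sqrt N = c * m * N"
  proof -
    have "N powr (\<alpha> + 1/2) * sqrt N = c * (sqrt N * sqrt N)"
      using N by (simp add: c_def powr_add powr_half_sqrt)
    then show ?thesis using N by simp
  qed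
  have "F_transform (dilation c (boolean_power (free_power M N) m)) z =
      of_real c * (z / of_real c + of_real m * (of_real N * excess (subordination N (z / of_real c))))"
    using bool.F_transform_dilation[OF c] free.F_transform_boolean_power[OF m near z']
      F_transform_free_power[OF N z'] by simp
  also have "\<dots> = z + of_real (c * m * N) * excess (subordination N (z / of_real c))"
    using c by (simp add: distrib_left mult_ac)
  also have "\<dots> = z + of_real (m * N powr (\<alpha> + 1/2)) *
        scaled_excess N (scaled_subordination N (of_real (N powr (- \<alpha> - 1/2)) * z))"
    unfolding coeff[symmetric] scaled_excess_def scaled_subordination_def arg
    using N by simp
  finally show "F_transform (dilation (N powr \<alpha>) (boolean_power (free_power M N) m)) z =
      z + of_real (m * N powr (\<alpha> + 1/2)) *
        scaled_excess N (scaled_subordination N (of_real (N powr (- \<alpha> - 1/2)) * z))"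
    by (simp add: c_def)
qed

text \<open>The fixed-point equation is solved for the excess, so its limit is read off without
  evaluating the excess near \<open>w\<close>. Taking \<open>N > 1\<close> keeps the factor
  \<open>1 - 1 / N\<close> nonzero.\<close>

lemma scaled_excess_limit_of_subordination_limit:
  assumes w: "((\<lambda>N. scaled_subordination N (\<zeta> N)) \<longlongrightarrow> w) at_top"
    and \<zeta>: "(\<zeta> \<longlongrightarrow> z) at_top" and pos: "\<forall>\<^sub>F N in at_top. Im (\<zeta> N) > 0"
  shows "((\<lambda>N. scaled_excess N (scaled_subordination N (\<zeta> N))) \<longlongrightarrow> w - z) at_top"
proof (rule Lim_transform_eventually)
  have "((\<lambda>N::real. 1 / N) \<longlongrightarrow> 0) at_top" by real_asymp
  then have inv: "((\<lambda>N::real. complex_of_real (1 / N)) \<longlongrightarrow> complex_of_real 0) at_top"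
    by (rule tendsto_of_real)
  have "((\<lambda>N. (scaled_subordination N (\<zeta> N) - \<zeta> N) / (1 - complex_of_real (1 / N))) \<longlongrightarrow> (w - z) / (1 - complex_of_real 0)) at_top"
    by (intro tendsto_divide tendsto_diff tendsto_const inv w \<zeta>) auto
  then show "((\<lambda>N. (scaled_subordination N (\<zeta> N) - \<zeta> N) / (1 - complex_of_real (1 / N))) \<longlongrightarrow> w - z) at_top"
    by simp
  show "\<forall>\<^sub>F N in at_top. (scaled_subordination N (\<zeta> N) - \<zeta> N) / (1 - complex_of_real (1 / N)) =
      scaled_excess N (scaled_subordination N (\<zeta> N))"
    using pos eventually_gt_at_top[of 1]
  proof eventually_elim
    case (elim N)
    have "scaled_subordination N (\<zeta> N) - \<zeta> N = (1 - 1 / of_real N) * scaled_excess N (scaled_subordination N (\<zeta> N))"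
      using scaled_subordination(1)[of N "\<zeta> N"] elim by (simp add: diff_eq_eq add.commute)
    moreover have "1 - complex_of_real (1 / N) \<noteq> 0"
      using elim by (metis eq_iff_diff_eq_0 less_irrefl of_real_1 of_real_eq_iff divide_eq_1_iff)
    ultimately show ?case by simp
  qed
qed

text \<open>Subordination does not lower imaginary parts, so the argument of the excess rises to
  infinity and the bound \<open>1 / Im w\<close>, which is uniform in \<open>N\<close>,
  suffices.\<close>

lemma scaled_excess_limit_infinity:
  assumes b: "filterlim b at_top at_top" and z: "Im z > 0"
  shows "((\<lambda>N. scaled_excess N (scaled_subordination N (of_real (b N) * z))) \<longlongrightarrow> 0) at_top"
proof (rule Lim_null_comparison)
  have "\<forall>\<^sub>F N in at_top. b N \<ge> 1" using b unfolding filterlim_at_top by blast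
  then show "\<forall>\<^sub>F N in at_top. cmod (scaled_excess N (scaled_subordination N (of_real (b N) * z))) \<le> 1 / (b N * Im z)"
    using eventually_ge_at_top[of 1]
  proof eventually_elim
    case (elim N)
    let ?w = "scaled_subordination N (of_real (b N) * z)"
    have pos: "0 < b N * Im z" using elim z by simp
    have ge: "b N * Im z \<le> Im ?w"
      using scaled_subordination(2)[of N "of_real (b N) * z"] elim pos by simp
    have "cmod (scaled_excess N ?w) \<le> 1 / Im ?w"
      using elim ge pos by (intro norm_scaled_excess_le) auto
    also have "\<dots> \<le> 1 / (b N * Im z)" by (rule frac_le) (use ge pos in auto)
    finally show ?case .
  qed
  have "filterlim (\<lambda>N. b N * Im z) at_top at_top"
    using filterlim_tendsto_pos_mult_at_top[OF tendsto_const z b] by (simp add: mult.commute)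
  then show "((\<lambda>N. 1 / (b N * Im z)) \<longlongrightarrow> 0) at_top"
    by (intro tendsto_divide_0[OF tendsto_const] filterlim_at_top_imp_at_infinity)
qed

text \<open>With \<open>b = 1 / q\<close>, the limiting equation \<open>w + 1 / w = z\<close> factors as \<open>(w - q) (w - b) = 0\<close>, and the
  root \<open>q\<close> lies in the lower half-plane, away from the values of the subordination function.\<close>

lemma scaled_excess_limit_semicircle:
  assumes z: "Im z > 0" and q: "q \<noteq> 0" "q + 1 / q = z" "Im q < 0"
  shows "((\<lambda>N. scaled_excess N (scaled_subordination N z)) \<longlongrightarrow> - q) at_top"
proof -
  let ?w = "\<lambda>N. scaled_subordination N z"
  \<comment> \<open>A bound for the subordination values, independent of \<open>N\<close>: they
    differ from \<open>z\<close> by at most the modulus of the scaled excess.\<close>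
  define B where "B = cmod z + 1 / Im z"
  have w: "Im (?w N) \<ge> Im z" "cmod (scaled_excess N (?w N)) \<le> 1 / Im z" "cmod (?w N) \<le> B" if N: "N \<ge> 1" for N
  proof -
    show 1: "Im (?w N) \<ge> Im z" by (rule scaled_subordination(2)[OF N z])
    have "cmod (scaled_excess N (?w N)) \<le> 1 / Im (?w N)"
      using 1 z N by (intro norm_scaled_excess_le) auto
    also have "\<dots> \<le> 1 / Im z" using 1 z by (simp add: frac_le)
    finally show 2: "cmod (scaled_excess N (?w N)) \<le> 1 / Im z" .
    have "cmod (1 - 1 / of_real N :: complex) = \<bar>1 - 1 / N\<bar>"
      unfolding norm_of_real[symmetric, where 'a = complex] by simp
    also have "\<dots> \<le> 1" using N by (simp add: abs_if)
    finally have "cmod ((1 - 1 / of_real N) * scaled_excess N (?w N)) \<le> 1 * (1 / Im z)"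
      unfolding norm_mult using 2 by (intro mult_mono) auto
    then show "cmod (?w N) \<le> B"
      unfolding B_def by (subst scaled_subordination(1)[OF N z]) (intro norm_triangle_le; simp)
  qed
  have B0: "B \<ge> 0" using z by (simp add: B_def)
  have "((\<lambda>N. ?w N - 1 / q) \<longlongrightarrow> 0) at_top"
  proof (rule tendstoI)
    fix \<epsilon> :: real assume \<epsilon>: "\<epsilon> > 0"
    \<comment> \<open>Chosen so that \<open>(B + 1) * (2 * \<delta>) = Im z * \<epsilon>\<close>;
      using \<open>B + 1\<close> instead of \<open>B\<close> makes the final estimate
      strict.\<close>
    define \<delta> where "\<delta> = \<epsilon> * Im z / (2 * (B + 1))"
    have \<delta>: "\<delta> > 0" using \<epsilon> z B0 by (simp add: \<delta>_def)
    show "\<forall>\<^sub>F N in at_top. dist (?w N - 1 / q) 0 < \<epsilon>"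
      using scaled_excess_uniform_limit[OF \<delta> z, of B] eventually_ge_at_top[of "max 1 (1 / (Im z * \<delta>))"]
    proof eventually_elim
      case (elim N)
      then have N: "N \<ge> 1" and N2: "1 / (Im z * \<delta>) \<le> N" by auto
      note wN = w[OF N]
      have w0: "?w N \<noteq> 0" using wN(1) z by auto
      have 1: "cmod (scaled_excess N (?w N) + 1 / ?w N) < \<delta>" using elim wN by blast
      have 2: "cmod (scaled_excess N (?w N) / of_real N) \<le> \<delta>"
      proof -
        have "cmod (scaled_excess N (?w N)) / N \<le> (1 / Im z) / N"
          using wN(2) N by (intro divide_right_mono) auto
        also have "\<dots> \<le> \<delta>" using N2 N z \<delta> by (simp add: field_simps)
        finally show ?thesis using N by (simp add: norm_divide)
      qed
      have eq: "?w N = z + (1 - 1 / of_real N) * scaled_excess N (?w N)"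
        by (rule scaled_subordination(1)[OF N z])
      have "?w N - z + 1 / ?w N = (1 - 1 / of_real N) * scaled_excess N (?w N) + 1 / ?w N"
        using eq by (metis add_diff_cancel_left')
      also have "\<dots> = (scaled_excess N (?w N) + 1 / ?w N) - scaled_excess N (?w N) / of_real N"
        by (simp add: left_diff_distrib)
      also have "cmod \<dots> < \<delta> + \<delta>" using 1 2 by (intro order_le_less_trans[OF norm_triangle_ineq4]) linarith
      finally have e: "cmod (?w N - z + 1 / ?w N) < 2 * \<delta>" by simp
      have fact: "(?w N - q) * (?w N - 1 / q) = ?w N * (?w N - z + 1 / ?w N)"
      proof -
        have "(?w N - q) * (?w N - 1 / q) = ?w N * ?w N - ?w N * (q + 1 / q) + q * (1 / q)"
          by (simp only: algebra_simps)
        also have "\<dots> = ?w N * ?w N - ?w N * z + ?w N * (1 / ?w N)"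
          using q(1) w0 by (simp add: q(2))
        finally show ?thesis by (simp only: right_diff_distrib distrib_left)
      qed
      have "Im z \<le> cmod (?w N - q)"
        using abs_Im_le_cmod[of "?w N - q"] wN(1) q(3) by simp
      then have "Im z * cmod (?w N - 1 / q) \<le> cmod (?w N - q) * cmod (?w N - 1 / q)"
        by (intro mult_right_mono) auto
      also have "\<dots> = cmod (?w N) * cmod (?w N - z + 1 / ?w N)"
        by (simp only: norm_mult[symmetric] fact)
      also have "\<dots> \<le> B * (2 * \<delta>)" using wN(3) e B0 by (intro mult_mono) auto
      also have "\<dots> < (B + 1) * (2 * \<delta>)" using \<delta> by simp
      also have "\<dots> = Im z * \<epsilon>"
      proof -
        have "K * (2 * (\<epsilon> * Im z / (2 * K))) = Im z * \<epsilon>" if "K > 0" for K using that by simp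
        from this[of "B + 1"] show ?thesis using B0 by (simp only: \<delta>_def)
      qed
      finally show ?case using z by simp
    qed
  qed
  then have lim: "(?w \<longlongrightarrow> 1 / q) at_top" by (rule LIM_zero_cancel)
  have "((\<lambda>N. scaled_excess N (?w N)) \<longlongrightarrow> 1 / q - z) at_top"
    by (rule scaled_excess_limit_of_subordination_limit[OF lim tendsto_const]) (use z in simp)
  also have "1 / q - z = - q" by (simp add: q(2)[symmetric])
  finally show ?thesis .
qed

text \<open>At \<open>\<i>\<close> the limiting map \<open>w + 1 / w\<close> vanishes with derivative \<open>2\<close>, so Newton's map
  \<open>w - (w + 1 / w) / 2\<close> contracts near \<open>\<i>\<close>; its perturbation still has a fixed point there, and by
  uniqueness this is the value of the subordination function, even for \<open>\<zeta>\<close> close to the real axis.\<close>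

lemma scaled_subordination_limit_origin:
  assumes \<zeta>: "(\<zeta> \<longlongrightarrow> 0) at_top" and pos: "\<forall>\<^sub>F N in at_top. Im (\<zeta> N) > 0"
  shows "((\<lambda>N. scaled_subordination N (\<zeta> N)) \<longlongrightarrow> \<i>) at_top"
proof (rule tendstoI)
  fix \<epsilon> :: real assume \<epsilon>: "\<epsilon> > 0"
  \<comment> \<open>The bound 1/2 keeps the disc around \<i> above height 1/2 and makes
    \<open>\<delta>\<^sup>2 \<le> \<delta> / 2\<close>. The three perturbations, each at most
    \<open>\<delta> / 4\<close> and then halved, fit into the remaining \<open>\<delta> / 2\<close>;
    one of them, \<open>2 / N\<close>, leads to the threshold \<open>8 / \<delta>\<close>.\<close>
  define \<delta> where "\<delta> = min (1/2) (\<epsilon> / 2)"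
  have \<delta>: "\<delta> > 0" "\<delta> \<le> 1/2" "\<delta> < \<epsilon>" using \<epsilon> by (auto simp: \<delta>_def)
  have "\<forall>\<^sub>F N in at_top. dist (\<zeta> N) 0 < \<delta> / 4" using \<zeta> \<delta>(1) by (intro tendstoD) auto
  moreover have "\<forall>\<^sub>F N in at_top. \<forall>w. Im w \<ge> 1/2 \<and> cmod w \<le> 3/2 \<longrightarrow> cmod (scaled_excess N w + 1 / w) < \<delta> / 4"
    using \<delta>(1) by (intro scaled_excess_uniform_limit) auto
  ultimately show "\<forall>\<^sub>F N in at_top. dist (scaled_subordination N (\<zeta> N)) \<i> < \<epsilon>"
    using pos eventually_ge_at_top[of "max 1 (8 / \<delta>)"]
  proof eventually_elim
    case (elim N)
    then have N: "N \<ge> 1" "8 / \<delta> \<le> N" and \<zeta>N: "cmod (\<zeta> N) < \<delta> / 4" "Im (\<zeta> N) > 0" by auto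
    define T where "T w = w - (w - (1 - 1 / of_real N) * scaled_excess N w - \<zeta> N) / 2" for w
    have ball: "Im w \<ge> 1/2" "cmod w \<le> 3/2" "cmod w \<ge> 1/2" if "w \<in> cball \<i> \<delta>" for w
    proof -
      have d: "cmod (\<i> - w) \<le> 1/2" using that \<delta> by (simp add: dist_norm)
      show 1: "Im w \<ge> 1/2" using abs_Im_le_cmod[of "\<i> - w"] d by simp
      show "cmod w \<le> 3/2" using norm_triangle_sub[of w \<i>] d by (simp add: norm_minus_commute)
      show "cmod w \<ge> 1/2" using 1 abs_Im_le_cmod[of w] by simp
    qed
    obtain w where w: "w \<in> cball \<i> \<delta>" "T w = w"
    proof (rule brouwer[of "cball \<i> \<delta>" T])
      have "continuous_on (cball \<i> \<delta>) (\<lambda>w. excess (of_real (sqrt N) * w))"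
      proof (rule continuous_on_compose2[OF continuous_on_excess[OF subset_refl]])
        show "(\<lambda>w. of_real (sqrt N) * w) ` cball \<i> \<delta> \<subseteq> upper_half_plane"
          using ball(1) N by (fastforce simp: upper_half_plane_def)
      qed (intro continuous_intros)
      then show "continuous_on (cball \<i> \<delta>) T"
        unfolding T_def scaled_excess_def by (intro continuous_intros) auto
      show "T \<in> cball \<i> \<delta> \<rightarrow> cball \<i> \<delta>"
      proof
        fix w assume w: "w \<in> cball \<i> \<delta>"
        note b = ball[OF w]
        have w0: "w \<noteq> 0" using b(3) by auto
        define s where "s = scaled_excess N w"
        have 1: "cmod (s + 1 / w) < \<delta> / 4" unfolding s_def using elim b by blast
        have 2: "cmod (s / of_real N) \<le> \<delta> / 4"
        proof -
          have "cmod s \<le> 1 / Im w" unfolding s_def using b N by (intro norm_scaled_excess_le) auto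
          also have "\<dots> \<le> 1 / (1/2)" using b by (intro divide_left_mono) auto
          finally have "cmod (s / of_real N) \<le> 2 / N"
            using N by (simp add: norm_divide divide_right_mono)
          also have "\<dots> \<le> \<delta> / 4" using N \<delta> by (simp add: field_simps)
          finally show ?thesis .
        qed
        have 3: "cmod ((w - \<i>)\<^sup>2 / (2 * w)) \<le> \<delta> / 2"
        proof -
          have "cmod (w - \<i>) \<le> \<delta>" using w by (simp add: dist_norm norm_minus_commute)
          then have "(cmod (w - \<i>))\<^sup>2 \<le> \<delta>\<^sup>2" by (intro power_mono) auto
          then have "cmod ((w - \<i>)\<^sup>2 / (2 * w)) \<le> \<delta>\<^sup>2 / 1"
            unfolding norm_divide norm_power using b(3) by (intro frac_le) (auto simp: norm_mult)
          also have "\<dots> \<le> \<delta> / 2" using \<delta> by (simp add: power2_eq_square)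
          finally show ?thesis .
        qed
        \<comment> \<open>The left side is the exact error of Newton's step for
          \<open>w + 1 / w\<close> at the root \<i>, hence quadratic in the distance.\<close>
        have sq: "(w - \<i>)\<^sup>2 / (2 * w) = w / 2 - \<i> - 1 / w / 2"
        proof -
          have "(w - \<i>)\<^sup>2 = 2 * w * (w / 2 - \<i> - 1 / w / 2)"
            using w0 by (simp add: power2_eq_square algebra_simps)
          then show ?thesis using w0 by simp
        qed
        have "T w - \<i> = (w - \<i>)\<^sup>2 / (2 * w) + (((s + 1 / w) - s / of_real N) + \<zeta> N) / 2"
          unfolding sq T_def s_def[symmetric]
          by (simp add: left_diff_distrib diff_divide_distrib add_divide_distrib)
        also have "cmod \<dots> \<le> cmod ((w - \<i>)\<^sup>2 / (2 * w)) + cmod (((s + 1 / w) - s / of_real N) + \<zeta> N) / 2"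
          by (intro norm_triangle_le) (simp add: norm_divide)
        finally have "cmod (T w - \<i>) \<le> cmod ((w - \<i>)\<^sup>2 / (2 * w)) + cmod (((s + 1 / w) - s / of_real N) + \<zeta> N) / 2" .
        moreover have "cmod (((s + 1 / w) - s / of_real N) + \<zeta> N) \<le> cmod (s + 1 / w) + cmod (s / of_real N) + cmod (\<zeta> N)"
          by (intro norm_triangle_le add_right_mono norm_triangle_ineq4)
        ultimately have "cmod (T w - \<i>) \<le> \<delta>" using 1 2 3 \<zeta>N(1) \<delta>(1) by linarith
        then show "T w \<in> cball \<i> \<delta>" by (simp add: dist_norm norm_minus_commute)
      qed
    qed (use \<delta> in auto)
    have "scaled_subordination N (\<zeta> N) = w"
    proof (rule scaled_subordination_eqI[OF N(1) \<zeta>N(2)])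
      show "Im w > 0" using ball(1)[OF w(1)] by simp
      have "w - (1 - 1 / of_real N) * scaled_excess N w - \<zeta> N = 0"
        using w(2) by (simp add: T_def)
      then show "w = \<zeta> N + (1 - 1 / of_real N) * scaled_excess N w"
        by (simp add: diff_eq_eq add.commute)
    qed
    then show ?case using w(1) \<delta> by (simp add: dist_commute)
  qed
qed

end

theorem theorem1p1:
  fixes \<mu> :: "real measure" and \<alpha> t :: real and M :: "real \<Rightarrow> real"
  assumes "real_distribution \<mu>"
    and "integrable \<mu> (\<lambda>x. x)" and "(LINT x|\<mu>. x) = 0"
    and "integrable \<mu> (\<lambda>x. x\<^sup>2)" and "prob_space.variance \<mu> (\<lambda>x. x) = 1"
    and "\<And>N. N \<ge> 1 \<Longrightarrow> M N > 0"
    and "t > 0"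
    and "((\<lambda>N. M N * N powr (\<alpha> + 1/2)) \<longlongrightarrow> t) at_top"
  shows "(\<alpha> > -1/2 \<longrightarrow>
            weakly_converges
              (\<lambda>N. dilation (N powr \<alpha>) (boolean_power (free_power \<mu> N) (M N)))
              (cauchy_distribution t) at_top) \<and>
         (\<alpha> = -1/2 \<longrightarrow>
            weakly_converges
              (\<lambda>N. dilation (N powr \<alpha>) (boolean_power (free_power \<mu> N) (M N)))
              (boolean_power semicircle_distribution t) at_top) \<and>
         (\<alpha> < -1/2 \<longrightarrow>
            weakly_converges
              (\<lambda>N. dilation (N powr \<alpha>) (boolean_power (free_power \<mu> N) (M N)))
              (return borel 0) at_top)"
proof -
  interpret real_distribution \<mu> by (rule assms(1))
  \<comment> \<open>The variance is the second moment because the mean vanishes.\<close>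
  interpret standardized_distribution \<mu>
    by unfold_locales (use assms(2-5) in auto)
  let ?\<nu> = "\<lambda>N. dilation (N powr \<alpha>) (boolean_power (free_power \<mu> N) (M N))"
  let ?e = "\<lambda>z N. scaled_excess N (scaled_subordination N (of_real (N powr (- \<alpha> - 1/2)) * z))"
  have \<nu>: "real_distribution (?\<nu> N)" if "N \<ge> 1" for N
    by (rule real_distribution_dilated_power[OF that assms(6)[OF that]])
  have F: "((\<lambda>N. F_transform (?\<nu> N) z) \<longlongrightarrow> z + of_real t * l) at_top"
    if "(?e z \<longlongrightarrow> l) at_top" "Im z > 0" for z l
  proof (rule Lim_transform_eventually)
    show "((\<lambda>N. z + of_real (M N * N powr (\<alpha> + 1/2)) * ?e z N) \<longlongrightarrow> z + of_real t * l) at_top"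
      by (intro tendsto_intros assms(8) that(1))
    show "\<forall>\<^sub>F N in at_top. z + of_real (M N * N powr (\<alpha> + 1/2)) * ?e z N = F_transform (?\<nu> N) z"
      using eventually_ge_at_top[of 1]
      by eventually_elim (rule F_transform_dilated_power[OF _ assms(6) that(2), symmetric])
  qed
  have "weakly_converges ?\<nu> (cauchy_distribution t) at_top" if "\<alpha> > -1/2"
  proof (rule weakly_converges_of_F_transform[OF \<nu> real_distribution_cauchy[OF assms(7)]])
    fix z :: complex assume z: "Im z > 0"
    have "((\<lambda>N::real. N powr (- \<alpha> - 1/2)) \<longlongrightarrow> 0) at_top"
      using that by (intro tendsto_neg_powr filterlim_ident) simp
    then have "((\<lambda>N. of_real (N powr (- \<alpha> - 1/2)) * z) \<longlongrightarrow> of_real 0 * z) at_top"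
      by (intro tendsto_intros)
    then have \<zeta>: "((\<lambda>N. of_real (N powr (- \<alpha> - 1/2)) * z) \<longlongrightarrow> 0) at_top" by simp
    have pos: "\<forall>\<^sub>F N in at_top. Im (of_real (N powr (- \<alpha> - 1/2)) * z) > 0"
      using eventually_gt_at_top[of 0] by eventually_elim (use z in simp)
    \<comment> \<open>The limit does not depend on \<open>z\<close>, which turns the limiting
      F-transform into a translation by \<open>\<i> t\<close>.\<close>
    have "(?e z \<longlongrightarrow> \<i> - 0) at_top"
      by (rule scaled_excess_limit_of_subordination_limit[OF scaled_subordination_limit_origin[OF \<zeta> pos] \<zeta> pos])
    from F[OF this z] show "((\<lambda>N. F_transform (?\<nu> N) z) \<longlongrightarrow> F_transform (cauchy_distribution t) z) at_top"
      using F_transform_cauchy[OF assms(7) z] by (simp add: mult.commute)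
  qed
  moreover have "weakly_converges ?\<nu> (boolean_power semicircle_distribution t) at_top" if \<alpha>: "\<alpha> = -1/2"
  proof -
    interpret sc: real_distribution semicircle_distribution by (rule real_distribution_semicircle)
    have F_sc: "F_transform semicircle_distribution z - z = - cauchy_transform semicircle_distribution z"
      if z: "Im z > 0" for z
    proof -
      obtain q where q: "q \<noteq> 0" "cmod q < 1" "q + 1 / q = z" by (rule joukowski_root_exists[OF z])
      show ?thesis
        unfolding F_transform_semicircle[OF q z] cauchy_transform_semicircle[OF q z] by simp
    qed
    then have near: "cmod (F_transform semicircle_distribution z - z) \<le> 1 / Im z" if "Im z > 0" for z
      using sc.norm_cauchy_transform_le[OF that] that by simp
    show ?thesis
    proof (rule weakly_converges_of_F_transform[OF \<nu> sc.real_distribution_boolean_power[OF assms(7) near]])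
      fix z :: complex assume z: "Im z > 0"
      obtain q where q: "q \<noteq> 0" "cmod q < 1" "q + 1 / q = z" by (rule joukowski_root_exists[OF z])
      have G: "cauchy_transform semicircle_distribution z = q" by (rule cauchy_transform_semicircle[OF q z])
      have "((\<lambda>N. scaled_excess N (scaled_subordination N z)) \<longlongrightarrow> - q) at_top"
        \<comment> \<open>That \<open>q\<close> lies in the lower half-plane is obtained from its
          being a value of a Cauchy transform.\<close>
        using sc.Im_cauchy_transform_neg[OF z] unfolding G
        by (rule scaled_excess_limit_semicircle[OF z q(1,3)])
      \<comment> \<open>The exponent is now 0, and \<open>N powr 0 = 1\<close> holds for nonzero
        \<open>N\<close>, so the argument \<zeta> is \<open>z\<close> itself.\<close>
      moreover have "\<forall>\<^sub>F N in at_top. scaled_excess N (scaled_subordination N z) = ?e z N"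
        using eventually_gt_at_top[of 0] by eventually_elim (simp add: \<alpha>)
      ultimately have "(?e z \<longlongrightarrow> - q) at_top" by (rule Lim_transform_eventually)
      from F[OF this z] show "((\<lambda>N. F_transform (?\<nu> N) z) \<longlongrightarrow> F_transform (boolean_power semicircle_distribution t) z) at_top"
        using sc.F_transform_boolean_power[OF assms(7) near z] F_sc[OF z] G by simp
    qed
  qed
  moreover have "weakly_converges ?\<nu> (return borel 0) at_top" if "\<alpha> < -1/2"
  proof (rule weakly_converges_of_F_transform[OF \<nu> real_distribution_return])
    fix z :: complex assume z: "Im z > 0"
    have "filterlim (\<lambda>N::real. N powr (- \<alpha> - 1/2)) at_top at_top"
      using that by real_asymp
    from F[OF scaled_excess_limit_infinity[OF this z] z]
    show "((\<lambda>N. F_transform (?\<nu> N) z) \<longlongrightarrow> F_transform (return borel 0) z) at_top"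
      by (simp add: F_transform_return)
  qed
  ultimately show ?thesis by blast
qed

end
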